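(* 1. Let $u=\alpha X^n$ where $0\neq n\in\mathbb{Z}$ and $\alpha$ is a nonzero monic element of $K(H)$. (i) The algebra $N(u,B)$ is generated by the algebra $C(u,B)$ and the element $H$. If $C(u,B)=K[v,v^{-1}]$, where $v=\beta X^t$ is the canonical generator of $C(u,B)$, then the algebra $N(u,B)$ is the skew Laurent extension $K[H][v,v^{-1};\sigma^t]$. So $N(u,B)$ is an affine Noetherian algebra. (ii) For $j\geq 0$, $N(u,j,B)=\sum_{i=0}^{j}C(u,B)H^i$ and $H^j\in N(u,j,B)\setminus N(u,j-1,B)$. (iii) The associated graded algebra $\mathcal{G}(u,B)$ is the polynomial algebra $C(u,B)[h]$ with coefficients from $C(u,B)$, where $h:=H+C(u,B)\in N(u,1,B)/C(u,B)$. Hence $\mathcal{G}(u,B)$ is an affine commutative algebra. 2. Let $u\in K(H)\setminus K$. Then $N(u,B)=C(u,B)=K(H)$.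
   Context: $K$ is a field of characteristic zero, $K(H)$ is the field of rational functions in $H$, and $\sigma$ is the $K$-automorphism of $K(H)$ with $\sigma(H)=H-1$. $B=K(H)[X,X^{-1};\sigma]=\bigoplus_{i\in\mathbb{Z}}K(H)X^i$ is the skew Laurent polynomial ring with $X\alpha=\sigma(\alpha)X$ for $\alpha\in K(H)$. An element of $K(H)$ is monic if it is a quotient of two polynomials with leading coefficient $1$. "Affine" means finitely generated as a $K$-algebra. For a non-scalar $u\in B$, $\mathrm{ad}\,u(b)=ub-bu$, $N(u,i,B)=\ker(\mathrm{ad}\,u)^{i+1}$ (kernel in $B$) for $i\geq 0$, $N(u,-1,B)=0$, $N(u,B)=\bigcup_{i\geq 0}N(u,i,B)$ (an $\mathbb{N}$-filtered algebra), and $C(u,B)=N(u,0,B)$ is the centralizer of $u$ in $B$. The associated graded algebra is $\mathcal{G}(u,B)=\bigoplus_{i\geq 0}N(u,i,B)/N(u,i-1,B)$. Canonical generator: for $u=\alpha X^n$ with $n\neq 0$ and $\alpha$ monic, let $s$ be the minimal positive divisor of $n$ for which, with $t=\mathrm{sign}(n)s$, there exists a monic $\beta\in K(H)$ (then unique) with $\beta\,\sigma^{t}(\beta)\,\sigma^{2t}(\beta)\cdots\sigma^{(n/t-1)t}(\beta)=\alpha$. Then $v=\beta X^{t}$ satisfies $v^{n/t}=u$ and $C(u,B)=K[v,v^{-1}]$ is a Laurent polynomial ring; $v$ is called the canonical generator of $C(u,B)$. *)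

theory Defs
  imports
    "HOL-Algebra.Algebra"
    "HOL-Algebra.UnivPoly"
    "HOL-Algebra.Product_Groups"
    "HOL-Algebra.Algebraic_Closure_Type"
    "HOL-Computational_Algebra.Polynomial_Factorial"
begin

text \<open>A \<open>K\<close>-algebra is a (not necessarily commutative) ring \<open>R\<close> with a structure map
  \<open>\<iota>\<close> from the field \<open>K\<close>, here the type \<open>'k\<close>, to the centre of \<open>R\<close>.\<close>

definition is_algebra :: "('k::field \<Rightarrow> 'r) \<Rightarrow> ('r, 'm) ring_scheme \<Rightarrow> bool" where
  "is_algebra \<iota> R \<longleftrightarrow>
     ring R \<and> \<iota> \<in> ring_hom (ring_of_type_algebra :: 'k ring) R \<and>
     (\<forall>c. \<forall>x\<in>carrier R. \<iota> c \<otimes>\<^bsub>R\<^esub> x = x \<otimes>\<^bsub>R\<^esub> \<iota> c)"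

definition algebra_generated :: "('k::field \<Rightarrow> 'r) \<Rightarrow> ('r, 'm) ring_scheme \<Rightarrow> 'r set \<Rightarrow> 'r set" where
  "algebra_generated \<iota> R S = generate_ring R (range \<iota> \<union> S)"

definition affine_algebra :: "('k::field \<Rightarrow> 'r) \<Rightarrow> ('r, 'm) ring_scheme \<Rightarrow> bool" where
  "affine_algebra \<iota> R \<longleftrightarrow>
     is_algebra \<iota> R \<and> (\<exists>S. finite S \<and> S \<subseteq> carrier R \<and> algebra_generated \<iota> R S = carrier R)"

definition left_ideal :: "'r set \<Rightarrow> ('r, 'm) ring_scheme \<Rightarrow> bool" where
  "left_ideal I R \<longleftrightarrow>
     additive_subgroup I R \<and> (\<forall>r\<in>carrier R. \<forall>x\<in>I. r \<otimes>\<^bsub>R\<^esub> x \<in> I)"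

definition right_ideal :: "'r set \<Rightarrow> ('r, 'm) ring_scheme \<Rightarrow> bool" where
  "right_ideal I R \<longleftrightarrow>
     additive_subgroup I R \<and> (\<forall>r\<in>carrier R. \<forall>x\<in>I. x \<otimes>\<^bsub>R\<^esub> r \<in> I)"

text \<open>The library locale \<^locale>\<open>noetherian_ring\<close> only speaks about two-sided ideals; for
  a noncommutative ring, Noetherian means left and right Noetherian.\<close>

definition lr_noetherian :: "('r, 'm) ring_scheme \<Rightarrow> bool" where
  "lr_noetherian R \<longleftrightarrow>
     ring R \<and>
     (\<forall>I. left_ideal I R \<longrightarrow>
        (\<exists>A. finite A \<and> A \<subseteq> carrier R \<and> I = \<Inter> {J. left_ideal J R \<and> A \<subseteq> J})) \<and>
     (\<forall>I. right_ideal I R \<longrightarrow>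
        (\<exists>A. finite A \<and> A \<subseteq> carrier R \<and> I = \<Inter> {J. right_ideal J R \<and> A \<subseteq> J}))"

definition iter_int :: "'r set \<Rightarrow> ('r \<Rightarrow> 'r) \<Rightarrow> int \<Rightarrow> 'r \<Rightarrow> 'r" where
  "iter_int S \<tau> i = (if 0 \<le> i then \<tau> ^^ nat i else inv_into S \<tau> ^^ nat (- i))"

text \<open>\<open>R[X, X\<^sup>-\<^sup>1; \<tau>]\<close> for an automorphism \<open>\<tau>\<close> of \<open>R\<close>, coefficients on the left: the
  function \<open>f\<close> stands for \<open>\<Sum>i. f i X\<^sup>i\<close>, and \<open>a X\<^sup>i \<cdot> b X\<^sup>j = a \<tau>\<^sup>i(b) X\<^sup>i\<^sup>+\<^sup>j\<close>.\<close>

definition skew_laurent :: "('r, 'm) ring_scheme \<Rightarrow> ('r \<Rightarrow> 'r) \<Rightarrow> (int \<Rightarrow> 'r) ring" where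
  "skew_laurent R \<tau> = \<lparr>
     partial_object.carrier = {f. range f \<subseteq> carrier R \<and> finite {i. f i \<noteq> \<zero>\<^bsub>R\<^esub>}},
     monoid.mult = (\<lambda>f g k. \<Oplus>\<^bsub>R\<^esub>i\<in>{i. f i \<noteq> \<zero>\<^bsub>R\<^esub>}. f i \<otimes>\<^bsub>R\<^esub> iter_int (carrier R) \<tau> i (g (k - i))),
     monoid.one = (\<lambda>i. if i = 0 then \<one>\<^bsub>R\<^esub> else \<zero>\<^bsub>R\<^esub>),
     ring.zero = (\<lambda>i. \<zero>\<^bsub>R\<^esub>),
     ring.add = (\<lambda>f g i. f i \<oplus>\<^bsub>R\<^esub> g i)\<rparr>"

text \<open>The substitution \<open>\<Sum>i. f i X\<^sup>i \<mapsto> \<Sum>i. \<phi>(f i) v\<^sup>i\<close> for a unit \<open>v\<close> of \<open>S\<close>.\<close>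

definition laurent_subst ::
    "('r, 'm) ring_scheme \<Rightarrow> ('s, 'n) ring_scheme \<Rightarrow> ('r \<Rightarrow> 's) \<Rightarrow> 's \<Rightarrow> (int \<Rightarrow> 'r) \<Rightarrow> 's" where
  "laurent_subst R S \<phi> v f = (\<Oplus>\<^bsub>S\<^esub>i\<in>{i. f i \<noteq> \<zero>\<^bsub>R\<^esub>}. \<phi> (f i) \<otimes>\<^bsub>S\<^esub> v [^]\<^bsub>S\<^esub> i)"

definition ad :: "('r, 'm) ring_scheme \<Rightarrow> 'r \<Rightarrow> 'r \<Rightarrow> 'r" where
  "ad R u b = u \<otimes>\<^bsub>R\<^esub> b \<ominus>\<^bsub>R\<^esub> b \<otimes>\<^bsub>R\<^esub> u"

text \<open>\<open>N(u,i,R)\<close>; the index is an integer so that \<open>N(u,-1,R) = 0\<close> makes sense.\<close>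

definition Nfilt :: "('r, 'm) ring_scheme \<Rightarrow> 'r \<Rightarrow> int \<Rightarrow> 'r set" where
  "Nfilt R u i =
     (if i < 0 then {\<zero>\<^bsub>R\<^esub>} else {b \<in> carrier R. (ad R u ^^ (nat i + 1)) b = \<zero>\<^bsub>R\<^esub>})"

definition Nalg :: "('r, 'm) ring_scheme \<Rightarrow> 'r \<Rightarrow> 'r set" where
  "Nalg R u = (\<Union>i::nat. Nfilt R u (int i))"

definition Cent :: "('r, 'm) ring_scheme \<Rightarrow> 'r \<Rightarrow> 'r set" where
  "Cent R u = Nfilt R u 0"

text \<open>For subgroups \<open>F(-1) = 0 \<subseteq> F(0) \<subseteq> F(1) \<subseteq> \<dots>\<close> of \<open>R\<close> with \<open>F(i) F(j) \<subseteq> F(i+j)\<close>: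
  the elements are the finitely supported families of cosets \<open>f i \<in> F(i)/F(i-1)\<close>, and
  \<open>(a + F(i-1)) (b + F(j-1)) = ab + F(i+j-1)\<close>. Mind that the groups \<open>F(i)/F(i-1)\<close> and
  their direct sum are written multiplicatively in the library, so that \<^const>\<open>finprod\<close>
  below is a sum of cosets.\<close>

definition gr_piece :: "('r, 'm) ring_scheme \<Rightarrow> (int \<Rightarrow> 'r set) \<Rightarrow> nat \<Rightarrow> 'r set monoid" where
  "gr_piece R F i = (R\<lparr>carrier := F (int i)\<rparr>) A_Mod (F (int i - 1))"

definition assoc_graded :: "('r, 'm) ring_scheme \<Rightarrow> (int \<Rightarrow> 'r set) \<Rightarrow> (nat \<Rightarrow> 'r set) ring" where
  "assoc_graded R F = \<lparr>
     partial_object.carrier = carrier (sum_group UNIV (gr_piece R F)),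
     monoid.mult = (\<lambda>f g k. finprod (gr_piece R F k)
               (\<lambda>i. rcoset_mult R (F (int k - 1)) (f i) (g (k - i))) {..k}),
     monoid.one = (\<lambda>k. if k = 0 then F (- 1) +>\<^bsub>R\<^esub> \<one>\<^bsub>R\<^esub> else F (int k - 1)),
     ring.zero = \<one>\<^bsub>sum_group UNIV (gr_piece R F)\<^esub>,
     ring.add = (\<otimes>\<^bsub>sum_group UNIV (gr_piece R F)\<^esub>)\<rparr>"

text \<open>The class \<open>a + F(i-1)\<close> of \<open>a \<in> F(i)\<close>, placed in degree \<open>i\<close>.\<close>

definition gr_class :: "('r, 'm) ring_scheme \<Rightarrow> (int \<Rightarrow> 'r set) \<Rightarrow> nat \<Rightarrow> 'r \<Rightarrow> nat \<Rightarrow> 'r set" where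
  "gr_class R F i a = (\<lambda>k. if k = i then F (int i - 1) +>\<^bsub>R\<^esub> a else F (int k - 1))"

text \<open>\<open>K[H]\<close> is \<^typ>\<open>'k poly\<close> and \<open>K(H)\<close> is its fraction field \<^typ>\<open>'k poly fract\<close>.\<close>

abbreviation KfracH :: "'k::field_char_0 poly fract ring" where
  "KfracH \<equiv> ring_of_type_algebra"

definition KpolyH :: "'k::field_char_0 poly fract ring" where
  "KpolyH = KfracH\<lparr>carrier := range to_fract\<rparr>"

text \<open>\<open>\<sigma>\<close> substitutes \<open>H - 1\<close> for \<open>H\<close> in numerator and denominator; the choice of the
  representation is immaterial by the lemma \<open>sigma_Fract\<close>.\<close>

definition sigma :: "'k::field_char_0 poly fract \<Rightarrow> 'k poly fract" where
  "sigma x = (case SOME (p, q). q \<noteq> 0 \<and> x = Fraction_Field.Fract p q of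
     (p, q) \<Rightarrow> Fraction_Field.Fract (pcompose p [:- 1, 1:]) (pcompose q [:- 1, 1:]))"

lemma sigma_Fract:
  fixes p q :: "'k::field_char_0 poly"
  assumes "q \<noteq> 0"
  shows "sigma (Fraction_Field.Fract p q) =
    Fraction_Field.Fract (pcompose p [:- 1, 1:]) (pcompose q [:- 1, 1:])"
proof -
  define r where
    "r = (SOME (p', q'). q' \<noteq> 0 \<and> Fraction_Field.Fract p q = Fraction_Field.Fract p' q')"
  obtain p' q' where r: "r = (p', q')" by (cases r)
  have "case r of (p', q') \<Rightarrow> q' \<noteq> 0 \<and> Fraction_Field.Fract p q = Fraction_Field.Fract p' q'"
    unfolding r_def by (rule someI[where x = "(p, q)"]) (simp add: assms)
  then have q': "q' \<noteq> 0" and eq: "p * q' = p' * q"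
    using assms eq_fract(1)[of q q' p p'] by (auto simp: r)
  from eq have "pcompose p [:- 1, 1:] * pcompose q' [:- 1, 1:] =
      pcompose p' [:- 1, 1:] * pcompose q [:- 1, 1:]"
    by (simp flip: pcompose_mult)
  then show ?thesis
    using assms q' by (simp add: sigma_def flip: r_def) (simp add: r eq_fract pcompose_eq_0_iff)
qed

abbreviation sigma_pow :: "int \<Rightarrow> 'k::field_char_0 poly fract \<Rightarrow> 'k poly fract" where
  "sigma_pow i \<equiv> iter_int UNIV sigma i"

definition BB :: "(int \<Rightarrow> 'k::field_char_0 poly fract) ring" where
  "BB = skew_laurent KfracH sigma"

definition lmonom :: "'k::field_char_0 poly fract \<Rightarrow> int \<Rightarrow> int \<Rightarrow> 'k poly fract" where
  "lmonom \<alpha> n = (\<lambda>i. if i = n then \<alpha> else 0)"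

definition scalarB :: "'k::field_char_0 \<Rightarrow> int \<Rightarrow> 'k poly fract" where
  "scalarB c = lmonom (to_fract [:c:]) 0"

definition HB :: "int \<Rightarrow> 'k::field_char_0 poly fract" where
  "HB = lmonom (to_fract [:0, 1:]) 0"

lemma X_comm:
  fixes \<alpha> :: "'k::field_char_0 poly fract"
  shows "lmonom 1 1 \<otimes>\<^bsub>BB\<^esub> lmonom \<alpha> 0 = lmonom (sigma \<alpha>) 0 \<otimes>\<^bsub>BB\<^esub> lmonom 1 1"
proof
  fix k :: int
  interpret ring "KfracH :: 'k poly fract ring" by (rule ring_from_type_algebra)
  have [simp]: "carrier (KfracH :: 'k poly fract ring) = UNIV" "\<zero>\<^bsub>KfracH\<^esub> = (0 :: 'k poly fract)"
    "\<And>x y :: 'k poly fract. x \<otimes>\<^bsub>KfracH\<^esub> y = x * y" "\<And>x y :: 'k poly fract. x \<oplus>\<^bsub>KfracH\<^esub> y = x + y"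
    by (simp_all add: ring_of_type_algebra_def)
  have [simp]: "finsum KfracH f {i} = f i" for f :: "int \<Rightarrow> 'k poly fract" and i
    using finsum_insert[of "{}" i f] by simp
  have [simp]: "sigma 0 = (0 :: 'k poly fract)"
    by (simp add: Zero_fract_def sigma_Fract pcompose_1)
  have l: "{i :: int. lmonom 1 1 i \<noteq> (0 :: 'k poly fract)} = {1}"
    by (auto simp: lmonom_def)
  have r: "{i. lmonom (sigma \<alpha>) 0 i \<noteq> 0} = (if sigma \<alpha> = 0 then {} else {0})"
    by (auto simp: lmonom_def)
  show "(lmonom 1 1 \<otimes>\<^bsub>BB\<^esub> lmonom \<alpha> 0) k = (lmonom (sigma \<alpha>) 0 \<otimes>\<^bsub>BB\<^esub> lmonom 1 1) k"
    by (simp add: BB_def skew_laurent_def l r) (simp add: lmonom_def iter_int_def)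
qed

definition monic_fract :: "'k::field_char_0 poly fract \<Rightarrow> bool" where
  "monic_fract \<alpha> \<longleftrightarrow> (\<exists>p q. lead_coeff p = 1 \<and> lead_coeff q = 1 \<and> \<alpha> = Fraction_Field.Fract p q)"

text \<open>\<open>(\<beta> X^t)^m = \<alpha> X^n\<close> with \<open>m = n/t\<close>; to be used when \<open>t\<close> divides \<open>n\<close> and has the same
  sign, so that \<open>m > 0\<close>.\<close>

definition sigma_root ::
    "'k::field_char_0 poly fract \<Rightarrow> int \<Rightarrow> int \<Rightarrow> 'k poly fract \<Rightarrow> bool" where
  "sigma_root \<alpha> n t \<beta> \<longleftrightarrow>
     monic_fract \<beta> \<and> (\<Prod>k<nat (n div t). sigma_pow (int k * t) \<beta>) = \<alpha>"

text \<open>\<open>\<beta> X\<^sup>t\<close> is the canonical generator of \<open>C(\<alpha> X\<^sup>n, B)\<close>.\<close>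

definition canonical_generator ::
    "'k::field_char_0 poly fract \<Rightarrow> int \<Rightarrow> int \<Rightarrow> 'k poly fract \<Rightarrow> bool" where
  "canonical_generator \<alpha> n t \<beta> \<longleftrightarrow>
     (\<exists>s>0. s dvd n \<and> t = sgn n * s \<and> sigma_root \<alpha> n t \<beta> \<and>
        (\<forall>s'>0. s' dvd n \<longrightarrow> (\<exists>\<beta>'. sigma_root \<alpha> n (sgn n * s') \<beta>') \<longrightarrow> s \<le> s'))"

lemma canonical_generator_exists:
  assumes "n \<noteq> 0" "monic_fract \<alpha>"
  shows "\<exists>t \<beta>. canonical_generator \<alpha> n t \<beta>"
proof -
  define P where "P m \<longleftrightarrow> 0 < m \<and> int m dvd n \<and> (\<exists>\<beta>. sigma_root \<alpha> n (sgn n * int m) \<beta>)" for m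
  have "n div (sgn n * \<bar>n\<bar>) = 1" using assms(1) by (simp add: sgn_mult_abs)
  then have "sigma_root \<alpha> n (sgn n * \<bar>n\<bar>) \<alpha>"
    using assms(2) by (simp add: sigma_root_def iter_int_def)
  then have ex: "P (nat \<bar>n\<bar>)" using assms(1) by (auto simp: P_def)
  define m where "m = (LEAST m. P m)"
  have m: "P m" unfolding m_def using ex by (rule LeastI)
  then obtain \<beta> where \<beta>: "sigma_root \<alpha> n (sgn n * int m) \<beta>" by (auto simp: P_def)
  have "int m \<le> s'" if "s' > 0" "s' dvd n" "sigma_root \<alpha> n (sgn n * s') \<beta>'" for s' \<beta>'
  proof -
    have "P (nat s')" using that by (auto simp: P_def)
    then have "m \<le> nat s'" unfolding m_def by (rule Least_le)
    then show ?thesis using that(1) by simp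
  qed
  then have "canonical_generator \<alpha> n (sgn n * int m) \<beta>"
    unfolding canonical_generator_def using m \<beta> by (intro exI[of _ "int m"]) (auto simp: P_def)
  then show ?thesis by blast
qed

abbreviation GG :: "(int \<Rightarrow> 'k::field_char_0 poly fract) \<Rightarrow> (nat \<Rightarrow> (int \<Rightarrow> 'k poly fract) set) ring" where
  "GG u \<equiv> assoc_graded BB (Nfilt BB u)"

end

theory Submission
  imports Defs
begin

text \<open>
  Grade \<open>B\<close> by the powers of \<open>X\<close>. As \<open>u = \<alpha>X\<^sup>n\<close> is homogeneous, \<open>ad u\<close> acts on coefficients, and
  \<open>bX\<^sup>i\<close> commutes with \<open>u\<close> iff \<open>\<alpha> \<sigma>\<^sup>n(b) = b \<sigma>\<^sup>i(\<alpha>)\<close>. Minimality of the canonical generator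
  \<open>v = \<beta>X\<^sup>t\<close> forces \<open>t dvd i\<close> if \<open>b \<noteq> 0\<close>. An element of \<open>N(u, B)\<close> is therefore a sum of terms \<open>x v\<^sup>m\<close>
  with \<open>x \<in> K(H)\<close>, and \<open>ad u (x v\<^sup>m) = (\<sigma>\<^sup>n(x) - x) u v\<^sup>m\<close>. Since the fixed field of \<open>\<sigma>\<^sup>n\<close> is \<open>K\<close> and
  \<open>\<sigma>\<^sup>n - 1\<close> maps the polynomials of degree at most \<open>j + 1\<close> onto those of degree at most \<open>j\<close>, the kernel of
  \<open>(\<sigma>\<^sup>n - 1)\<^sup>j\<^sup>+\<^sup>1\<close> on \<open>K(H)\<close> consists of the polynomials of degree at most \<open>j\<close>. So \<open>N(u, j, B)\<close> is the
  set of all \<open>\<Sum>m. g m v\<^sup>m\<close> with polynomials \<open>g m\<close> of degree at most \<open>j\<close>, and everything else is read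
  off this normal form.
\<close>

subsection \<open>The shift automorphisms of \<open>K(H)\<close>\<close>

text \<open>Two conclusions are not simply read off. Noetherianity needs a Hilbert basis argument.
  As K[H] is Euclidean, ideals of leading coefficients can be replaced by a single element whose
  leading coefficient has the least degree over all exponents: multiplied by powers of v it serves
  as divisor in every higher exponent, and only the finitely many exponents below it need generators
  of their own. The argument is carried out once, on families of polynomials with a twist parameter,
  because left and right ideals differ only in the direction of the twist. The graded algebra is
  commutative although N(u, B) is not, and the reason is again the difference operator: moving H^i
  past v^m replaces H^i by a shift of it, and H^i minus its shift has smaller degree, so commutators
  with C(u, B) fall one step in the filtration. Characteristic zero gives infinitely many distinct
  points a - k n, hence the fixed field K, and nonvanishing factors (d + 1) n, hence primitives for
  the difference operator.\<close>

definition pshift :: "int \<Rightarrow> 'k::field_char_0 poly \<Rightarrow> 'k poly" where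
  "pshift i p = pcompose p [:- of_int i, 1:]"

lemma pshift_0 [simp]: "pshift i 0 = 0"
  and pshift_1 [simp]: "pshift i 1 = 1"
  and pshift_const [simp]: "pshift i [:c:] = [:c:]"
  and pshift_add: "pshift i (p + q) = pshift i p + pshift i q"
  and pshift_diff: "pshift i (p - q) = pshift i p - pshift i q"
  and pshift_mult: "pshift i (p * q) = pshift i p * pshift i q"
  and pshift_smult: "pshift i (smult c p) = smult c (pshift i p)"
  by (simp_all add: pshift_def pcompose_1 pcompose_add pcompose_diff pcompose_mult pcompose_smult)

lemma pshift_pshift: "pshift i (pshift j p) = pshift (i + j) p"
  by (simp add: pshift_def pcompose_assoc[symmetric] pcompose_pCons algebra_simps)

lemma pshift_zero_shift [simp]: "pshift 0 p = p"
  by (simp add: pshift_def pcompose_idR)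

lemma degree_pshift [simp]: "degree (pshift i p) = degree p"
  by (simp add: pshift_def degree_pcompose)

lemma pshift_eq_0_iff [simp]: "pshift i p = 0 \<longleftrightarrow> p = 0"
  by (simp add: pshift_def pcompose_eq_0_iff)

lemma lead_coeff_pshift [simp]: "lead_coeff (pshift i p) = lead_coeff p"
  using lead_coeff_comp[of "[:- of_int i, 1:]" p] by (simp add: pshift_def)

lemma poly_pshift: "poly (pshift i p) x = poly p (x - of_int i)"
  by (simp add: pshift_def poly_pcompose)

lemma sigma_Fract_pshift:
  "q \<noteq> 0 \<Longrightarrow> sigma (Fraction_Field.Fract p q) = Fraction_Field.Fract (pshift 1 p) (pshift 1 q)"
  by (simp add: sigma_Fract pshift_def)

lemma sigma_funpow_Fract:
  "q \<noteq> 0 \<Longrightarrow> (sigma ^^ k) (Fraction_Field.Fract p q) =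
     Fraction_Field.Fract (pshift (int k) p) (pshift (int k) q)"
  by (induction k) (simp_all add: sigma_Fract_pshift pshift_pshift)

lemma bij_sigma: "bij (sigma :: 'k::field_char_0 poly fract \<Rightarrow> _)"
proof (rule bijI)
  show "inj (sigma :: 'k poly fract \<Rightarrow> _)"
  proof (rule injI)
    fix x y :: "'k poly fract" assume *: "sigma x = sigma y"
    obtain p q where x: "x = Fraction_Field.Fract p q" "q \<noteq> 0" by (cases x)
    obtain r s where y: "y = Fraction_Field.Fract r s" "s \<noteq> 0" by (cases y)
    have "pshift 1 (p * s - r * q) = 0"
      using * x y by (simp add: sigma_Fract_pshift eq_fract pshift_mult pshift_diff)
    then show "x = y" using x y by (simp add: eq_fract)
  qed
  show "surj (sigma :: 'k poly fract \<Rightarrow> _)"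
  proof (rule surjI)
    fix x :: "'k poly fract"
    obtain p q where "x = Fraction_Field.Fract p q" "q \<noteq> 0" by (cases x)
    \<comment> \<open>A preimage needs some representation of \<open>x\<close>; every choice works,
      so \<open>SOME\<close> is harmless.\<close>
    then show "sigma (case SOME (p, q). q \<noteq> 0 \<and> x = Fraction_Field.Fract p q of
        (p, q) \<Rightarrow> Fraction_Field.Fract (pshift (-1) p) (pshift (-1) q)) = x"
      by (rule_tac someI2[where a = "(p, q)"]) (auto simp: sigma_Fract_pshift pshift_pshift)
  qed
qed

text \<open>Negative powers are iterates of \<open>inv_into\<close>, so the inverse of
  \<open>sigma\<close> is first identified as the shift by \<open>-1\<close>. Afterwards powers of
  either sign obey one formula.\<close>

lemma sigma_pow_Fract:
  assumes "q \<noteq> 0"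
  shows "sigma_pow i (Fraction_Field.Fract p q) = Fraction_Field.Fract (pshift i p) (pshift i q)"
proof (cases "0 \<le> i")
  case True
  then show ?thesis using assms by (simp add: iter_int_def sigma_funpow_Fract)
next
  case False
  have 1: "inv_into UNIV sigma (Fraction_Field.Fract p q) = Fraction_Field.Fract (pshift (-1) p) (pshift (-1) q)"
    if "q \<noteq> 0" for p q :: "'a poly"
    using that by (intro inv_f_eq[OF bij_is_inj[OF bij_sigma]]) (simp add: sigma_Fract_pshift pshift_pshift)
  have "(inv_into UNIV sigma ^^ k) (Fraction_Field.Fract p q) =
      Fraction_Field.Fract (pshift (- int k) p) (pshift (- int k) q)" for k
    using assms by (induction k) (simp_all add: 1 pshift_pshift)
  from this[of "nat (- i)"] show ?thesis using False by (simp add: iter_int_def)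
qed

lemma sigma_pow_to_fract [simp]: "sigma_pow i (to_fract p) = to_fract (pshift i p)"
  by (simp add: to_fract_def sigma_pow_Fract)

lemma sigma_pow_add [simp]: "sigma_pow i (x + y) = sigma_pow i x + sigma_pow i y"
  by (cases x; cases y) (simp add: sigma_pow_Fract pshift_add pshift_mult)

lemma sigma_pow_mult [simp]: "sigma_pow i (x * y) = sigma_pow i x * sigma_pow i y"
  by (cases x; cases y) (simp add: sigma_pow_Fract pshift_mult)

lemma sigma_pow_0 [simp]: "sigma_pow i 0 = 0"
  using sigma_pow_to_fract[of i 0] by (simp del: sigma_pow_to_fract)

lemma sigma_pow_1 [simp]: "sigma_pow i 1 = 1"
  using sigma_pow_to_fract[of i 1] by (simp del: sigma_pow_to_fract)

lemma sigma_pow_minus [simp]: "sigma_pow i (- x) = - sigma_pow i x"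
  using sigma_pow_add[of i x "- x"] by (simp del: sigma_pow_add add: eq_neg_iff_add_eq_0 add.commute)

lemma sigma_pow_diff [simp]: "sigma_pow i (x - y) = sigma_pow i x - sigma_pow i y"
  using sigma_pow_add[of i x "- y"] by simp

lemma sigma_pow_sigma_pow [simp]: "sigma_pow i (sigma_pow j x) = sigma_pow (i + j) x"
  by (cases x) (simp add: sigma_pow_Fract pshift_pshift)

lemma sigma_pow_zero_exp [simp]: "sigma_pow 0 x = x"
  by (simp add: iter_int_def)

lemma sigma_pow_eq_0_iff [simp]: "sigma_pow i x = 0 \<longleftrightarrow> x = 0"
  by (cases x) (simp add: sigma_pow_Fract Zero_fract_def eq_fract)

lemma sigma_pow_inverse [simp]: "sigma_pow i (inverse x) = inverse (sigma_pow i x)"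
proof (cases "x = 0")
  case False
  then have "sigma_pow i (inverse x) * sigma_pow i x = 1"
    by (simp flip: sigma_pow_mult)
  then show ?thesis by (metis inverse_unique mult.commute)
qed simp

lemma sigma_pow_divide [simp]: "sigma_pow i (x / y) = sigma_pow i x / sigma_pow i y"
  by (simp add: divide_inverse)

lemma sigma_pow_sum [simp]: "sigma_pow i (sum f A) = (\<Sum>x\<in>A. sigma_pow i (f x))"
  by (induction A rule: infinite_finite_induct) simp_all

lemma bij_sigma_pow: "bij (sigma_pow i)"
  by (rule bij_betw_byWitness[where f' = "sigma_pow (- i)"]) auto

text \<open>Writing the fixed element as \<open>p/q\<close> and evaluating \<open>p(H - kn) q(H) = p(H) q(H - kn)\<close> at a
  point \<open>a\<close> with \<open>q(a) \<noteq> 0\<close>, the polynomial \<open>q(a) p - p(a) q\<close> has the zeros \<open>a - kn\<close>.\<close>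

lemma sigma_pow_fixed:
  fixes x :: "'k::field_char_0 poly fract"
  assumes n: "n \<noteq> 0" and fixed: "sigma_pow n x = x"
  shows "\<exists>c. x = to_fract [:c:]"
proof -
  obtain p q where x: "x = Fraction_Field.Fract p q" "q \<noteq> 0" by (cases x)
  have "sigma_pow (int k * n) x = x" for k
  proof (induction k)
    case (Suc k)
    have "sigma_pow (int (Suc k) * n) x = sigma_pow n (sigma_pow (int k * n) x)"
      by (simp add: algebra_simps)
    then show ?case using Suc fixed by simp
  qed simp
  then have "pshift (int k * n) p * q = p * pshift (int k * n) q" for k
    using x by (simp add: sigma_pow_Fract eq_fract)
  then have eq: "poly p (a - of_int (int k * n)) * poly q a = poly p a * poly q (a - of_int (int k * n))"
    for k a
    using arg_cong[of _ _ "\<lambda>r. poly r a"] by (fastforce simp: poly_pshift)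
  have "infinite (UNIV :: 'k set)" by (rule infinite_UNIV_char_0)
  then have "UNIV \<noteq> {z. poly q z = 0}" using poly_roots_finite[OF x(2)] by metis
  then obtain a where a: "poly q a \<noteq> 0" by blast
  let ?r = "smult (poly q a) p - smult (poly p a) q"
  have "range (\<lambda>k. a - of_int (int k * n)) \<subseteq> {z. poly ?r z = 0}"
    using eq by (auto simp: mult.commute)
  moreover have "inj (\<lambda>k. a - of_int (int k * n) :: 'k)"
  proof (rule injI)
    fix k l :: nat
    assume "a - of_int (int k * n) = a - of_int (int l * n)"
    then have "of_int (int k * n) = (of_int (int l * n) :: 'k)" by (rule diff_left_imp_eq)
    then show "k = l" using n by (simp only: of_int_eq_iff mult_cancel_right of_nat_eq_iff) simp
  qed
  then have "infinite (range (\<lambda>k. a - of_int (int k * n) :: 'k))" by (simp add: finite_image_iff)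
  ultimately have "?r = 0" using poly_roots_finite finite_subset by blast
  then have "smult (inverse (poly q a)) (smult (poly q a) p) =
      smult (inverse (poly q a)) (smult (poly p a) q)" by simp
  then have "p = smult (poly p a / poly q a) q"
    using a by (simp add: divide_inverse mult.commute)
  then have "x = to_fract [:poly p a / poly q a:]"
    using x by (simp add: to_fract_def eq_fract)
  then show ?thesis by blast
qed

subsection \<open>The difference operator\<close>

definition pdelta :: "int \<Rightarrow> 'k::field_char_0 poly \<Rightarrow> 'k poly" where
  "pdelta n p = pshift n p - p"

text \<open>On the step-\<open>n\<close> factorial powers \<open>H (H + n) \<dots> (H + (d - 1) n)\<close> the operator
  \<^const>\<open>pdelta\<close> acts like a derivative.\<close>

definition ffact_poly :: "int \<Rightarrow> nat \<Rightarrow> 'k::field_char_0 poly" where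
  "ffact_poly n d = (\<Prod>i<d. [:of_int (int i * n), 1:])"

lemma degree_ffact_poly [simp]: "degree (ffact_poly n d :: 'k::field_char_0 poly) = d"
  and lead_coeff_ffact_poly [simp]: "coeff (ffact_poly n d :: 'k poly) d = 1"
proof -
  show *: "degree (ffact_poly n d :: 'k poly) = d"
    unfolding ffact_poly_def by (subst degree_prod_eq_sum_degree) auto
  have "lead_coeff (ffact_poly n d :: 'k poly) = 1"
    unfolding ffact_poly_def by (subst lead_coeff_prod) auto
  with * show "coeff (ffact_poly n d :: 'k poly) d = 1" by simp
qed

text \<open>The shift turns H (H + n) ... (H + d n) into (H - n) H ... (H + (d - 1) n). Both
  products contain \<open>ffact_poly n d\<close>, and the remaining linear factors H - n and H + d n
  differ by the constant -(d + 1) n.\<close>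

lemma pdelta_ffact_poly:
  "pdelta n (ffact_poly n (Suc d)) = smult (- of_nat (Suc d) * of_int n) (ffact_poly n d)"
proof -
  have shift: "pshift n [:a, 1:] = [:a - of_int n, 1:]" for a :: 'a
    by (simp add: pshift_def pcompose_pCons)
  have "pshift n (ffact_poly n (Suc d)) = [:- of_int n, 1:] * (ffact_poly n d :: 'a poly)"
  proof (induction d)
    case (Suc d)
    have "pshift n (ffact_poly n (Suc (Suc d))) =
        pshift n (ffact_poly n (Suc d)) * pshift n [:of_int (int (Suc d) * n), 1 :: 'a:]"
      by (subst ffact_poly_def, subst prod.lessThan_Suc, subst ffact_poly_def[symmetric])
        (rule pshift_mult)
    also have "\<dots> = [:- of_int n, 1:] * ffact_poly n d * [:of_int (int d * n), 1:]"
      unfolding Suc shift by (rule arg_cong[where f = "(*) _"]) (simp add: algebra_simps)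
    also have "\<dots> = [:- of_int n, 1:] * ffact_poly n (Suc d)"
      unfolding ffact_poly_def prod.lessThan_Suc by (rule mult.assoc)
    finally show ?case .
  qed (simp add: ffact_poly_def shift)
  moreover have "ffact_poly n (Suc d) = [:of_nat d * of_int n, 1:] * (ffact_poly n d :: 'a poly)"
    unfolding ffact_poly_def prod.lessThan_Suc by (subst mult.commute) simp
  ultimately have "pdelta n (ffact_poly n (Suc d)) =
      ([:- of_int n, 1:] - [:of_nat d * of_int n, 1:]) * (ffact_poly n d :: 'a poly)"
    by (simp only: pdelta_def left_diff_distrib)
  also have "[:- of_int n, 1:] - [:of_nat d * of_int n, 1:] = [:- of_nat (Suc d) * of_int n :: 'a:]"
    by (simp add: algebra_simps)
  finally show ?thesis by simp
qed

text \<open>The monic \<open>ffact_poly\<close> takes the place of the leading monomial, so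
  inductions on the degree need \<open>pdelta\<close> only on factorial powers.\<close>

lemma poly_split_ffact:
  fixes p :: "'k::field_char_0 poly"
  assumes "degree p \<le> Suc d"
  obtains c r where "p = smult c (ffact_poly n (Suc d)) + r" "degree r \<le> d"
proof
  let ?r = "p - smult (coeff p (Suc d)) (ffact_poly n (Suc d))"
  show "p = smult (coeff p (Suc d)) (ffact_poly n (Suc d)) + ?r" by simp
  have "coeff ?r i = 0" if "i > d" for i
  proof (cases "i = Suc d")
    case True
    show ?thesis unfolding True coeff_diff coeff_smult lead_coeff_ffact_poly by simp
  next
    case False
    then have "i > Suc d" using that by simp
    then have "coeff p i = 0" "coeff (ffact_poly n (Suc d) :: 'k poly) i = 0"
      using assms by (auto intro!: coeff_eq_0)
    then show ?thesis by simp
  qed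
  then show "degree ?r \<le> d" by (intro degree_le) blast
qed

lemma pdelta_add: "pdelta n (p + q) = pdelta n p + pdelta n q"
  and pdelta_smult: "pdelta n (smult c p) = smult c (pdelta n p)"
  and pdelta_const [simp]: "pdelta n [:c:] = 0"
  by (simp_all add: pdelta_def pshift_add pshift_smult smult_diff_right)

lemma degree_smult_leI: "degree p \<le> d \<Longrightarrow> degree (smult c p) \<le> d"
  using degree_smult_le[of c p] by simp

lemma degree_pdelta_le: "degree p \<le> Suc d \<Longrightarrow> degree (pdelta n p) \<le> d"
proof (induction d arbitrary: p)
  case (Suc d)
  obtain c r where "p = smult c (ffact_poly n (Suc (Suc d))) + r" "degree r \<le> Suc d"
    by (rule poly_split_ffact[OF Suc.prems])
  moreover from this have "degree (pdelta n r) \<le> d" using Suc.IH by blast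
  ultimately show ?case
    by (auto simp: pdelta_add pdelta_smult pdelta_ffact_poly intro!: degree_add_le degree_smult_leI)
next
  case 0
  obtain c r where p: "p = smult c (ffact_poly n (Suc 0)) + r" "degree r \<le> 0"
    by (rule poly_split_ffact[OF 0])
  from p(2) obtain e where "r = [:e:]" by (auto elim: degree_eq_zeroE)
  then show ?case using p
    by (auto simp: pdelta_add pdelta_smult pdelta_ffact_poly intro!: degree_add_le degree_smult_leI)
qed

text \<open>Discrete integration: the leading term is matched by a multiple of the next factorial
  power, the rest by induction.\<close>

lemma pdelta_primitive:
  fixes p :: "'k::field_char_0 poly"
  assumes n: "n \<noteq> 0" and "degree p \<le> d"
  shows "\<exists>q. degree q \<le> Suc d \<and> pdelta n q = p"
  using assms(2)
proof (induction d arbitrary: p)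
  case 0
  then obtain c where "p = [:c:]" by (auto elim: degree_eq_zeroE)
  moreover have "ffact_poly n 0 = (1 :: 'k poly)" by (simp add: ffact_poly_def)
  ultimately show ?case using n
    by (intro exI[of _ "smult (- c / of_int n) (ffact_poly n (Suc 0))"])
       (auto simp del: smult_minus_left simp: pdelta_smult pdelta_ffact_poly
          intro!: degree_smult_leI)
next
  case (Suc d)
  obtain c r where p: "p = smult c (ffact_poly n (Suc d)) + r" "degree r \<le> d"
    by (rule poly_split_ffact[OF Suc.prems])
  obtain q where q: "degree q \<le> Suc d" "pdelta n q = r" using Suc.IH[OF p(2)] by blast
  \<comment> \<open>The factor that \<open>pdelta\<close> produces on the next factorial power;
    dividing by it needs characteristic zero and \<open>n \<noteq> 0\<close>.\<close>
  define a where "a = - of_nat (Suc (Suc d)) * (of_int n :: 'k)"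
  have *: "pdelta n (ffact_poly n (Suc (Suc d))) = smult a (ffact_poly n (Suc d))"
    unfolding a_def by (rule pdelta_ffact_poly)
  have "a \<noteq> 0" using n unfolding a_def by (simp del: of_nat_Suc)
  have "pdelta n (smult (c / a) (ffact_poly n (Suc (Suc d))) + q) = p"
    using \<open>a \<noteq> 0\<close> p(1) q(2)
    by (simp add: pdelta_add pdelta_smult *)
  moreover have "degree (smult (c / a) (ffact_poly n (Suc (Suc d))) + q) \<le> Suc (Suc d)"
    using q(1) by (auto intro!: degree_add_le degree_smult_leI)
  ultimately show ?case by blast
qed

text \<open>If the difference of a rational function is a polynomial, subtract a polynomial with the
  same difference: what remains is fixed by sigma^n, hence constant, so there was no denominator.
  This is the inductive step for the kernels of the powers of sigma^n - 1.\<close>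

lemma sigma_pow_delta_poly_iff:
  fixes x :: "'k::field_char_0 poly fract"
  assumes "n \<noteq> 0"
  shows "(\<exists>p. degree p \<le> d \<and> sigma_pow n x - x = to_fract p) \<longleftrightarrow>
    (\<exists>q. degree q \<le> Suc d \<and> x = to_fract q)"
proof
  assume "\<exists>p. degree p \<le> d \<and> sigma_pow n x - x = to_fract p"
  then obtain p where p: "degree p \<le> d" "sigma_pow n x - x = to_fract p" by blast
  obtain q where q: "degree q \<le> Suc d" "pdelta n q = p"
    using pdelta_primitive[OF assms p(1)] by blast
  have "to_fract (pshift n q) - to_fract q = to_fract p"
    using q(2) by (simp add: pdelta_def flip: to_fract_diff)
  then have "sigma_pow n (x - to_fract q) = x - to_fract q"
    using p(2) by (simp add: algebra_simps)
  from sigma_pow_fixed[OF assms this] obtain c where "x - to_fract q = to_fract [:c:]" by blast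
  then have "x = to_fract (q + [:c:])" by (simp add: algebra_simps)
  moreover have "degree (q + [:c:]) \<le> Suc d" using q(1) by (intro degree_add_le) auto
  ultimately show "\<exists>q. degree q \<le> Suc d \<and> x = to_fract q" by blast
next
  assume "\<exists>q. degree q \<le> Suc d \<and> x = to_fract q"
  then obtain q where "degree q \<le> Suc d" "x = to_fract q" by blast
  then show "\<exists>p. degree p \<le> d \<and> sigma_pow n x - x = to_fract p"
    using degree_pdelta_le[of q d n]
    by (intro exI[of _ "pdelta n q"]) (simp add: pdelta_def)
qed

subsection \<open>Monic rational functions\<close>

lemma monic_fract_1 [simp]: "monic_fract 1"
  unfolding monic_fract_def One_fract_def by (intro exI[of _ 1]) simp

lemma monic_fractE:
  assumes "monic_fract x"
  obtains p q where "lead_coeff p = 1" "lead_coeff q = 1" "p \<noteq> 0" "q \<noteq> 0"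
    "x = Fraction_Field.Fract p q"
  using assms unfolding monic_fract_def by fastforce

lemma monic_fract_nonzero: "monic_fract x \<Longrightarrow> x \<noteq> 0"
  by (elim monic_fractE) (simp add: Fract_conv_to_fract)

lemma monic_fract_mult:
  assumes "monic_fract x" "monic_fract y" shows "monic_fract (x * y)"
proof -
  obtain p q where x: "lead_coeff p = 1" "lead_coeff q = 1" "x = Fraction_Field.Fract p q"
    using assms(1) by (rule monic_fractE)
  obtain r s where y: "lead_coeff r = 1" "lead_coeff s = 1" "y = Fraction_Field.Fract r s"
    using assms(2) by (rule monic_fractE)
  show ?thesis unfolding monic_fract_def
    using x y by (intro exI[of _ "p * r"] exI[of _ "q * s"]) (simp add: lead_coeff_mult del: coeff_mult_degree_sum)
qed

lemma monic_fract_inverse: "monic_fract x \<Longrightarrow> monic_fract (inverse x)"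
  by (elim monic_fractE) (auto simp: monic_fract_def)

lemma monic_fract_sigma_pow:
  assumes "monic_fract x" shows "monic_fract (sigma_pow i x)"
proof -
  obtain p q where x: "lead_coeff p = 1" "lead_coeff q = 1" "q \<noteq> 0" "x = Fraction_Field.Fract p q"
    using assms by (rule monic_fractE)
  show ?thesis unfolding monic_fract_def
    using x lead_coeff_pshift[of i p] lead_coeff_pshift[of i q]
    by (intro exI[of _ "pshift i p"] exI[of _ "pshift i q"]) (simp add: sigma_pow_Fract)
qed

lemma monic_fract_prod:
  "(\<And>i. i \<in> A \<Longrightarrow> monic_fract (f i)) \<Longrightarrow> monic_fract (prod f A)"
  by (induction A rule: infinite_finite_induct) (auto simp: monic_fract_mult)

text \<open>Together with \<open>sigma_pow_fixed\<close> this upgrades equality of monic elements up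
  to a fixed factor to equality.\<close>

lemma monic_fract_const:
  assumes "monic_fract (to_fract [:c:])" shows "c = 1"
proof -
  obtain p q where pq: "lead_coeff p = 1" "lead_coeff q = 1" "to_fract [:c:] = Fraction_Field.Fract p q"
    using assms unfolding monic_fract_def by blast
  then have "q \<noteq> 0" by auto
  then have "smult c q = p" using pq(3) by (simp add: to_fract_def eq_fract)
  then show ?thesis using pq(1,2) by (auto split: if_splits)
qed

text \<open>Commuting with u is unaffected by nonzero scalars, so coefficients of commuting elements
  may be normalized to monic ones, as \<open>sigma_root\<close> demands.\<close>

lemma monic_fract_scale:
  fixes x :: "'k::field_char_0 poly fract"
  assumes "x \<noteq> 0"
  obtains c y where "c \<noteq> 0" "monic_fract y" "y = to_fract [:c:] * x"
proof -
  obtain p q where x: "x = Fraction_Field.Fract p q" "q \<noteq> 0" by (cases x)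
  then have "p \<noteq> 0" using assms by (auto simp: fract_collapse)
  define c where "c = lead_coeff q / lead_coeff p"
  have "c \<noteq> 0" using \<open>p \<noteq> 0\<close> x by (simp add: c_def)
  moreover have "to_fract [:c:] * x =
      Fraction_Field.Fract (smult (inverse (lead_coeff p)) p) (smult (inverse (lead_coeff q)) q)"
    using x \<open>p \<noteq> 0\<close> by (simp add: to_fract_def eq_fract c_def field_simps)
  then have "monic_fract (to_fract [:c:] * x)"
    unfolding monic_fract_def using x \<open>p \<noteq> 0\<close>
    by (intro exI[of _ "smult (inverse (lead_coeff p)) p"]
        exI[of _ "smult (inverse (lead_coeff q)) q"]) simp
  ultimately show ?thesis using that by blast
qed

subsection \<open>The ring \<open>B\<close>\<close>

lemma KfracH_simps [simp]:
  "carrier (KfracH :: 'k::field_char_0 poly fract ring) = UNIV"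
  "\<zero>\<^bsub>KfracH :: 'k poly fract ring\<^esub> = 0"
  "\<one>\<^bsub>KfracH :: 'k poly fract ring\<^esub> = 1"
  "monoid.mult (KfracH :: 'k poly fract ring) = (*)"
  "ring.add (KfracH :: 'k poly fract ring) = (+)"
  by (simp_all add: ring_of_type_algebra_def fun_eq_iff)

lemma finsum_KfracH [simp]:
  "finsum (KfracH :: 'k::field_char_0 poly fract ring) f A = sum f A"
proof -
  interpret cring "KfracH :: 'k poly fract ring" by (rule cring_from_type_algebra)
  show ?thesis
    by (induction A rule: infinite_finite_induct) simp_all
qed

lemma carrier_BB: "f \<in> carrier BB \<longleftrightarrow> finite {i. f i \<noteq> 0}"
  and zero_BB: "\<zero>\<^bsub>BB\<^esub> = (\<lambda>i. 0)"
  and one_BB: "\<one>\<^bsub>BB\<^esub> = lmonom 1 0"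
  and add_BB: "f \<oplus>\<^bsub>BB\<^esub> g = (\<lambda>i. f i + g i)"
  and mult_BB: "f \<otimes>\<^bsub>BB\<^esub> g = (\<lambda>k. \<Sum>i | f i \<noteq> 0. f i * sigma_pow i (g (k - i)))"
  by (simp_all add: BB_def skew_laurent_def lmonom_def fun_eq_iff)

text \<open>Sums and products change the support; over a common finite index set they can be
  compared term by term.\<close>

lemma mult_BB_superset:
  assumes "finite S" "{i. f i \<noteq> 0} \<subseteq> S"
  shows "(f \<otimes>\<^bsub>BB\<^esub> g) k = (\<Sum>i\<in>S. f i * sigma_pow i (g (k - i)))"
  unfolding mult_BB using assms by (intro sum.mono_neutral_left) auto

lemma lmonom_closed [simp]: "lmonom a n \<in> carrier BB"
proof -
  have "{i. lmonom a n i \<noteq> 0} \<subseteq> {n}" by (auto simp: lmonom_def)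
  then show ?thesis unfolding carrier_BB using finite_subset by blast
qed

lemma lmonom_mult_left: "(lmonom a n \<otimes>\<^bsub>BB\<^esub> f) k = a * sigma_pow n (f (k - n))"
  by (subst mult_BB_superset[of "{n}"]) (auto simp: lmonom_def)

lemma mult_lmonom_right:
  assumes "f \<in> carrier BB"
  shows "(f \<otimes>\<^bsub>BB\<^esub> lmonom a n) k = f (k - n) * sigma_pow (k - n) a"
proof -
  have "(f \<otimes>\<^bsub>BB\<^esub> lmonom a n) k =
      (\<Sum>i\<in>insert (k - n) {i. f i \<noteq> 0}. f i * sigma_pow i (lmonom a n (k - i)))"
    using assms by (intro mult_BB_superset) (auto simp: carrier_BB)
  also have "\<dots> = (\<Sum>i\<in>{k - n}. f i * sigma_pow i (lmonom a n (k - i)))"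
    using assms by (intro sum.mono_neutral_right) (auto simp: carrier_BB lmonom_def)
  finally show ?thesis by (simp add: lmonom_def)
qed

lemma lmonom_mult: "lmonom a i \<otimes>\<^bsub>BB\<^esub> lmonom b j = lmonom (a * sigma_pow i b) (i + j)"
  by (rule ext) (simp only: lmonom_mult_left, auto simp: lmonom_def)

lemma support_mult_BB:
  "{k. (f \<otimes>\<^bsub>BB\<^esub> g) k \<noteq> 0} \<subseteq> (\<lambda>(i, j). i + j) ` ({i. f i \<noteq> 0} \<times> {i. g i \<noteq> 0})"
proof
  fix k assume "k \<in> {k. (f \<otimes>\<^bsub>BB\<^esub> g) k \<noteq> 0}"
  then have "(\<Sum>i | f i \<noteq> 0. f i * sigma_pow i (g (k - i))) \<noteq> 0" by (simp add: mult_BB)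
  then obtain i where "f i * sigma_pow i (g (k - i)) \<noteq> 0"
    by (rule sum.not_neutral_contains_not_neutral)
  then have "f i \<noteq> 0" "g (k - i) \<noteq> 0" by auto
  then show "k \<in> (\<lambda>(i, j). i + j) ` ({i. f i \<noteq> 0} \<times> {i. g i \<noteq> 0})"
    by (intro image_eqI[of _ _ "(i, k - i)"]) auto
qed

lemma mult_BB_closed: "f \<in> carrier BB \<Longrightarrow> g \<in> carrier BB \<Longrightarrow> f \<otimes>\<^bsub>BB\<^esub> g \<in> carrier BB"
  unfolding carrier_BB by (rule finite_subset[OF support_mult_BB]) auto

text \<open>Both sides are one double sum over i in the support of f and j in the support of g.
  \<open>U\<close> holds all values m = i + j, and for fixed i the sum over m collapses to the sum
  over j.\<close>

lemma mult_BB_assoc: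
  assumes f: "f \<in> carrier BB" and g: "g \<in> carrier BB"
  shows "(f \<otimes>\<^bsub>BB\<^esub> g) \<otimes>\<^bsub>BB\<^esub> h = f \<otimes>\<^bsub>BB\<^esub> (g \<otimes>\<^bsub>BB\<^esub> h)"
proof
  fix k
  define S T where "S = {i. f i \<noteq> 0}" and "T = {i. g i \<noteq> 0}"
  define U where "U = (\<lambda>(i, j). i + j) ` (S \<times> T)"
  have fin: "finite S" "finite T" "finite U"
    using f g by (auto simp: S_def T_def U_def carrier_BB)
  have "((f \<otimes>\<^bsub>BB\<^esub> g) \<otimes>\<^bsub>BB\<^esub> h) k =
      (\<Sum>m\<in>U. (\<Sum>i\<in>S. f i * sigma_pow i (g (m - i))) * sigma_pow m (h (k - m)))"
    using fin(3) support_mult_BB[of f g]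
    by (subst mult_BB_superset[of U]) (auto simp: U_def S_def T_def mult_BB)
  also have "\<dots> = (\<Sum>i\<in>S. \<Sum>m\<in>U. f i * (sigma_pow i (g (m - i)) * sigma_pow m (h (k - m))))"
    unfolding sum_distrib_right by (subst sum.swap) (simp add: mult.assoc)
  also have "\<dots> = (\<Sum>i\<in>S. f i * sigma_pow i ((g \<otimes>\<^bsub>BB\<^esub> h) (k - i)))"
  proof (rule sum.cong[OF refl])
    fix i assume i: "i \<in> S"
    have "(\<Sum>m\<in>U. f i * (sigma_pow i (g (m - i)) * sigma_pow m (h (k - m)))) =
        (\<Sum>m\<in>(+) i ` T. f i * (sigma_pow i (g (m - i)) * sigma_pow m (h (k - m))))"
    proof (rule sum.mono_neutral_right[OF fin(3)])
      show "(+) i ` T \<subseteq> U" using i by (auto simp: U_def)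
      show "\<forall>m\<in>U - (+) i ` T. f i * (sigma_pow i (g (m - i)) * sigma_pow m (h (k - m))) = 0"
      proof
        fix m assume "m \<in> U - (+) i ` T"
        then have "m - i \<notin> T" by (metis DiffD2 add_diff_cancel_left' diff_add_cancel add.commute imageI)
        then show "f i * (sigma_pow i (g (m - i)) * sigma_pow m (h (k - m))) = 0"
          by (simp add: T_def)
      qed
    qed
    also have "\<dots> = (\<Sum>j\<in>T. f i * (sigma_pow i (g j) * sigma_pow (i + j) (h (k - (i + j)))))"
      by (subst sum.reindex) (auto simp: inj_on_def)
    also have "\<dots> = f i * sigma_pow i ((g \<otimes>\<^bsub>BB\<^esub> h) (k - i))"
      by (simp add: mult_BB T_def sum_distrib_left algebra_simps)
    finally show "(\<Sum>m\<in>U. f i * (sigma_pow i (g (m - i)) * sigma_pow m (h (k - m)))) =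
      f i * sigma_pow i ((g \<otimes>\<^bsub>BB\<^esub> h) (k - i))" .
  qed
  also have "\<dots> = (f \<otimes>\<^bsub>BB\<^esub> (g \<otimes>\<^bsub>BB\<^esub> h)) k" by (simp add: mult_BB S_def)
  finally show "((f \<otimes>\<^bsub>BB\<^esub> g) \<otimes>\<^bsub>BB\<^esub> h) k = (f \<otimes>\<^bsub>BB\<^esub> (g \<otimes>\<^bsub>BB\<^esub> h)) k" .
qed

lemma ring_BB: "ring (BB :: (int \<Rightarrow> 'k::field_char_0 poly fract) ring)"
proof (rule ringI)
  show "abelian_group (BB :: (int \<Rightarrow> 'k poly fract) ring)"
  proof (rule abelian_groupI)
    fix x y :: "int \<Rightarrow> 'k poly fract" assume xy: "x \<in> carrier BB" "y \<in> carrier BB"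
    have "{i. x i + y i \<noteq> 0} \<subseteq> {i. x i \<noteq> 0} \<union> {i. y i \<noteq> 0}" by auto
    then show "x \<oplus>\<^bsub>BB\<^esub> y \<in> carrier BB"
      unfolding carrier_BB add_BB by (rule finite_subset) (use xy in \<open>simp add: carrier_BB\<close>)
  next
    fix x :: "int \<Rightarrow> 'k poly fract" assume x: "x \<in> carrier BB"
    show "\<exists>y\<in>carrier BB. y \<oplus>\<^bsub>BB\<^esub> x = \<zero>\<^bsub>BB\<^esub>"
      using x by (intro bexI[of _ "\<lambda>i. - x i"]) (auto simp: carrier_BB add_BB zero_BB)
  qed (auto simp: add_BB zero_BB carrier_BB algebra_simps)
  show "monoid (BB :: (int \<Rightarrow> 'k poly fract) ring)"
  proof (rule monoidI)
    fix x :: "int \<Rightarrow> 'k poly fract" assume x: "x \<in> carrier BB"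
    show "\<one>\<^bsub>BB\<^esub> \<otimes>\<^bsub>BB\<^esub> x = x"
      by (rule ext) (simp add: one_BB lmonom_mult_left)
    show "x \<otimes>\<^bsub>BB\<^esub> \<one>\<^bsub>BB\<^esub> = x"
      by (rule ext) (simp add: one_BB mult_lmonom_right[OF x])
  qed (auto simp: mult_BB_closed mult_BB_assoc one_BB)
  fix x y z :: "int \<Rightarrow> 'k poly fract"
  assume x: "x \<in> carrier BB" and y: "y \<in> carrier BB" and z: "z \<in> carrier BB"
  show "z \<otimes>\<^bsub>BB\<^esub> (x \<oplus>\<^bsub>BB\<^esub> y) = z \<otimes>\<^bsub>BB\<^esub> x \<oplus>\<^bsub>BB\<^esub> z \<otimes>\<^bsub>BB\<^esub> y"
    by (simp add: mult_BB add_BB sum.distrib distrib_left)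
  let ?S = "{i. x i \<noteq> 0} \<union> {i. y i \<noteq> 0}"
  have fin: "finite ?S" using x y by (simp add: carrier_BB)
  show "(x \<oplus>\<^bsub>BB\<^esub> y) \<otimes>\<^bsub>BB\<^esub> z = x \<otimes>\<^bsub>BB\<^esub> z \<oplus>\<^bsub>BB\<^esub> y \<otimes>\<^bsub>BB\<^esub> z"
  proof
    fix k
    show "((x \<oplus>\<^bsub>BB\<^esub> y) \<otimes>\<^bsub>BB\<^esub> z) k = (x \<otimes>\<^bsub>BB\<^esub> z \<oplus>\<^bsub>BB\<^esub> y \<otimes>\<^bsub>BB\<^esub> z) k"
      unfolding add_BB
      by (subst (1 2 3) mult_BB_superset[OF fin]) (auto simp: sum.distrib distrib_right)
  qed
qed

interpretation BB: ring "BB :: (int \<Rightarrow> 'k::field_char_0 poly fract) ring"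
  by (rule ring_BB)

lemma a_inv_BB: "f \<in> carrier BB \<Longrightarrow> \<ominus>\<^bsub>BB\<^esub> f = (\<lambda>i. - f i)"
  by (rule BB.minus_equality) (auto simp: add_BB zero_BB carrier_BB)

lemma minus_BB: "g \<in> carrier BB \<Longrightarrow> f \<ominus>\<^bsub>BB\<^esub> g = (\<lambda>i. f i - g i)"
  by (simp add: a_minus_def a_inv_BB add_BB)

lemma finsum_BB:
  "finite A \<Longrightarrow> F \<in> A \<rightarrow> carrier BB \<Longrightarrow> finsum BB F A = (\<lambda>k. \<Sum>a\<in>A. F a k)"
  by (induction A rule: finite_induct) (auto simp: zero_BB add_BB)

lemma lmonom_nat_pow_0: "lmonom a 0 [^]\<^bsub>BB\<^esub> (j :: nat) = lmonom (a ^ j) 0"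
  by (induction j) (simp_all add: one_BB lmonom_mult mult.commute)

lemma HB_pow: "HB [^]\<^bsub>BB\<^esub> (j :: nat) = lmonom (to_fract ([:0, 1:] ^ j)) 0"
proof -
  have "to_fract ([:0, 1:] :: 'a poly) ^ j = to_fract ([:0, 1:] ^ j)"
    by (induction j) (simp_all del: to_fract_mult mult_pCons_left flip: to_fract_mult)
  then show ?thesis by (simp add: HB_def lmonom_nat_pow_0)
qed

lemma HB_closed [simp]: "HB \<in> carrier BB"
  by (simp add: HB_def)

lemma scalarB_closed [simp]: "scalarB c \<in> carrier BB"
  by (simp add: scalarB_def)

lemma scalarB_central:
  assumes "f \<in> carrier BB" shows "scalarB c \<otimes>\<^bsub>BB\<^esub> f = f \<otimes>\<^bsub>BB\<^esub> scalarB c"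
  by (rule ext) (use assms in \<open>simp add: scalarB_def lmonom_mult_left mult_lmonom_right mult.commute\<close>)

lemma scalarB_hom: "scalarB \<in> ring_hom (ring_of_type_algebra :: 'k::field_char_0 ring) BB"
proof (rule ring_hom_memI)
  fix a b :: 'k
  show "scalarB (a \<otimes>\<^bsub>ring_of_type_algebra\<^esub> b) = scalarB a \<otimes>\<^bsub>BB\<^esub> scalarB b"
    by (simp add: scalarB_def lmonom_mult ring_of_type_algebra_def mult.commute
        flip: to_fract_mult)
  show "scalarB (a \<oplus>\<^bsub>ring_of_type_algebra\<^esub> b) = scalarB a \<oplus>\<^bsub>BB\<^esub> scalarB b"
    by (simp add: scalarB_def add_BB lmonom_def ring_of_type_algebra_def fun_eq_iff flip: to_fract_add)
  show "scalarB \<one>\<^bsub>ring_of_type_algebra\<^esub> = (\<one>\<^bsub>BB\<^esub> :: int \<Rightarrow> 'k poly fract)"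
    by (simp add: scalarB_def one_BB ring_of_type_algebra_def one_pCons[symmetric])
qed simp

subsection \<open>The filtration defined by a homogeneous element\<close>

lemma ad_closed: "u \<in> carrier BB \<Longrightarrow> b \<in> carrier BB \<Longrightarrow> ad BB u b \<in> carrier BB"
  by (simp add: ad_def)

lemma ad_lmonom:
  assumes "f \<in> carrier BB"
  shows "ad BB (lmonom a n) f k =
    a * sigma_pow n (f (k - n)) - f (k - n) * sigma_pow (k - n) a"
  using assms by (simp add: ad_def minus_BB lmonom_mult_left mult_lmonom_right)

lemma Nfilt_0: "Nfilt BB u 0 = {b \<in> carrier BB. ad BB u b = \<zero>\<^bsub>BB\<^esub>}"
  by (simp add: Nfilt_def)

lemma Nfilt_Suc:
  assumes "u \<in> carrier BB"
  shows "Nfilt BB u (int (Suc j)) = {b \<in> carrier BB. ad BB u b \<in> Nfilt BB u (int j)}"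
  using assms ad_closed unfolding Nfilt_def by (auto simp: nat_add_distrib funpow_Suc_right simp del: funpow.simps)

text \<open>For an element of degree zero \<open>ad\<close> is diagonal: it multiplies the
  coefficient of X^i by \<open>a - sigma_pow i a\<close>. For i \<noteq> 0 this factor is nonzero
  because u is not scalar, so no power of \<open>ad\<close> kills anything outside degree
  zero.\<close>

lemma Nfilt_degree_zero:
  fixes a :: "'k::field_char_0 poly fract"
  assumes u: "u = lmonom a 0" "u \<notin> range scalarB"
  shows "Nfilt BB u (int j) = range (\<lambda>a. lmonom a 0)"
proof -
  have ad: "ad BB u f i = (a - sigma_pow i a) * f i" if "f \<in> carrier BB" for f i
    using that by (simp add: u ad_lmonom algebra_simps)
  have neq: "a \<noteq> sigma_pow i a" if "i \<noteq> 0" for i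
    using sigma_pow_fixed[OF that, of a] u by (auto simp: scalarB_def)
  have deg0: "f \<in> range (\<lambda>a. lmonom a 0) \<longleftrightarrow> f \<in> carrier BB \<and> (\<forall>i. i \<noteq> 0 \<longrightarrow> f i = 0)" for f
  proof
    assume f: "f \<in> carrier BB \<and> (\<forall>i. i \<noteq> 0 \<longrightarrow> f i = 0)"
    then have "f = lmonom (f 0) 0" by (auto simp: lmonom_def)
    then show "f \<in> range (\<lambda>a. lmonom a 0)" by blast
  next
    assume "f \<in> range (\<lambda>a. lmonom a 0)"
    then obtain b where "f = lmonom b 0" by blast
    then show "f \<in> carrier BB \<and> (\<forall>i. i \<noteq> 0 \<longrightarrow> f i = 0)"
      by (simp, simp add: lmonom_def)
  qed
  have ad_0: "ad BB u f i = 0 \<longleftrightarrow> i = 0 \<or> f i = 0" if "f \<in> carrier BB" for f i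
    using neq[of i] by (cases "i = 0") (simp_all add: ad that)
  show ?thesis
  proof (induction j)
    case 0
    show ?case
    proof (rule Set.set_eqI)
      fix f :: "int \<Rightarrow> 'k poly fract"
      have "f \<in> Nfilt BB u (int 0) \<longleftrightarrow> f \<in> carrier BB \<and> (\<forall>i. ad BB u f i = 0)"
        by (simp add: Nfilt_0 zero_BB fun_eq_iff)
      then show "f \<in> Nfilt BB u (int 0) \<longleftrightarrow> f \<in> range (\<lambda>a. lmonom a 0)"
        unfolding deg0 using ad_0 by blast
    qed
  next
    case (Suc j)
    have u_closed: "u \<in> carrier BB" by (simp add: u)
    show ?case
    proof (rule Set.set_eqI)
      fix f :: "int \<Rightarrow> 'k poly fract"
      have "f \<in> Nfilt BB u (int (Suc j)) \<longleftrightarrow> f \<in> carrier BB \<and> (\<forall>i. i \<noteq> 0 \<longrightarrow> ad BB u f i = 0)"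
        unfolding Nfilt_Suc[OF u_closed] Suc deg0 using ad_closed[OF u_closed] by blast
      then show "f \<in> Nfilt BB u (int (Suc j)) \<longleftrightarrow> f \<in> range (\<lambda>a. lmonom a 0)"
        unfolding deg0 using ad_0 by blast
    qed
  qed
qed

subsection \<open>Powers of a homogeneous unit\<close>

text \<open>\<open>cocyc \<beta> t m\<close> is the coefficient of \<open>(\<beta> X\<^sup>t)\<^sup>m\<close>.\<close>

definition cocyc :: "'k::field_char_0 poly fract \<Rightarrow> int \<Rightarrow> int \<Rightarrow> 'k poly fract" where
  "cocyc \<beta> t m =
     (if 0 \<le> m then \<Prod>k<nat m. sigma_pow (int k * t) \<beta>
      else \<Prod>k<nat (- m). inverse (sigma_pow (- (int k + 1) * t) \<beta>))"

lemma cocyc_0 [simp]: "cocyc \<beta> t 0 = 1"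
  by (simp add: cocyc_def)

lemma cocyc_1 [simp]: "cocyc \<beta> t 1 = \<beta>"
  by (simp add: cocyc_def)

lemma cocyc_nonzero: "\<beta> \<noteq> 0 \<Longrightarrow> cocyc \<beta> t m \<noteq> 0"
  by (simp add: cocyc_def)

lemma cocyc_step:
  assumes "\<beta> \<noteq> 0"
  shows "cocyc \<beta> t (m + 1) = cocyc \<beta> t m * sigma_pow (m * t) \<beta>"
proof (cases "0 \<le> m")
  case True
  then have "nat (m + 1) = Suc (nat m)" by simp
  then show ?thesis using True by (simp add: cocyc_def)
next
  case False
  \<comment> \<open>For negative m the last factor of the product is the inverse of
    \<open>sigma_pow (m * t) \<beta>\<close>, and it cancels.\<close>
  define k where "k = nat (- m - 1)"
  have m: "nat (- m) = Suc k" "m = - (int k + 1)" "nat (- (m + 1)) = k"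
    using False by (auto simp: k_def)
  have "cocyc \<beta> t m = (\<Prod>k<k. inverse (sigma_pow (- (int k + 1) * t) \<beta>)) *
      inverse (sigma_pow (m * t) \<beta>)"
    using False unfolding cocyc_def m(1) by (simp only: prod.lessThan_Suc m(2)[symmetric]) simp
  moreover have "cocyc \<beta> t (m + 1) = (\<Prod>k<k. inverse (sigma_pow (- (int k + 1) * t) \<beta>))"
    using False m(3) by (auto simp: cocyc_def)
  ultimately show ?thesis using assms by simp
qed

text \<open>The 1-cocycle identity for the integers acting through powers of sigma^t; it says that
  powers of v with exponents of either sign multiply as they should. The induction on
  \<open>l\<close> runs in both directions.\<close>

lemma cocyc_add:
  assumes "\<beta> \<noteq> 0"
  shows "cocyc \<beta> t (m + l) = cocyc \<beta> t m * sigma_pow (m * t) (cocyc \<beta> t l)"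
proof (induction l rule: int_induct[where k = 0])
  case (step1 l)
  have "cocyc \<beta> t (m + (l + 1)) = cocyc \<beta> t (m + l) * sigma_pow ((m + l) * t) \<beta>"
    using cocyc_step[OF assms, of t "m + l"] by (simp add: add.assoc)
  then show ?case
    using step1 by (simp add: cocyc_step[OF assms, of t l]) (simp add: algebra_simps)
next
  case (step2 l)
  have 1: "cocyc \<beta> t (m + l) = cocyc \<beta> t (m + (l - 1)) * sigma_pow ((m + (l - 1)) * t) \<beta>"
    using cocyc_step[OF assms, of t "m + (l - 1)"] by (simp add: algebra_simps)
  have 2: "cocyc \<beta> t l = cocyc \<beta> t (l - 1) * sigma_pow ((l - 1) * t) \<beta>"
    using cocyc_step[OF assms, of t "l - 1"] by simp
  have "cocyc \<beta> t (m + (l - 1)) * sigma_pow ((m + (l - 1)) * t) \<beta> =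
      cocyc \<beta> t m * sigma_pow (m * t) (cocyc \<beta> t (l - 1)) * sigma_pow ((m + (l - 1)) * t) \<beta>"
    using step2 unfolding 1 unfolding 2 by (simp add: algebra_simps)
  then show ?case using assms by simp
qed simp

lemma monic_cocyc: "monic_fract \<beta> \<Longrightarrow> monic_fract (cocyc \<beta> t m)"
  by (simp add: cocyc_def monic_fract_prod monic_fract_sigma_pow monic_fract_inverse)

lemma lmonom_cocyc_mult:
  "\<beta> \<noteq> 0 \<Longrightarrow> lmonom (cocyc \<beta> t m) (m * t) \<otimes>\<^bsub>BB\<^esub> lmonom (cocyc \<beta> t l) (l * t) =
     lmonom (cocyc \<beta> t (m + l)) ((m + l) * t)"
  by (simp add: lmonom_mult cocyc_add distrib_right)

lemma lmonom_int_pow: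
  assumes "\<beta> \<noteq> 0"
  shows "lmonom \<beta> t [^]\<^bsub>BB\<^esub> (m :: int) = lmonom (cocyc \<beta> t m) (m * t)"
proof -
  have nat: "lmonom \<beta> t [^]\<^bsub>BB\<^esub> (k :: nat) = lmonom (cocyc \<beta> t (int k)) (int k * t)" for k
  proof (induction k)
    case (Suc k)
    then show ?case
      using lmonom_cocyc_mult[OF assms, of t "int k" 1] by (simp add: add.commute)
  qed (simp add: one_BB)
  show ?thesis
  proof (cases "0 \<le> m")
    case True
    then show ?thesis unfolding int_pow_def2 by (simp add: nat)
  next
    case False
    have "inv\<^bsub>BB\<^esub> (lmonom (cocyc \<beta> t (- m)) (- m * t)) = lmonom (cocyc \<beta> t m) (m * t)"
    proof (rule BB.inv_unique'[symmetric])
      show "lmonom (cocyc \<beta> t (- m)) (- m * t) \<otimes>\<^bsub>BB\<^esub> lmonom (cocyc \<beta> t m) (m * t) = \<one>\<^bsub>BB\<^esub>"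
        using lmonom_cocyc_mult[OF assms, of t "- m" m] by (simp add: one_BB)
      show "lmonom (cocyc \<beta> t m) (m * t) \<otimes>\<^bsub>BB\<^esub> lmonom (cocyc \<beta> t (- m)) (- m * t) = \<one>\<^bsub>BB\<^esub>"
        using lmonom_cocyc_mult[OF assms, of t m "- m"] by (simp add: one_BB)
    qed simp_all
    then show ?thesis using False unfolding int_pow_def2 by (simp add: nat)
  qed
qed

subsection \<open>Centralizer and filtration of \<open>\<alpha> X\<^sup>n\<close>\<close>

locale canonical =
  fixes \<alpha> \<beta> :: "'k::field_char_0 poly fract" and n t :: int
  assumes n_nonzero: "n \<noteq> 0" and canonical: "canonical_generator \<alpha> n t \<beta>"
begin

abbreviation u where "u \<equiv> lmonom \<alpha> n"
abbreviation v where "v \<equiv> lmonom \<beta> t"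
abbreviation \<gamma> where "\<gamma> \<equiv> cocyc \<beta> t"

text \<open>The exponent for which u is the \<open>r\<close>-th power of v; it is positive because t
  carries the sign of n.\<close>

definition r where "r = n div t"

lemma t_nonzero: "t \<noteq> 0" and n_eq: "n = r * t" and r_pos: "r > 0"
  and monic_\<beta>: "monic_fract \<beta>" and \<gamma>_r: "\<gamma> r = \<alpha>"
proof -
  obtain s where s: "s > 0" "s dvd n" "t = sgn n * s" "sigma_root \<alpha> n t \<beta>"
    using canonical unfolding canonical_generator_def by blast
  then obtain d where d: "n = s * d" by blast
  show t: "t \<noteq> 0" using s n_nonzero by (simp add: sgn_0_0)
  have "t dvd n" using s(2,3) n_nonzero by (simp add: sgn_if)
  then show n: "n = r * t" unfolding r_def by simp
  have "sgn t = sgn n" using s(1,3) by (simp add: sgn_mult)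
  then have "sgn r = 1" using n t n_nonzero by (metis mult_cancel_right1 sgn_0_0 sgn_mult)
  then show r: "r > 0" by (simp add: sgn_1_pos)
  show "monic_fract \<beta>" "\<gamma> r = \<alpha>"
    using s(4) r unfolding sigma_root_def cocyc_def r_def by auto
qed

lemma t_dvd_n: "t dvd n"
  using n_eq by (metis dvd_triv_right)

lemma mult_t_add_n: "m * t + n = (m + r) * t"
  by (subst n_eq) (rule distrib_right[symmetric])

lemma \<beta>_nonzero: "\<beta> \<noteq> 0"
  using monic_\<beta> by (rule monic_fract_nonzero)

lemma \<gamma>_nonzero [simp]: "\<gamma> m \<noteq> 0"
  using \<beta>_nonzero by (rule cocyc_nonzero)

lemma monic_\<alpha>: "monic_fract \<alpha>"
  using monic_cocyc[OF monic_\<beta>, of t r] by (simp add: \<gamma>_r)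

lemma \<alpha>_nonzero: "\<alpha> \<noteq> 0"
  using monic_\<alpha> by (rule monic_fract_nonzero)

lemma \<gamma>_add: "\<gamma> (m + l) = \<gamma> m * sigma_pow (m * t) (\<gamma> l)"
  by (rule cocyc_add[OF \<beta>_nonzero])

text \<open>Both left-hand sides are the coefficient of v^(m + r), computed from u v^m and from v^m
  u.\<close>

lemma \<gamma>_commutes: "\<alpha> * sigma_pow n (\<gamma> m) = \<gamma> (m + r)" "\<gamma> m * sigma_pow (m * t) \<alpha> = \<gamma> (m + r)"
  using \<gamma>_add[of r m] \<gamma>_add[of m r] by (simp_all add: \<gamma>_r n_eq[symmetric] add.commute)

section \<open>Homogeneous elements commuting with u\<close>

definition centralizes :: "int \<Rightarrow> 'k poly fract \<Rightarrow> bool" where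
  "centralizes i b \<longleftrightarrow> \<alpha> * sigma_pow n b = b * sigma_pow i \<alpha>"

lemma centralizes_mult:
  assumes "centralizes i b" "centralizes j c"
  shows "centralizes (i + j) (b * sigma_pow i c)"
proof -
  have "\<alpha> * sigma_pow n (b * sigma_pow i c) = (\<alpha> * sigma_pow n b) * sigma_pow i (sigma_pow n c)"
    by (simp add: add.commute mult.assoc)
  also have "\<dots> = b * sigma_pow i (\<alpha> * sigma_pow n c)"
    using assms(1) by (simp add: centralizes_def)
  also have "\<dots> = (b * sigma_pow i c) * sigma_pow (i + j) \<alpha>"
    using assms(2) by (simp add: centralizes_def)
  finally show ?thesis unfolding centralizes_def .
qed

text \<open>The new coefficient is that of the inverse of b X^i, and the inverse of a unit commuting
  with u commutes with u.\<close>

lemma centralizes_uminus: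
  assumes "centralizes i b" "b \<noteq> 0"
  shows "centralizes (- i) (sigma_pow (- i) (inverse b))"
proof -
  have "sigma_pow i \<alpha> * inverse (sigma_pow n b) = \<alpha> * inverse b"
    using assms by (simp add: centralizes_def field_simps)
  then have "sigma_pow (- i) (sigma_pow i \<alpha> * inverse (sigma_pow n b)) =
      sigma_pow (- i) (\<alpha> * inverse b)" by simp
  then show ?thesis by (simp add: centralizes_def mult.commute)
qed

text \<open>Take integer powers of b X^i. Later only the degree and the nonvanishing matter, so the
  coefficient stays existential.\<close>

lemma centralizes_times:
  assumes "centralizes i b" "b \<noteq> 0"
  shows "\<exists>c. c \<noteq> 0 \<and> centralizes (k * i) c"
proof (induction k rule: int_induct[where k = 0])
  case base
  show ?case by (intro exI[of _ 1]) (simp add: centralizes_def)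
next
  case (step1 k)
  then obtain c where "c \<noteq> 0" "centralizes (k * i) c" by blast
  then show ?case
    using centralizes_mult[of "k * i" c i b] assms
    by (intro exI[of _ "c * sigma_pow (k * i) b"]) (simp add: algebra_simps)
next
  case (step2 k)
  then obtain c where "c \<noteq> 0" "centralizes (k * i) c" by blast
  then show ?case
    using centralizes_mult[OF _ centralizes_uminus[OF assms], of "k * i" c] assms(2)
    by (intro exI[of _ "c * sigma_pow (k * i) (sigma_pow (- i) (inverse b))"])
      (simp add: algebra_simps)
qed

text \<open>The degrees of homogeneous elements of the centralizer form a subgroup of \<open>\<int>\<close>; an element of
  this subgroup outside \<open>t\<int>\<close> would yield, through the gcd, a root of \<open>\<alpha>\<close> for a proper divisor
  of \<open>t\<close>.\<close>

lemma centralizes_imp_dvd: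
  assumes "centralizes i b" "b \<noteq> 0"
  shows "t dvd i"
proof -
  define g where "g = gcd i t"
  have g: "g > 0" "g dvd i" "g dvd t" using t_nonzero by (auto simp: g_def)
  have "g dvd n" using g(3) t_dvd_n by (rule dvd_trans)
  obtain x y where xy: "x * i + y * t = g" unfolding g_def using bezout_int by blast
  have "centralizes t \<beta>"
    using \<gamma>_commutes[of 1] by (simp add: centralizes_def)
  then obtain c where c: "c \<noteq> 0" "centralizes (y * t) c"
    using centralizes_times \<beta>_nonzero by blast
  obtain c' where c': "c' \<noteq> 0" "centralizes (x * i) c'"
    using centralizes_times assms by blast
  \<comment> \<open>The gcd with the sign of n, as \<open>sigma_root\<close> requires: then
    \<open>n div g'\<close> is positive.\<close>
  define g' where "g' = sgn n * g"
  have "centralizes g (c' * sigma_pow (x * i) c)"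
    using centralizes_mult[OF c'(2) c(2)] by (simp add: xy)
  then obtain e where e: "e \<noteq> 0" "centralizes g' e"
    using centralizes_times[of g "c' * sigma_pow (x * i) c" "sgn n"] c(1) c'(1)
    by (auto simp: g'_def)
  obtain a b' where b': "a \<noteq> 0" "monic_fract b'" "b' = to_fract [:a:] * e"
    using monic_fract_scale[OF e(1)] by blast
  have cb: "centralizes g' b'"
    using e(2) by (simp add: b'(3) centralizes_def mult.left_commute mult.assoc)
  have b'0: "b' \<noteq> 0" using b'(2) by (rule monic_fract_nonzero)
  have cent: "centralizes (int k * g') (cocyc b' g' (int k))" for k
  proof (induction k)
    case (Suc k)
    then show ?case
      using centralizes_mult[OF Suc cb] cocyc_step[OF b'0, of g' "int k"]
      by (simp add: algebra_simps)
  qed (simp add: centralizes_def)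
  define q where "q = n div g'"
  have "g' dvd n" using \<open>g dvd n\<close> n_nonzero by (simp add: g'_def sgn_if)
  then have q: "n = q * g'" by (simp add: q_def)
  have "sgn g' = sgn n" using g(1) by (simp add: g'_def sgn_mult)
  then have "sgn q = 1" using q n_nonzero by (metis mult_cancel_right1 sgn_0_0 sgn_mult)
  then have q_pos: "q > 0" by (simp add: sgn_1_pos)
  \<comment> \<open>The coefficient of the q-th power of b' X^g', an element of degree n that
    commutes with u.\<close>
  define G where "G = cocyc b' g' q"
  have G: "monic_fract G" unfolding G_def by (rule monic_cocyc[OF b'(2)])
  have "centralizes n G"
    using cent[of "nat q"] q_pos by (simp add: q[symmetric] G_def)
  \<comment> \<open>Two commuting elements of the same degree n differ by a factor fixed by sigma^n,
    that is, by a scalar. Here both coefficients are monic, so the scalar is 1.\<close>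
  then have "sigma_pow n (G / \<alpha>) = G / \<alpha>"
    using \<alpha>_nonzero by (simp add: centralizes_def field_simps)
  then obtain d where d: "G / \<alpha> = to_fract [:d:]"
    using sigma_pow_fixed[OF n_nonzero] by blast
  have "monic_fract (G / \<alpha>)"
    unfolding divide_inverse by (intro monic_fract_mult monic_fract_inverse G monic_\<alpha>)
  then have "d = 1" using d monic_fract_const by metis
  then have "G = \<alpha>" using d \<alpha>_nonzero by (simp add: one_pCons[symmetric])
  then have "sigma_root \<alpha> n g' b'"
    using q_pos b'(2) by (simp add: sigma_root_def G_def cocyc_def q_def)
  then have "\<bar>t\<bar> \<le> g"
    using canonical g(1) \<open>g dvd n\<close> n_nonzero unfolding canonical_generator_def g'_def
    by (auto simp: abs_mult abs_sgn_eq)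
  moreover have "g \<le> \<bar>t\<bar>" using dvd_imp_le_int[OF t_nonzero g(3)] g(1) by simp
  ultimately have "g = \<bar>t\<bar>" by simp
  then show ?thesis using g(2) by simp
qed

lemma \<gamma>_delta:
  "\<alpha> * sigma_pow n (x * \<gamma> m) - x * \<gamma> m * sigma_pow (m * t) \<alpha> = (sigma_pow n x - x) * \<gamma> (m + r)"
proof -
  have 1: "\<alpha> * sigma_pow n (x * \<gamma> m) = sigma_pow n x * \<gamma> (m + r)"
    by (simp add: \<gamma>_commutes(1)[symmetric] mult.left_commute)
  have 2: "x * \<gamma> m * sigma_pow (m * t) \<alpha> = x * \<gamma> (m + r)"
    by (simp add: \<gamma>_commutes(2)[symmetric] mult.assoc)
  show ?thesis unfolding 1 2 by (simp add: left_diff_distrib)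
qed

text \<open>The sum of all g m v^m, written coefficientwise. As \<gamma> m is a unit of K(H), the
  family \<open>g\<close> can be recovered, and statements about B turn into statements about
  families of polynomials.\<close>

definition Psi :: "(int \<Rightarrow> 'k poly) \<Rightarrow> int \<Rightarrow> 'k poly fract" where
  "Psi g = (\<lambda>i. if t dvd i then to_fract (g (i div t)) * \<gamma> (i div t) else 0)"

definition PF :: "(int \<Rightarrow> 'k poly) set" where
  "PF = {g. finite {m. g m \<noteq> 0}}"

definition PFdeg :: "nat \<Rightarrow> (int \<Rightarrow> 'k poly) set" where
  "PFdeg j = {g \<in> PF. \<forall>m. degree (g m) \<le> j}"

lemma Psi_at [simp]: "Psi g (m * t) = to_fract (g m) * \<gamma> m"
  using t_nonzero by (simp add: Psi_def)

lemma support_Psi: "{i. Psi g i \<noteq> 0} = (\<lambda>m. m * t) ` {m. g m \<noteq> 0}"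
  using t_nonzero by (auto simp: Psi_def mult.commute)

lemma Psi_closed_iff: "Psi g \<in> carrier BB \<longleftrightarrow> g \<in> PF"
  unfolding carrier_BB PF_def support_Psi mem_Collect_eq
  using t_nonzero by (intro finite_image_iff) (auto simp: inj_on_def)

lemma Psi_closed [simp]: "g \<in> PF \<Longrightarrow> Psi g \<in> carrier BB"
  by (simp add: Psi_closed_iff)

lemma Psi_eq_iff [simp]: "Psi g = Psi h \<longleftrightarrow> g = h"
proof
  assume "Psi g = Psi h"
  then have "Psi g (m * t) = Psi h (m * t)" for m by simp
  then show "g = h" by (simp add: fun_eq_iff)
qed simp

lemma Psi_eqI: "(\<And>m. f (m * t) = to_fract (g m) * \<gamma> m) \<Longrightarrow> (\<And>i. \<not> t dvd i \<Longrightarrow> f i = 0) \<Longrightarrow> f = Psi g"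
  using t_nonzero by (auto simp: Psi_def fun_eq_iff dvd_def mult.commute)

lemma PsiE:
  assumes "f \<in> carrier BB" "\<And>i. \<not> t dvd i \<Longrightarrow> f i = 0"
    and "\<And>m. \<exists>p. degree p \<le> j \<and> f (m * t) = to_fract p * \<gamma> m"
  shows "f \<in> Psi ` PFdeg j"
proof -
  obtain g where g: "\<And>m. degree (g m) \<le> j \<and> f (m * t) = to_fract (g m) * \<gamma> m"
    using assms(3) by metis
  then have "f = Psi g" using assms(2) by (intro Psi_eqI) auto
  moreover have "g \<in> PF" using assms(1) Psi_closed_iff calculation by simp
  ultimately show ?thesis using g by (auto simp: PFdeg_def)
qed

lemma ad_u:
  assumes "f \<in> carrier BB"
  shows "ad BB u f (i + n) = \<alpha> * sigma_pow n (f i) - f i * sigma_pow i \<alpha>"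
  using assms by (simp add: ad_lmonom)

lemma Nfilt_0_eq: "Nfilt BB u 0 = Psi ` PFdeg 0"
proof (intro equalityI subsetI)
  fix f assume "f \<in> Nfilt BB u 0"
  then have f: "f \<in> carrier BB" and "\<And>i. ad BB u f (i + n) = 0"
    by (auto simp: Nfilt_0 zero_BB)
  then have cent: "centralizes i (f i)" for i
    using ad_u by (metis centralizes_def eq_iff_diff_eq_0)
  show "f \<in> Psi ` PFdeg 0"
  proof (rule PsiE[OF f])
    fix i assume "\<not> t dvd i"
    then show "f i = 0" using centralizes_imp_dvd cent by blast
  next
    fix m
    have "(sigma_pow n (f (m * t) / \<gamma> m) - f (m * t) / \<gamma> m) * \<gamma> (m + r) = 0"
      using cent[of "m * t"] \<gamma>_delta[of "f (m * t) / \<gamma> m" m, symmetric]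
      by (simp add: centralizes_def)
    then have "sigma_pow n (f (m * t) / \<gamma> m) = f (m * t) / \<gamma> m" by simp
    then obtain c where "f (m * t) / \<gamma> m = to_fract [:c:]"
      using sigma_pow_fixed[OF n_nonzero] by blast
    then have "f (m * t) = to_fract [:c:] * \<gamma> m" by (simp add: field_simps)
    then show "\<exists>p. degree p \<le> 0 \<and> f (m * t) = to_fract p * \<gamma> m"
      by (intro exI[of _ "[:c:]"]) simp
  qed
next
  fix f assume "f \<in> Psi ` PFdeg 0"
  then obtain g where g: "f = Psi g" "g \<in> PF" "\<And>m. degree (g m) = 0"
    by (auto simp: PFdeg_def)
  have "ad BB u f (i + n) = 0" for i
  proof (cases "t dvd i")
    case True
    then obtain m where i: "i = m * t" by (metis dvd_div_mult_self)
    obtain c where "g m = [:c:]" using g(3)[of m] by (rule degree_eq_zeroE)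
    then show ?thesis
      using \<gamma>_delta[of "to_fract [:c:]" m] g by (simp add: ad_u i)
  next
    case False
    then have "Psi g i = 0" by (simp add: Psi_def)
    then show ?thesis using g by (simp add: ad_u)
  qed
  from this[of "i - n" for i] have "ad BB u f i = 0" for i by simp
  then show "f \<in> Nfilt BB u 0"
    using g(1,2) by (auto simp: Nfilt_0 zero_BB)
qed

lemma Nfilt_eq: "Nfilt BB u (int j) = Psi ` PFdeg j"
proof (induction j)
  case 0
  show ?case by (simp add: Nfilt_0_eq)
next
  case (Suc j)
  show ?case
  proof (intro equalityI subsetI)
    fix f assume "f \<in> Nfilt BB u (int (Suc j))"
    then have f: "f \<in> carrier BB" and "ad BB u f \<in> Psi ` PFdeg j"
      by (auto simp: Nfilt_Suc Suc simp del: of_nat_Suc)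
    then obtain g where g: "ad BB u f = Psi g" "\<And>m. degree (g m) \<le> j"
      by (auto simp: PFdeg_def)
    have *: "\<alpha> * sigma_pow n (f i) - f i * sigma_pow i \<alpha> = Psi g (i + n)" for i
      using g(1) ad_u[OF f] by metis
    show "f \<in> Psi ` PFdeg (Suc j)"
    proof (rule PsiE[OF f])
      fix i assume i: "\<not> t dvd i"
      \<comment> \<open>As t divides n, \<open>ad\<close> moves the coefficient at i to a position
        that t does not divide either, where \<open>Psi g\<close> vanishes. So f i X^i commutes with
        u and must be 0.\<close>
      then have "\<not> t dvd i + n" using t_dvd_n by (simp add: dvd_add_left_iff)
      then have "centralizes i (f i)" using *[of i] by (simp add: Psi_def centralizes_def)
      then show "f i = 0" using centralizes_imp_dvd i by blast
    next
      fix m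
      let ?x = "f (m * t) / \<gamma> m"
      have "(sigma_pow n ?x - ?x) * \<gamma> (m + r) = Psi g (m * t + n)"
        using *[of "m * t"] \<gamma>_delta[of ?x m] by simp
      also have "\<dots> = to_fract (g (m + r)) * \<gamma> (m + r)"
        unfolding mult_t_add_n by (rule Psi_at)
      finally have "sigma_pow n ?x - ?x = to_fract (g (m + r))" by simp
      then obtain q where "degree q \<le> Suc j" "?x = to_fract q"
        using sigma_pow_delta_poly_iff[OF n_nonzero, of j ?x] g(2) by blast
      then show "\<exists>p. degree p \<le> Suc j \<and> f (m * t) = to_fract p * \<gamma> m"
        by (intro exI[of _ q]) (simp add: field_simps)
    qed
  next
    fix f assume "f \<in> Psi ` PFdeg (Suc j)"
    then obtain g where g: "f = Psi g" "g \<in> PF" "\<And>m. degree (g m) \<le> Suc j"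
      by (auto simp: PFdeg_def)
    have f: "f \<in> carrier BB" using g by simp
    have "ad BB u f \<in> Psi ` PFdeg j"
    proof (rule PsiE)
      show "ad BB u f \<in> carrier BB" using f by (simp add: ad_closed)
    next
      fix i assume "\<not> t dvd i"
      then have "\<not> t dvd i - n" using t_dvd_n dvd_diff_right_iff[of t n i] by (metis dvd_add diff_add_cancel)
      then show "ad BB u f i = 0"
        using ad_u[OF f, of "i - n"] by (simp add: g(1) Psi_def)
    next
      fix m
      \<comment> \<open>u is v^r, so the term of the commutator at v^m comes from the term of f at
        v^(m - r).\<close>
      have *: "(m - r) * t + n = m * t" using mult_t_add_n[of "m - r"] by simp
      have "ad BB u f (m * t) =
          (sigma_pow n (to_fract (g (m - r))) - to_fract (g (m - r))) * \<gamma> m"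
        using ad_u[OF f, of "(m - r) * t"] \<gamma>_delta[of "to_fract (g (m - r))" "m - r"]
        unfolding * by (simp add: g(1))
      moreover obtain p where "degree p \<le> j"
        "sigma_pow n (to_fract (g (m - r))) - to_fract (g (m - r)) = to_fract p"
        using sigma_pow_delta_poly_iff[OF n_nonzero, of j "to_fract (g (m - r))"] g(3) by blast
      ultimately show "\<exists>p. degree p \<le> j \<and> ad BB u f (m * t) = to_fract p * \<gamma> m" by auto
    qed
    then show "f \<in> Nfilt BB u (int (Suc j))"
      using f by (auto simp: Nfilt_Suc Suc simp del: of_nat_Suc)
  qed
qed

end

subsection \<open>Subrings and finite generation\<close>

text \<open>The additive inverse is a description over the carrier, so shrinking the carrier changes
  its definition; uniqueness of inverses in the subring gives the same value.\<close>

lemma (in ring) a_inv_subring: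
  assumes "subring E R" "x \<in> E"
  shows "\<ominus>\<^bsub>R\<lparr>carrier := E\<rparr>\<^esub> x = \<ominus> x"
proof -
  interpret E: ring "R\<lparr>carrier := E\<rparr>" using assms(1) by (rule subring_is_ring)
  show ?thesis
    by (rule E.minus_equality) (use assms subringE[OF assms(1)] in \<open>auto simp: l_neg subset_eq\<close>)
qed

text \<open>\<open>affine_algebra\<close> measures generation inside the subring, while the
  generation arguments run in the ambient ring.\<close>

lemma (in ring) generate_ring_subring:
  assumes "subring E R" "S \<subseteq> E"
  shows "generate_ring (R\<lparr>carrier := E\<rparr>) S = generate_ring R S"
proof -
  interpret E: ring "R\<lparr>carrier := E\<rparr>" using assms(1) by (rule subring_is_ring)
  have S: "S \<subseteq> carrier R" using assms subringE(1) by blast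
  have 1: "generate_ring (R\<lparr>carrier := E\<rparr>) S \<subseteq> E"
    using E.generate_ring_incl[of S] assms(2) by simp
  have "x \<in> generate_ring R S" if "x \<in> generate_ring (R\<lparr>carrier := E\<rparr>) S" for x
    using that
  proof induction
    case (a_inv h)
    then show ?case using 1 a_inv_subring[OF assms(1)] generate_ring.a_inv by fastforce
  qed (auto intro: generate_ring.intros)
  moreover have "x \<in> generate_ring (R\<lparr>carrier := E\<rparr>) S" if "x \<in> generate_ring R S" for x
    using that
  proof induction
    case one
    then show ?case using generate_ring.one[of "R\<lparr>carrier := E\<rparr>" S] by simp
  next
    case (incl h)
    then show ?case by (rule generate_ring.incl)
  next
    case (a_inv h)
    then show ?case
      using 1 a_inv_subring[OF assms(1)] generate_ring.a_inv[of h "R\<lparr>carrier := E\<rparr>" S] by auto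
  next
    case (eng_add h1 h2)
    then show ?case using generate_ring.eng_add[of h1 "R\<lparr>carrier := E\<rparr>" S h2] by simp
  next
    case (eng_mult h1 h2)
    then show ?case using generate_ring.eng_mult[of h1 "R\<lparr>carrier := E\<rparr>" S h2] by simp
  qed
  ultimately show ?thesis by blast
qed

lemma is_algebra_subring_BB:
  fixes E :: "(int \<Rightarrow> 'k::field_char_0 poly fract) set"
  assumes "subring E BB" "range scalarB \<subseteq> E"
  shows "is_algebra scalarB (BB\<lparr>carrier := E\<rparr>)"
  unfolding is_algebra_def
proof (intro conjI allI ballI)
  show "ring (BB\<lparr>carrier := E\<rparr>)" by (rule BB.subring_is_ring[OF assms(1)])
  show "scalarB \<in> ring_hom ring_of_type_algebra (BB\<lparr>carrier := E\<rparr>)"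
    using scalarB_hom[where 'k = 'k] assms(2) by (auto simp: ring_hom_def)
  fix c x assume "x \<in> carrier (BB\<lparr>carrier := E\<rparr>)"
  then show "scalarB c \<otimes>\<^bsub>BB\<lparr>carrier := E\<rparr>\<^esub> x = x \<otimes>\<^bsub>BB\<lparr>carrier := E\<rparr>\<^esub> scalarB c"
    using scalarB_central subringE(1)[OF assms(1)] by auto
qed

lemma affine_algebra_subring_BB:
  fixes E :: "(int \<Rightarrow> 'k::field_char_0 poly fract) set"
  assumes E: "subring E BB" "range scalarB \<subseteq> E"
    and S: "finite S" "S \<subseteq> E" "E \<subseteq> generate_ring BB (range scalarB \<union> S)"
  shows "affine_algebra scalarB (BB\<lparr>carrier := E\<rparr>)"
  unfolding affine_algebra_def algebra_generated_def
proof (intro conjI exI[of _ S])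
  have "range scalarB \<union> S \<subseteq> carrier BB" using E S subringE(1)[OF E(1)] by auto
  then have "generate_ring BB (range scalarB \<union> S) \<subseteq> E"
    using E S by (intro BB.generate_ring_min_subring1) auto
  then show "generate_ring (BB\<lparr>carrier := E\<rparr>) (range scalarB \<union> S) = carrier (BB\<lparr>carrier := E\<rparr>)"
    using E S by (subst BB.generate_ring_subring) auto
qed (use is_algebra_subring_BB[OF E] S in auto)

subsection \<open>The algebra \<open>N(u, B)\<close>\<close>

lemma pshift_degree_0: "degree p = 0 \<Longrightarrow> pshift i p = p"
  by (auto elim: degree_eq_zeroE)

context canonical
begin

text \<open>The twisted convolution of K[H][v, v^-1; sigma^t], which results from v^m p =
  \<open>pshift (m * t) p\<close> v^m.\<close>

definition pmul :: "(int \<Rightarrow> 'k poly) \<Rightarrow> (int \<Rightarrow> 'k poly) \<Rightarrow> int \<Rightarrow> 'k poly" where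
  "pmul g h = (\<lambda>k. \<Sum>i | g i \<noteq> 0. g i * pshift (i * t) (h (k - i)))"

lemma Psi_add: "Psi g \<oplus>\<^bsub>BB\<^esub> Psi h = Psi (\<lambda>m. g m + h m)"
  by (auto simp: Psi_def add_BB distrib_right)

lemma Psi_zero: "\<zero>\<^bsub>BB\<^esub> = Psi (\<lambda>m. 0)"
  by (auto simp: Psi_def zero_BB)

lemma Psi_uminus: "g \<in> PF \<Longrightarrow> \<ominus>\<^bsub>BB\<^esub> Psi g = Psi (\<lambda>m. - g m)"
  by (simp add: a_inv_BB) (auto simp: Psi_def)

lemma Psi_single: "Psi (\<lambda>i. if i = m then p else 0) = lmonom (to_fract p * \<gamma> m) (m * t)"
  using t_nonzero by (auto simp: Psi_def lmonom_def fun_eq_iff)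

lemma Psi_one: "\<one>\<^bsub>BB\<^esub> = Psi (\<lambda>i. if i = 0 then 1 else 0)"
  by (simp add: Psi_single one_BB)

lemma Psi_scalar: "scalarB c = Psi (\<lambda>i. if i = 0 then [:c:] else 0)"
  by (simp add: Psi_single scalarB_def)

lemma Psi_HB_pow: "HB [^]\<^bsub>BB\<^esub> (j :: nat) = Psi (\<lambda>i. if i = 0 then [:0, 1:] ^ j else 0)"
  by (simp add: Psi_single HB_pow)

lemma Psi_v_pow: "v [^]\<^bsub>BB\<^esub> (m :: int) = Psi (\<lambda>i. if i = m then 1 else 0)"
  by (simp add: Psi_single lmonom_int_pow[OF \<beta>_nonzero])

lemma PF_single [simp]: "(\<lambda>i. if i = m then p else 0) \<in> PF"
proof -
  have "{i. (if i = m then p else 0) \<noteq> 0} \<subseteq> {m}" by auto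
  then show ?thesis unfolding PF_def using finite_subset by blast
qed

lemma PFdeg_single: "degree p \<le> j \<Longrightarrow> (\<lambda>i. if i = m then p else 0) \<in> PFdeg j"
  by (simp add: PFdeg_def)

lemma PF_zero [simp]: "(\<lambda>m. 0) \<in> PF"
  by (simp add: PF_def)

text \<open>Finiteness of the support is inherited from closure of the carrier of B through
  \<open>Psi_closed_iff\<close>.\<close>

lemma PF_add: "g \<in> PF \<Longrightarrow> h \<in> PF \<Longrightarrow> (\<lambda>m. g m + h m) \<in> PF"
  using BB.add.m_closed[of "Psi g" "Psi h"] by (simp only: Psi_add Psi_closed_iff)

lemma PF_uminus: "g \<in> PF \<Longrightarrow> (\<lambda>m. - g m) \<in> PF"
  by (simp add: PF_def)

lemma PFdeg_PF: "g \<in> PFdeg j \<Longrightarrow> g \<in> PF"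
  by (simp add: PFdeg_def)

lemma PFdeg_mono: "i \<le> j \<Longrightarrow> PFdeg i \<subseteq> PFdeg j"
  unfolding PFdeg_def by (fastforce intro: order.trans)

lemma PFdeg_zero: "(\<lambda>m. 0) \<in> PFdeg j"
  by (simp add: PFdeg_def)

lemma PFdeg_add: "g \<in> PFdeg j \<Longrightarrow> h \<in> PFdeg j \<Longrightarrow> (\<lambda>m. g m + h m) \<in> PFdeg j"
  by (auto simp: PFdeg_def PF_add intro: degree_add_le)

lemma PFdeg_uminus: "g \<in> PFdeg j \<Longrightarrow> (\<lambda>m. - g m) \<in> PFdeg j"
  by (simp add: PFdeg_def PF_uminus)

lemma PF_PFdeg:
  assumes "g \<in> PF" obtains j where "g \<in> PFdeg j"
proof
  let ?D = "insert 0 ((\<lambda>m. degree (g m)) ` {m. g m \<noteq> 0})"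
  have "finite ?D" using assms by (simp add: PF_def)
  moreover have "degree (g m) \<in> ?D" for m by (cases "g m = 0") auto
  ultimately have "degree (g m) \<le> Max ?D" for m by (rule Max_ge)
  then show "g \<in> PFdeg (Max ?D)"
    using assms by (simp add: PFdeg_def)
qed

text \<open>The cocycle identity merges \<gamma> m and the shifted \<gamma> (k - m) into \<gamma> k,
  so all summands at position k t carry the same unit, which factors out.\<close>

lemma Psi_mult:
  assumes g: "g \<in> PF"
  shows "Psi g \<otimes>\<^bsub>BB\<^esub> Psi h = Psi (pmul g h)"
proof (rule Psi_eqI)
  have fin: "finite {m. g m \<noteq> 0}" using g by (simp add: PF_def)
  have inj: "inj_on (\<lambda>m. m * t) {m. g m \<noteq> 0}" using t_nonzero by (auto simp: inj_on_def)
  have at: "(Psi g \<otimes>\<^bsub>BB\<^esub> Psi h) i =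
      (\<Sum>m | g m \<noteq> 0. to_fract (g m) * \<gamma> m * sigma_pow (m * t) (Psi h (i - m * t)))" for i
    by (simp add: mult_BB support_Psi sum.reindex[OF inj])
  show "(Psi g \<otimes>\<^bsub>BB\<^esub> Psi h) (k * t) = to_fract (pmul g h k) * \<gamma> k" for k
  proof -
    have *: "to_fract (g m) * \<gamma> m * sigma_pow (m * t) (Psi h (k * t - m * t)) =
        to_fract (g m * pshift (m * t) (h (k - m))) * \<gamma> k" for m
    proof -
      have "Psi h (k * t - m * t) = to_fract (h (k - m)) * \<gamma> (k - m)"
        using Psi_at[of h "k - m"] by (simp only: left_diff_distrib)
      then show ?thesis using \<gamma>_add[of m "k - m"] by simp
    qed
    show ?thesis unfolding at * by (simp add: pmul_def sum_distrib_right)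
  qed
  fix i assume "\<not> t dvd i"
  then have "\<not> t dvd i - m * t" for m
    by (metis diff_add_cancel dvd_add dvd_triv_right)
  then have "Psi h (i - m * t) = 0" for m by (simp add: Psi_def)
  then show "(Psi g \<otimes>\<^bsub>BB\<^esub> Psi h) i = 0" unfolding at by simp
qed

lemma PF_pmul: "g \<in> PF \<Longrightarrow> h \<in> PF \<Longrightarrow> pmul g h \<in> PF"
  using BB.m_closed[of "Psi g" "Psi h"] by (simp only: Psi_mult Psi_closed_iff)

lemma PFdeg_pmul:
  assumes "g \<in> PFdeg i" "h \<in> PFdeg j" shows "pmul g h \<in> PFdeg (i + j)"
proof -
  have "degree (pmul g h k) \<le> i + j" for k
    unfolding pmul_def
  proof (rule degree_sum_le)
    show "finite {m. g m \<noteq> 0}" using assms by (simp add: PFdeg_def PF_def)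
    fix m
    have "degree (g m * pshift (m * t) (h (k - m))) \<le> degree (g m) + degree (h (k - m))"
      using degree_mult_le[of "g m" "pshift (m * t) (h (k - m))"] by simp
    also have "\<dots> \<le> i + j" using assms by (intro add_mono) (auto simp: PFdeg_def)
    finally show "degree (g m * pshift (m * t) (h (k - m))) \<le> i + j" .
  qed
  then show ?thesis using assms PF_pmul by (simp add: PFdeg_def)
qed

lemma Cent_eq: "Cent BB u = Psi ` PFdeg 0"
  by (simp add: Cent_def Nfilt_0_eq)

lemma Nalg_eq: "Nalg BB u = Psi ` PF"
proof -
  have PF: "PF = (\<Union>j. PFdeg j)" by (auto elim: PF_PFdeg dest: PFdeg_PF)
  show ?thesis unfolding Nalg_def Nfilt_eq PF by (rule image_UN[symmetric])
qed

lemma subring_Nalg: "subring (Nalg BB u) BB"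
  unfolding Nalg_eq
  by (rule BB.subringI)
     (auto simp: Psi_one Psi_uminus Psi_add Psi_mult PF_uminus PF_add PF_pmul)

lemma subring_Cent: "subring (Cent BB u) BB"
  unfolding Cent_eq
proof (rule BB.subringI)
  show "\<one>\<^bsub>BB\<^esub> \<in> Psi ` PFdeg 0"
    unfolding Psi_one by (intro imageI PFdeg_single) simp
  fix f assume "f \<in> Psi ` PFdeg 0"
  then show "\<ominus>\<^bsub>BB\<^esub> f \<in> Psi ` PFdeg 0"
    by (auto simp: Psi_uminus PFdeg_PF PFdeg_uminus)
next
  fix f g assume fg: "f \<in> Psi ` PFdeg 0" "g \<in> Psi ` PFdeg 0"
  then show "f \<oplus>\<^bsub>BB\<^esub> g \<in> Psi ` PFdeg 0" by (auto simp: Psi_add PFdeg_add)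
  show "f \<otimes>\<^bsub>BB\<^esub> g \<in> Psi ` PFdeg 0"
    using fg PFdeg_pmul[of _ 0 _ 0] by (auto simp: Psi_mult PFdeg_PF)
qed (auto simp: PFdeg_PF)

lemma scalarB_Cent: "scalarB c \<in> Cent BB u"
  unfolding Psi_scalar Cent_eq by (intro imageI PFdeg_single) simp

lemma v_pow_Cent: "v [^]\<^bsub>BB\<^esub> (m :: int) \<in> Cent BB u"
  unfolding Psi_v_pow Cent_eq by (intro imageI PFdeg_single) simp

lemma Cent_Nalg: "Cent BB u \<subseteq> Nalg BB u"
  unfolding Cent_eq Nalg_eq using PFdeg_PF by blast

lemma HB_Nalg: "HB \<in> Nalg BB u"
  using Psi_HB_pow[of 1] unfolding Nalg_eq by auto

lemma scalarB_Nalg: "range scalarB \<subseteq> Nalg BB u"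
  using scalarB_Cent Cent_Nalg by blast

text \<open>Constants are fixed by every shift, so \<open>pmul\<close> becomes ordinary convolution,
  which is symmetric under replacing i by k - i.\<close>

lemma Cent_commute:
  assumes "f \<in> Cent BB u" "g \<in> Cent BB u"
  shows "f \<otimes>\<^bsub>BB\<^esub> g = g \<otimes>\<^bsub>BB\<^esub> f"
proof -
  obtain a b where ab: "f = Psi a" "a \<in> PFdeg 0" "g = Psi b" "b \<in> PFdeg 0"
    using assms unfolding Cent_eq by blast
  have const: "pshift i (a m) = a m" "pshift i (b m) = b m" for i m
    using ab by (auto simp: PFdeg_def intro!: pshift_degree_0)
  have fin: "finite {i. a i \<noteq> 0}" "finite {i. b i \<noteq> 0}"
    using ab by (auto simp: PFdeg_def PF_def)
  have "pmul a b k = pmul b a k" for k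
  proof -
    have "pmul a b k = (\<Sum>i | a i \<noteq> 0 \<and> b (k - i) \<noteq> 0. a i * b (k - i))"
      unfolding pmul_def const using fin(1) by (intro sum.mono_neutral_right) auto
    also have "\<dots> = (\<Sum>j | b j \<noteq> 0 \<and> a (k - j) \<noteq> 0. b j * a (k - j))"
      by (rule sum.reindex_bij_witness[of _ "\<lambda>j. k - j" "\<lambda>i. k - i"]) (simp_all add: mult.commute)
    also have "\<dots> = pmul b a k"
      unfolding pmul_def const using fin(2) by (intro sum.mono_neutral_left) auto
    finally show ?thesis .
  qed
  then have "pmul a b = pmul b a" by (rule ext)
  then show ?thesis using ab by (simp add: Psi_mult PFdeg_PF)
qed

lemma cring_Cent: "cring (BB\<lparr>carrier := Cent BB u\<rparr>)"
  by (intro cring.intro comm_monoid.intro BB.subring_is_ring subring_Cent ring.is_monoid)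
     (auto simp: comm_monoid_axioms_def Cent_commute)

section \<open>Generators of N(u, B) and C(u, B)\<close>

lemma v_pow_mem:
  assumes v: "v \<in> E" "v [^]\<^bsub>BB\<^esub> (- 1 :: int) \<in> E"
    and mult: "\<And>x y. x \<in> E \<Longrightarrow> y \<in> E \<Longrightarrow> x \<otimes>\<^bsub>BB\<^esub> y \<in> E" and one: "\<one>\<^bsub>BB\<^esub> \<in> E"
  shows "v [^]\<^bsub>BB\<^esub> (m :: int) \<in> E"
proof (induction m rule: int_induct[where k = 0])
  case base
  show ?case using one by simp
next
  case (step1 m)
  then show ?case
    using mult[OF step1(2) v(1)] lmonom_cocyc_mult[OF \<beta>_nonzero, of t m 1]
    by (simp add: lmonom_int_pow[OF \<beta>_nonzero])
next
  case (step2 m)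
  then show ?case
    using mult[OF step2(2) v(2)] lmonom_cocyc_mult[OF \<beta>_nonzero, of t m "- 1"]
    by (simp add: lmonom_int_pow[OF \<beta>_nonzero])
qed

lemma lmonom_0: "lmonom 0 i = \<zero>\<^bsub>BB\<^esub>"
  by (auto simp: lmonom_def zero_BB)

text \<open>Terms g m v^m are split off one at a time. The coefficients are only assumed to lie in
  \<open>E\<close>, so one induction serves N(u, B) with polynomial and C(u, B) with constant
  coefficients.\<close>

lemma Psi_mem:
  assumes g: "g \<in> PF" and E: "subring E BB" and coeffs: "\<And>m. lmonom (to_fract (g m)) 0 \<in> E"
    and v: "v \<in> E" "v [^]\<^bsub>BB\<^esub> (- 1 :: int) \<in> E"
  shows "Psi g \<in> E"
proof -
  have pow: "v [^]\<^bsub>BB\<^esub> m \<in> E" for m :: int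
    using v by (rule v_pow_mem) (use subringE[OF E] in auto)
  have "Psi g \<in> E" if "finite S" "{m. g m \<noteq> 0} = S" "\<And>m. lmonom (to_fract (g m)) 0 \<in> E" for S g
    using that
  proof (induction S arbitrary: g rule: finite_induct)
    case empty
    then have "Psi g = \<zero>\<^bsub>BB\<^esub>" by (auto simp: Psi_def zero_BB)
    then show ?case using subringE(2)[OF E] by simp
  next
    case (insert m S)
    have "lmonom (to_fract ((g(m := 0)) k)) 0 \<in> E" for k
      using insert.prems(2)[of k] subringE(2)[OF E] by (cases "k = m") (auto simp: lmonom_0)
    moreover have "{k. (g(m := 0)) k \<noteq> 0} = S" using insert.prems insert.hyps by auto
    ultimately have "Psi (g(m := 0)) \<in> E" using insert.IH by blast
    moreover have "lmonom (to_fract (g m)) 0 \<otimes>\<^bsub>BB\<^esub> v [^]\<^bsub>BB\<^esub> m \<in> E"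
      using insert.prems(2) pow subringE(6)[OF E] by blast
    moreover have "Psi g = lmonom (to_fract (g m)) 0 \<otimes>\<^bsub>BB\<^esub> v [^]\<^bsub>BB\<^esub> m \<oplus>\<^bsub>BB\<^esub> Psi (g(m := 0))"
    proof -
      have "lmonom (to_fract (g m)) 0 \<otimes>\<^bsub>BB\<^esub> v [^]\<^bsub>BB\<^esub> m = Psi (\<lambda>i. if i = m then g m else 0)"
        by (simp add: lmonom_int_pow[OF \<beta>_nonzero] lmonom_mult Psi_single)
      then show ?thesis by (simp only: Psi_add Psi_eq_iff) (auto simp: fun_eq_iff)
    qed
    ultimately show ?case using subringE(7)[OF E] by simp
  qed
  then show ?thesis using g coeffs by (simp add: PF_def)
qed

text \<open>Horner's scheme: \<open>pCons a p\<close> is a + H p.\<close>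

lemma lmonom_poly_mem:
  assumes E: "subring E BB" and "range scalarB \<subseteq> E" "HB \<in> E"
  shows "lmonom (to_fract p) 0 \<in> E"
proof (induction p)
  case 0
  have "lmonom (to_fract 0) 0 = scalarB 0" by (simp add: scalarB_def)
  then show ?case using assms(2) by auto
next
  case (pCons a p)
  have "lmonom (to_fract (pCons a p)) 0 = scalarB a \<oplus>\<^bsub>BB\<^esub> HB \<otimes>\<^bsub>BB\<^esub> lmonom (to_fract p) 0"
    by (simp add: scalarB_def HB_def lmonom_mult del: to_fract_mult flip: to_fract_mult)
       (auto simp: lmonom_def add_BB simp del: to_fract_add simp flip: to_fract_add)
  moreover have "HB \<otimes>\<^bsub>BB\<^esub> lmonom (to_fract p) 0 \<in> E"
    using pCons(2) assms(3) by (intro subringE(6)[OF E])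
  ultimately show ?case using assms(2) subringE(7)[OF E] by auto
qed

lemma Nalg_generated:
  assumes "subring E BB" "range scalarB \<subseteq> E" "HB \<in> E" "v \<in> E" "v [^]\<^bsub>BB\<^esub> (- 1 :: int) \<in> E"
  shows "Nalg BB u \<subseteq> E"
  unfolding Nalg_eq using Psi_mem lmonom_poly_mem assms by blast

lemma Cent_generated:
  assumes E: "subring E BB" "range scalarB \<subseteq> E" "v \<in> E" "v [^]\<^bsub>BB\<^esub> (- 1 :: int) \<in> E"
  shows "Cent BB u \<subseteq> E"
  unfolding Cent_eq
proof (rule image_subsetI)
  fix g assume g: "g \<in> PFdeg 0"
  show "Psi g \<in> E"
  proof (rule Psi_mem[OF PFdeg_PF[OF g] E(1) _ E(3,4)])
    fix m
    obtain c where "g m = [:c:]" using g by (auto simp: PFdeg_def elim: degree_eq_zeroE)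
    then have "lmonom (to_fract (g m)) 0 = scalarB c" by (simp add: scalarB_def)
    then show "lmonom (to_fract (g m)) 0 \<in> E" using E(2) by auto
  qed
qed

lemma v_Cent: "v \<in> Cent BB u"
  using v_pow_Cent[of 1] by (simp add: lmonom_int_pow[OF \<beta>_nonzero])

lemma Nalg_algebra_generated:
  "Nalg BB u = algebra_generated scalarB BB (Cent BB u \<union> {HB})"
  unfolding algebra_generated_def
proof (rule equalityI)
  let ?S = "range scalarB \<union> (Cent BB u \<union> {HB})"
  have S: "?S \<subseteq> Nalg BB u" using scalarB_Nalg Cent_Nalg HB_Nalg by blast
  then have S': "?S \<subseteq> carrier BB" using subringE(1)[OF subring_Nalg] by blast
  show "generate_ring BB ?S \<subseteq> Nalg BB u"
    by (rule BB.generate_ring_min_subring1[OF S' subring_Nalg S])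
  show "Nalg BB u \<subseteq> generate_ring BB ?S"
    by (rule Nalg_generated[OF BB.generate_ring_is_subring[OF S']])
       (use v_Cent v_pow_Cent in \<open>auto intro: generate_ring.incl\<close>)
qed

lemma affine_Nalg: "affine_algebra scalarB (BB\<lparr>carrier := Nalg BB u\<rparr>)"
proof (rule affine_algebra_subring_BB[OF subring_Nalg scalarB_Nalg])
  let ?S = "{HB, v, v [^]\<^bsub>BB\<^esub> (- 1 :: int)}"
  show S: "?S \<subseteq> Nalg BB u" using HB_Nalg v_Cent v_pow_Cent Cent_Nalg by blast
  have "range scalarB \<union> ?S \<subseteq> carrier BB"
    using S scalarB_Nalg subringE(1)[OF subring_Nalg] by blast
  then show "Nalg BB u \<subseteq> generate_ring BB (range scalarB \<union> ?S)"
    by (intro Nalg_generated BB.generate_ring_is_subring) (auto intro: generate_ring.incl)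
qed simp

lemma affine_Cent: "affine_algebra scalarB (BB\<lparr>carrier := Cent BB u\<rparr>)"
proof (rule affine_algebra_subring_BB[OF subring_Cent])
  let ?S = "{v, v [^]\<^bsub>BB\<^esub> (- 1 :: int)}"
  show S: "?S \<subseteq> Cent BB u" using v_Cent v_pow_Cent by blast
  show "range scalarB \<subseteq> Cent BB u" using scalarB_Cent by blast
  then have "range scalarB \<union> ?S \<subseteq> carrier BB"
    using S subringE(1)[OF subring_Cent] by blast
  then show "Cent BB u \<subseteq> generate_ring BB (range scalarB \<union> ?S)"
    by (intro Cent_generated BB.generate_ring_is_subring) (auto intro: generate_ring.incl)
qed simp

text \<open>In the normal form the polynomials stand to the left of v^m, whereas here H stands on
  the right. Since v^m p = \<open>pshift (m * t) p\<close> v^m, a coefficient has to be expanded in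
  powers of H after undoing the shift.\<close>

lemma Nfilt_sum_HB:
  "Nfilt BB u (int j) =
     {\<Oplus>\<^bsub>BB\<^esub>i\<in>{..j}. c i \<otimes>\<^bsub>BB\<^esub> HB [^]\<^bsub>BB\<^esub> i | c. c \<in> {..j} \<rightarrow> Cent BB u}"
proof (intro equalityI subsetI)
  fix f assume "f \<in> Nfilt BB u (int j)"
  then obtain g where g: "f = Psi g" "g \<in> PF" "\<And>m. degree (g m) \<le> j"
    unfolding Nfilt_eq PFdeg_def by blast
  \<comment> \<open>The constant in front of v^m H^i: the i-th coefficient of g m once it is moved
    to the right of v^m.\<close>
  define a where "a = (\<lambda>i m. [:coeff (pshift (- (m * t)) (g m)) i:])"
  have a: "a i \<in> PFdeg 0" for i
  proof -
    have "{m. a i m \<noteq> 0} \<subseteq> {m. g m \<noteq> 0}" by (auto simp: a_def)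
    then have "a i \<in> PF" using g(2) unfolding PF_def by (auto intro: finite_subset)
    then show ?thesis by (simp add: PFdeg_def a_def)
  qed
  have a_HB: "Psi (a i) \<otimes>\<^bsub>BB\<^esub> HB [^]\<^bsub>BB\<^esub> i = Psi (\<lambda>m. a i m * pshift (m * t) ([:0, 1:] ^ i))" for i
  proof -
    have "pmul (a i) (\<lambda>k. if k = 0 then [:0, 1:] ^ i else 0) k = a i k * pshift (k * t) ([:0, 1:] ^ i)"
      for k
    proof -
      have "pmul (a i) (\<lambda>k. if k = 0 then [:0, 1:] ^ i else 0) k =
          (\<Sum>m | a i m \<noteq> 0. if m = k then a i k * pshift (k * t) ([:0, 1:] ^ i) else 0)"
        unfolding pmul_def by (intro sum.cong) auto
      also have "\<dots> = a i k * pshift (k * t) ([:0, 1:] ^ i)"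
        using a[of i] by (simp add: PFdeg_def PF_def)
      finally show ?thesis .
    qed
    then show ?thesis unfolding Psi_HB_pow Psi_mult[OF PFdeg_PF[OF a]] Psi_eq_iff by (rule ext)
  qed
  have "f = (\<Oplus>\<^bsub>BB\<^esub>i\<in>{..j}. Psi (a i) \<otimes>\<^bsub>BB\<^esub> HB [^]\<^bsub>BB\<^esub> i)"
  proof -
    have "g m = (\<Sum>i\<le>j. a i m * pshift (m * t) ([:0, 1:] ^ i))" for m
    proof -
      let ?h = "pshift (- (m * t)) (g m)"
      have "?h = (\<Sum>i\<le>j. monom (coeff ?h i) i)"
        using g(3)[of m] by (intro poly_as_sum_of_monoms'[symmetric]) simp
      then have "pshift (m * t) ?h = (\<Sum>i\<le>j. pshift (m * t) (monom (coeff ?h i) i))"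
        by (simp only: pshift_def pcompose_sum[symmetric])
      moreover have "monom c i = [:c:] * [:0, 1:] ^ i" for c :: 'k and i
        by (simp add: monom_altdef)
      ultimately show ?thesis by (simp add: pshift_pshift pshift_smult a_def)
    qed
    then have "f = (\<lambda>k. \<Sum>i\<le>j. Psi (\<lambda>m. a i m * pshift (m * t) ([:0, 1:] ^ i)) k)"
      unfolding g(1) by (intro Psi_eqI[symmetric])
        (simp_all add: Psi_def sum_distrib_right t_nonzero del: to_fract_mult)
    then show ?thesis
      unfolding a_HB[symmetric] by (subst finsum_BB) (simp_all add: PFdeg_PF[OF a])
  qed
  then show "f \<in> {\<Oplus>\<^bsub>BB\<^esub>i\<in>{..j}. c i \<otimes>\<^bsub>BB\<^esub> HB [^]\<^bsub>BB\<^esub> i | c. c \<in> {..j} \<rightarrow> Cent BB u}"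
    using a unfolding Cent_eq by (intro CollectI exI[of _ "\<lambda>i. Psi (a i)"]) auto
next
  fix f assume "f \<in> {\<Oplus>\<^bsub>BB\<^esub>i\<in>{..j}. c i \<otimes>\<^bsub>BB\<^esub> HB [^]\<^bsub>BB\<^esub> i | c. c \<in> {..j} \<rightarrow> Cent BB u}"
  then obtain c where c: "f = (\<Oplus>\<^bsub>BB\<^esub>i\<in>{..j}. c i \<otimes>\<^bsub>BB\<^esub> HB [^]\<^bsub>BB\<^esub> i)" "c \<in> {..j} \<rightarrow> Cent BB u"
    by blast
  have mem: "c i \<otimes>\<^bsub>BB\<^esub> HB [^]\<^bsub>BB\<^esub> i \<in> Psi ` PFdeg j" if "i \<le> j" for i
  proof -
    have "c i \<in> Psi ` PFdeg 0" using c(2) that unfolding Cent_eq by auto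
    then obtain g where g: "c i = Psi g" "g \<in> PFdeg 0" by blast
    have "(\<lambda>k. if k = 0 then [:0, 1:] ^ i else 0) \<in> PFdeg i"
      by (rule PFdeg_single) (simp add: degree_linear_power)
    from PFdeg_pmul[OF g(2) this] show ?thesis
      using PFdeg_mono[OF that] g by (auto simp: Psi_HB_pow Psi_mult PFdeg_PF)
  qed
  have "(\<Oplus>\<^bsub>BB\<^esub>i\<in>S. c i \<otimes>\<^bsub>BB\<^esub> HB [^]\<^bsub>BB\<^esub> i) \<in> Psi ` PFdeg j" if "finite S" "S \<subseteq> {..j}" for S
    using that
  proof (induction S rule: finite_induct)
    case empty
    show ?case using PFdeg_zero by (auto simp: Psi_zero)
  next
    case (insert i S)
    have closed: "c k \<otimes>\<^bsub>BB\<^esub> HB [^]\<^bsub>BB\<^esub> k \<in> carrier BB" if "k \<le> j" for k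
      using mem[OF that] by (auto dest: PFdeg_PF)
    have "(\<Oplus>\<^bsub>BB\<^esub>i\<in>insert i S. c i \<otimes>\<^bsub>BB\<^esub> HB [^]\<^bsub>BB\<^esub> i) =
        c i \<otimes>\<^bsub>BB\<^esub> HB [^]\<^bsub>BB\<^esub> i \<oplus>\<^bsub>BB\<^esub> (\<Oplus>\<^bsub>BB\<^esub>i\<in>S. c i \<otimes>\<^bsub>BB\<^esub> HB [^]\<^bsub>BB\<^esub> i)"
      using insert closed by (intro BB.finsum_insert) auto
    then show ?case using insert mem[of i] by (auto simp: Psi_add PFdeg_add)
  qed
  then show "f \<in> Nfilt BB u (int j)" using c(1) by (simp add: Nfilt_eq)
qed

lemma HB_pow_Nfilt: "HB [^]\<^bsub>BB\<^esub> j \<in> Nfilt BB u (int j) - Nfilt BB u (int j - 1)"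
proof
  have deg: "degree ([:0, 1 :: 'k:] ^ j) = j" by (simp add: degree_linear_power)
  show "HB [^]\<^bsub>BB\<^esub> j \<in> Nfilt BB u (int j)"
    unfolding Nfilt_eq Psi_HB_pow by (intro imageI PFdeg_single) (simp add: deg)
  show "HB [^]\<^bsub>BB\<^esub> j \<notin> Nfilt BB u (int j - 1)"
  proof (cases j)
    \<comment> \<open>The lower piece is N(u, -1, B) = 0, so the claim is that 1 is nonzero.\<close>
    case 0
    then show ?thesis
      by (simp add: Nfilt_def one_BB zero_BB) (auto simp: lmonom_def dest: fun_cong[where x = 0])
  next
    case (Suc i)
    have "Psi (\<lambda>i. if i = 0 then [:0, 1:] ^ j else 0) \<notin> Psi ` PFdeg i"
    proof
      assume "Psi (\<lambda>i. if i = 0 then [:0, 1:] ^ j else 0) \<in> Psi ` PFdeg i"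
      then have "(\<lambda>i. if i = 0 then [:0, 1:] ^ j else 0) \<in> PFdeg i" by auto
      then have "degree ([:0, 1 :: 'k:] ^ j) \<le> i" unfolding PFdeg_def by (auto dest!: spec[of _ 0])
      then show False using deg Suc by simp
    qed
    moreover have "int j - 1 = int i" using Suc by simp
    ultimately show ?thesis by (simp add: Psi_HB_pow Nfilt_eq)
  qed
qed

end

subsection \<open>The skew Laurent extension \<open>K[H][v, v\<^sup>-\<^sup>1; \<sigma>\<^sup>t]\<close>\<close>

lemma KpolyH_simps [simp]:
  "carrier (KpolyH :: 'k::field_char_0 poly fract ring) = range to_fract"
  "\<zero>\<^bsub>KpolyH :: 'k poly fract ring\<^esub> = 0"
  "\<one>\<^bsub>KpolyH :: 'k poly fract ring\<^esub> = 1"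
  "monoid.mult (KpolyH :: 'k poly fract ring) = (*)"
  "ring.add (KpolyH :: 'k poly fract ring) = (+)"
  by (simp_all add: KpolyH_def)

lemma finsum_KpolyH:
  assumes "finite A"
  shows "finsum KpolyH (\<lambda>i. to_fract (f i)) A = to_fract (\<Sum>i\<in>A. f i :: 'k::field_char_0 poly)"
proof -
  interpret abelian_monoid "KpolyH :: 'k poly fract ring"
    by (rule abelian_monoidI) (auto simp: add_ac simp flip: to_fract_add intro: range_eqI[of _ _ 0])
  show ?thesis using assms
    by (induction A rule: finite_induct) auto
qed

text \<open>Here negative powers invert the restriction of sigma^t to K[H]. That restriction is onto
  because the shift by \<open>- t\<close> preserves polynomials, so the values agree with those in
  K(H).\<close>

lemma iter_int_KpolyH:
  "iter_int (range to_fract) (sigma_pow t) i (to_fract p) = to_fract (pshift (i * t) p)"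
proof -
  have 1: "(sigma_pow t ^^ k) (to_fract p) = to_fract (pshift (int k * t) p)" for k p
    by (induction k) (simp_all add: pshift_pshift algebra_simps)
  have inv: "inv_into (range to_fract) (sigma_pow t) (to_fract p) = to_fract (pshift (- t) p)"
    for p :: "'a poly"
    by (rule inv_into_f_eq)
       (auto simp: pshift_pshift intro: inj_on_subset[OF bij_is_inj[OF bij_sigma_pow]])
  have 2: "(inv_into (range to_fract) (sigma_pow t) ^^ k) (to_fract p) = to_fract (pshift (- int k * t) p)"
    for k and p :: "'a poly"
    by (induction k) (simp_all add: inv pshift_pshift algebra_simps)
  show ?thesis
    using 1[of "nat i" p] 2[of "nat (- i)" p] by (simp add: iter_int_def)
qed

context canonical
begin

lemma carrier_skew_laurent_KpolyH:
  "carrier (skew_laurent KpolyH (sigma_pow t)) = (\<lambda>g i. to_fract (g i)) ` PF"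
proof (intro equalityI subsetI)
  fix f :: "int \<Rightarrow> 'k poly fract" assume "f \<in> carrier (skew_laurent KpolyH (sigma_pow t))"
  then have f: "range f \<subseteq> range to_fract" "finite {i. f i \<noteq> 0}" by (auto simp: skew_laurent_def)
  then have "\<forall>i. \<exists>p. f i = to_fract p" by auto
  then obtain g where "f = (\<lambda>i. to_fract (g i))" by metis
  then show "f \<in> (\<lambda>g i. to_fract (g i)) ` PF" using f(2) by (auto simp: PF_def)
qed (auto simp: skew_laurent_def PF_def)

lemma laurent_subst_Psi:
  assumes "g \<in> PF"
  shows "laurent_subst KpolyH BB (\<lambda>a. lmonom a 0) v (\<lambda>i. to_fract (g i)) = Psi g"
proof -
  have fin: "finite {i. g i \<noteq> 0}" using assms by (simp add: PF_def)
  have summand: "lmonom (to_fract (g i)) 0 \<otimes>\<^bsub>BB\<^esub> v [^]\<^bsub>BB\<^esub> i = Psi (\<lambda>k. if k = i then g i else 0)" for i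
    by (simp add: lmonom_int_pow[OF \<beta>_nonzero] lmonom_mult Psi_single)
  have "laurent_subst KpolyH BB (\<lambda>a. lmonom a 0) v (\<lambda>i. to_fract (g i)) =
      (\<lambda>k. \<Sum>i | g i \<noteq> 0. Psi (\<lambda>k. if k = i then g i else 0) k)"
    using fin by (simp add: laurent_subst_def summand finsum_BB)
  also have "\<dots> = Psi g"
  proof (rule Psi_eqI)
    fix m
    have "(\<Sum>i | g i \<noteq> 0. Psi (\<lambda>k. if k = i then g i else 0) (m * t)) =
        (\<Sum>i | g i \<noteq> 0. if i = m then to_fract (g m) * \<gamma> m else 0)"
      by (intro sum.cong) auto
    then show "(\<Sum>i | g i \<noteq> 0. Psi (\<lambda>k. if k = i then g i else 0) (m * t)) = to_fract (g m) * \<gamma> m"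
      using fin by simp
  qed (simp add: Psi_def)
  finally show ?thesis .
qed

text \<open>On coefficient families the substitution is \<open>Psi\<close> and the product of
  \<open>skew_laurent\<close> is \<open>pmul\<close>, so the claim reduces to the properties of
  \<open>Psi\<close>.\<close>

lemma laurent_subst_iso:
  "laurent_subst KpolyH BB (\<lambda>a. lmonom a 0) v
     \<in> ring_iso (skew_laurent KpolyH (sigma_pow t)) (BB\<lparr>carrier := Nalg BB u\<rparr>)"
proof (rule ring_iso_memI)
  let ?S = "skew_laurent KpolyH (sigma_pow t) :: (int \<Rightarrow> 'k poly fract) ring"
  let ?L = "laurent_subst KpolyH BB (\<lambda>a. lmonom a 0) v"
  let ?T = "\<lambda>g i. to_fract (g i) :: 'k poly fract"
  fix x assume "x \<in> carrier ?S"
  then obtain g where g: "x = ?T g" "g \<in> PF" unfolding carrier_skew_laurent_KpolyH by blast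
  then show "?L x \<in> carrier (BB\<lparr>carrier := Nalg BB u\<rparr>)"
    by (simp add: laurent_subst_Psi Nalg_eq)
  fix y assume "y \<in> carrier ?S"
  then obtain h where h: "y = ?T h" "h \<in> PF" unfolding carrier_skew_laurent_KpolyH by blast
  have "x \<otimes>\<^bsub>?S\<^esub> y = ?T (pmul g h)"
  proof
    fix k
    have "(x \<otimes>\<^bsub>?S\<^esub> y) k =
        (\<Oplus>\<^bsub>KpolyH\<^esub>i\<in>{i. g i \<noteq> 0}. to_fract (g i * pshift (i * t) (h (k - i))))"
      by (simp add: skew_laurent_def g h iter_int_KpolyH)
    then show "(x \<otimes>\<^bsub>?S\<^esub> y) k = ?T (pmul g h) k"
      using g(2) by (simp only: finsum_KpolyH PF_def mem_Collect_eq pmul_def)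
  qed
  then show "?L (x \<otimes>\<^bsub>?S\<^esub> y) = ?L x \<otimes>\<^bsub>BB\<lparr>carrier := Nalg BB u\<rparr>\<^esub> ?L y"
    by (simp add: g h laurent_subst_Psi PF_pmul Psi_mult)
  have "x \<oplus>\<^bsub>?S\<^esub> y = ?T (\<lambda>i. g i + h i)"
    by (simp add: skew_laurent_def g h)
  then show "?L (x \<oplus>\<^bsub>?S\<^esub> y) = ?L x \<oplus>\<^bsub>BB\<lparr>carrier := Nalg BB u\<rparr>\<^esub> ?L y"
    using PF_add[OF g(2) h(2)] by (simp add: g h laurent_subst_Psi Psi_add del: to_fract_add)
next
  have "\<one>\<^bsub>skew_laurent KpolyH (sigma_pow t)\<^esub> =
      (\<lambda>i. to_fract (if i = (0 :: int) then 1 else 0 :: 'k poly))"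
    by (auto simp: skew_laurent_def)
  then show "laurent_subst KpolyH BB (\<lambda>a. lmonom a 0) v \<one>\<^bsub>skew_laurent KpolyH (sigma_pow t)\<^esub> =
      \<one>\<^bsub>BB\<lparr>carrier := Nalg BB u\<rparr>\<^esub>"
    by (simp only: laurent_subst_Psi[OF PF_single]) (simp add: Psi_one)
next
  show "bij_betw (laurent_subst KpolyH BB (\<lambda>a. lmonom a 0) v)
      (carrier (skew_laurent KpolyH (sigma_pow t))) (carrier (BB\<lparr>carrier := Nalg BB u\<rparr>))"
    unfolding bij_betw_def inj_on_def carrier_skew_laurent_KpolyH
    by (auto simp: laurent_subst_Psi Nalg_eq image_image)
qed

end

subsection \<open>The Hilbert basis theorem for twisted Laurent sequences\<close>

text \<open>A family \<open>g\<close> stands for \<open>\<Sum>m. g m v\<^sup>m\<close> when right ideals are considered, and for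
  \<open>\<Sum>m. v\<^sup>m g m\<close> in the case of left ideals. Multiplication by \<open>p \<in> K[H]\<close> on the far side of the
  powers of \<open>v\<close> then acts by shifts of \<open>p\<close>, with opposite signs of \<open>s\<close> in the two cases.\<close>

definition twisted_module :: "int \<Rightarrow> (int \<Rightarrow> 'k::field_char_0 poly) set \<Rightarrow> bool" where
  "twisted_module s J \<longleftrightarrow> (\<lambda>m. 0) \<in> J \<and>
     (\<forall>g\<in>J. \<forall>h\<in>J. (\<lambda>m. g m + h m) \<in> J) \<and>
     (\<forall>g\<in>J. \<forall>d. (\<lambda>m. g (m - d)) \<in> J) \<and>
     (\<forall>g\<in>J. \<forall>p. (\<lambda>m. pshift (m * s) p * g m) \<in> J)"

lemma twisted_moduleD:
  assumes "twisted_module s J"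
  shows "(\<lambda>m. 0) \<in> J"
    and "g \<in> J \<Longrightarrow> h \<in> J \<Longrightarrow> (\<lambda>m. g m + h m) \<in> J"
    and "g \<in> J \<Longrightarrow> (\<lambda>m. g (m - d)) \<in> J"
    and "g \<in> J \<Longrightarrow> (\<lambda>m. pshift (m * s) p * g m) \<in> J"
  using assms unfolding twisted_module_def by blast+

text \<open>Counterpart of the ordinary polynomials in v of degree less than d; Laurent families are
  shifted into such a window.\<close>

definition supported_below :: "nat \<Rightarrow> (int \<Rightarrow> 'k::field_char_0 poly) set" where
  "supported_below d = {g. \<forall>m. g m \<noteq> 0 \<longrightarrow> 0 \<le> m \<and> m < int d}"

lemma supported_below_0: "g \<in> supported_below 0 \<Longrightarrow> g = (\<lambda>m. 0)"
  by (rule ext, rule ccontr) (simp add: supported_below_def, force)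

lemma supported_below_Suc:
  assumes g: "g \<in> supported_below (Suc d)" and "g (int d) = 0"
  shows "g \<in> supported_below d"
proof -
  have "0 \<le> m \<and> m < int d" if "g m \<noteq> 0" for m
  proof -
    have "m \<noteq> int d" using that assms(2) by blast
    moreover have "0 \<le> m \<and> m < int (Suc d)" using g that by (simp add: supported_below_def)
    ultimately show ?thesis by simp
  qed
  then show ?thesis by (simp add: supported_below_def)
qed

text \<open>Division with remainder of the top coefficients: the remainder would contradict the
  minimality of the degree of \<open>b d\<close> unless it vanishes.\<close>

lemma twisted_reduce:
  assumes I: "twisted_module s I"
    and g: "g \<in> I \<inter> supported_below (Suc d)" and b: "b \<in> I \<inter> supported_below (Suc d)"
    and nonzero: "b (int d) \<noteq> 0"
    and minimal: "\<And>h. h \<in> I \<inter> supported_below (Suc d) \<Longrightarrow> h (int d) \<noteq> 0 \<Longrightarrow>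
      degree (b (int d)) \<le> degree (h (int d))"
    and J: "twisted_module s J" "b \<in> J" "I \<inter> supported_below d \<subseteq> J"
  shows "g \<in> J"
proof -
  \<comment> \<open>In a twisted module, multiplication by q shifts q by d s at the index d. The
    opposite shift cancels this, so the top coefficient of \<open>h\<close> is the
    remainder.\<close>
  define q where "q = pshift (- (int d * s)) (g (int d) div b (int d))"
  define h where "h = (\<lambda>m. g m + pshift (m * s) (- q) * b m)"
  have uminus: "pshift i (- q) = - pshift i q" for i
    using pshift_diff[of i 0 q] by simp
  have "h \<in> I"
    unfolding h_def using g b by (intro twisted_moduleD(2,4)[OF I]) auto
  moreover have "h \<in> supported_below (Suc d)"
    using g b unfolding supported_below_def h_def by (auto; metis add.right_neutral mult_zero_right)
  moreover have top: "h (int d) = g (int d) mod b (int d)"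
    unfolding h_def uminus by (simp add: q_def pshift_pshift minus_div_mult_eq_mod[symmetric])
  ultimately have "h (int d) = 0"
    using minimal[of h] degree_mod_less[OF nonzero, of "g (int d)"] by fastforce
  then have "h \<in> supported_below d"
    by (rule supported_below_Suc[OF \<open>h \<in> supported_below (Suc d)\<close>])
  then have "h \<in> J" using \<open>h \<in> I\<close> J(3) by blast
  moreover have "g = (\<lambda>m. h m + pshift (m * s) q * b m)" by (simp add: h_def uminus)
  ultimately show ?thesis
    using twisted_moduleD(2,4)[OF J(1)] J(2) by simp
qed

text \<open>The coefficients at the top index d form an ideal of the Euclidean ring K[H], so each
  step of the induction adds at most one generator. Quantifying over all \<open>J\<close> that
  contain \<open>A\<close> expresses generation without defining spans.\<close>

lemma twisted_module_bounded_fg: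
  assumes I: "twisted_module s I"
  shows "\<exists>A. finite A \<and> A \<subseteq> I \<and>
    (\<forall>J. twisted_module s J \<longrightarrow> A \<subseteq> J \<longrightarrow> I \<inter> supported_below d \<subseteq> J)"
proof (induction d)
  case 0
  have "I \<inter> supported_below 0 \<subseteq> {\<lambda>m. 0}" using supported_below_0 by blast
  then show ?case
    by (intro exI[of _ "{}"]) (auto dest: twisted_moduleD(1))
next
  case (Suc d)
  then obtain A where A: "finite A" "A \<subseteq> I"
    "\<And>J. twisted_module s J \<Longrightarrow> A \<subseteq> J \<Longrightarrow> I \<inter> supported_below d \<subseteq> J" by blast
  define P where "P g \<longleftrightarrow> g \<in> I \<inter> supported_below (Suc d) \<and> g (int d) \<noteq> 0" for g
  show ?case
  proof (cases "\<exists>g. P g")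
    case True
    then obtain b where b: "P b" "\<And>g. P g \<Longrightarrow> degree (b (int d)) \<le> degree (g (int d))"
      using ex_has_least_nat[of P _ "\<lambda>g. degree (g (int d))"] by blast
    have "I \<inter> supported_below (Suc d) \<subseteq> J" if J: "twisted_module s J" "insert b A \<subseteq> J" for J
    proof
      fix g assume "g \<in> I \<inter> supported_below (Suc d)"
      then show "g \<in> J"
        by (rule twisted_reduce[OF I, of _ d b]) (use b J A(3)[of J] in \<open>auto simp: P_def\<close>)
    qed
    then show ?thesis using A b(1) by (intro exI[of _ "insert b A"]) (auto simp: P_def)
  next
    case False
    then have "I \<inter> supported_below (Suc d) \<subseteq> I \<inter> supported_below d"
      unfolding P_def using supported_below_Suc by blast
    then show ?thesis using A by (intro exI[of _ A]) blast
  qed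
qed

text \<open>Among the leading coefficients in all exponents pick one of least degree, belonging to b
  with top index e. Shifted copies of b reduce every element with top index at least e, and
  \<open>twisted_module_bounded_fg\<close> takes care of the elements supported below e.\<close>

lemma twisted_module_fg:
  assumes I: "twisted_module s I" and fin: "\<And>g. g \<in> I \<Longrightarrow> finite {m. g m \<noteq> 0}"
  shows "\<exists>A. finite A \<and> A \<subseteq> I \<and> (\<forall>J. twisted_module s J \<longrightarrow> A \<subseteq> J \<longrightarrow> I \<subseteq> J)"
proof -
  have all: "I \<subseteq> J"
    if J: "twisted_module s J" "\<And>d. I \<inter> supported_below d \<subseteq> J" for J
  proof
    fix g assume g: "g \<in> I"
    \<comment> \<open>Shifting by N moves the support from [-N, N] into [0, 2 N], where
      \<open>supported_below\<close> applies.\<close>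
    define N where "N = Max (insert 0 (abs ` {m. g m \<noteq> 0}))"
    have "finite (insert 0 (abs ` {m. g m \<noteq> 0}))" using fin[OF g] by simp
    then have N: "\<And>m. g m \<noteq> 0 \<Longrightarrow> \<bar>m\<bar> \<le> N" "0 \<le> N"
      unfolding N_def by (auto intro!: Max_ge)
    have "(\<lambda>m. g (m - N)) \<in> I" by (rule twisted_moduleD(3)[OF I g])
    moreover have "(\<lambda>m. g (m - N)) \<in> supported_below (nat (2 * N + 1))"
      using N by (fastforce simp: supported_below_def)
    ultimately have "(\<lambda>m. g (m - N)) \<in> J" using J(2) by blast
    from twisted_moduleD(3)[OF J(1) this, of "- N"] show "g \<in> J" by simp
  qed
  \<comment> \<open>Pairs, so that one minimum is taken over all top indices at once.\<close>
  define P where "P x \<longleftrightarrow> (case x of (d, g) \<Rightarrow> g \<in> I \<inter> supported_below (Suc d) \<and> g (int d) \<noteq> 0)" for x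
  show ?thesis
  proof (cases "\<exists>x. P x")
    case True
    then obtain x where x: "P x"
      "\<And>y. P y \<Longrightarrow> degree (snd x (int (fst x))) \<le> degree (snd y (int (fst y)))"
      using ex_has_least_nat[of P _ "\<lambda>x. degree (snd x (int (fst x)))"] by blast
    obtain e b where xe: "x = (e, b)" by (cases x)
    have b: "b \<in> I" "b \<in> supported_below (Suc e)" "b (int e) \<noteq> 0"
      using x(1) by (auto simp: P_def xe)
    have minimal: "degree (b (int e)) \<le> degree (g (int d))"
      if "g \<in> I \<inter> supported_below (Suc d)" "g (int d) \<noteq> 0" for d g
      using x(2)[of "(d, g)"] that by (simp add: P_def xe)
    obtain A where A: "finite A" "A \<subseteq> I"
      "\<And>J. twisted_module s J \<Longrightarrow> A \<subseteq> J \<Longrightarrow> I \<inter> supported_below e \<subseteq> J"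
      using twisted_module_bounded_fg[OF I, of e] by blast
    have "I \<subseteq> J" if J: "twisted_module s J" "insert b A \<subseteq> J" for J
    proof (rule all[OF J(1)])
      fix d
      show "I \<inter> supported_below d \<subseteq> J"
      proof (induction d)
        case 0
        have "I \<inter> supported_below 0 \<subseteq> {\<lambda>m. 0}" using supported_below_0 by blast
        then show ?case using twisted_moduleD(1)[OF J(1)] by blast
      next
        case (Suc d)
        show ?case
        proof (cases "d < e")
          case True
          then have "supported_below (Suc d) \<subseteq> (supported_below e :: (int \<Rightarrow> 'a poly) set)"
            by (auto simp: supported_below_def intro: order.strict_trans2)
          then show ?thesis using A(3)[OF J(1)] J(2) by auto
        next
          case False
          \<comment> \<open>The copy of b with its top coefficient moved from index e to index
            d.\<close>
          define c where "c = (\<lambda>m. b (m - int (d - e)))"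
          have c: "c \<in> I" "c \<in> J" "c (int d) = b (int e)"
            using b J twisted_moduleD(3)[OF I] twisted_moduleD(3)[OF J(1)] False
            by (auto simp: c_def of_nat_diff)
          have supp: "c \<in> supported_below (Suc d)"
            using b(2) False by (fastforce simp: supported_below_def c_def of_nat_diff)
          show ?thesis
          proof
            fix g assume "g \<in> I \<inter> supported_below (Suc d)"
            then show "g \<in> J"
              by (rule twisted_reduce[OF I, of _ d c])
                 (use c supp J Suc b(3) minimal in auto)
          qed
        qed
      qed
    qed
    then show ?thesis using A b(1) by (intro exI[of _ "insert b A"]) auto
  next
    case False
    have "I \<inter> supported_below d \<subseteq> {\<lambda>m. 0}" for d
    proof (induction d)
      case (Suc d)
      have "g \<in> supported_below d" if "g \<in> I \<inter> supported_below (Suc d)" for g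
        using False that supported_below_Suc[of g d] by (auto simp: P_def)
      then show ?case using Suc by blast
    qed (auto dest: supported_below_0)
    then have "I \<subseteq> J" if "twisted_module s J" for J
      using all[OF that] twisted_moduleD(1)[OF that] by blast
    then show ?thesis by (intro exI[of _ "{}"]) auto
  qed
qed

subsection \<open>Noetherianity of \<open>N(u, B)\<close>\<close>

context canonical
begin

lemma Psi_single_mult:
  "lmonom (to_fract p * \<gamma> d) (d * t) \<otimes>\<^bsub>BB\<^esub> Psi h = Psi (\<lambda>k. p * pshift (d * t) (h (k - d)))"
proof (rule Psi_eqI)
  fix m
  have "Psi h (m * t - d * t) = to_fract (h (m - d)) * \<gamma> (m - d)"
    using Psi_at[of h "m - d"] by (simp only: left_diff_distrib)
  then show "(lmonom (to_fract p * \<gamma> d) (d * t) \<otimes>\<^bsub>BB\<^esub> Psi h) (m * t) =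
      to_fract (p * pshift (d * t) (h (m - d))) * \<gamma> m"
    using \<gamma>_add[of d "m - d"] by (simp add: lmonom_mult_left)
next
  fix i assume "\<not> t dvd i"
  then have "\<not> t dvd i - d * t" by (metis diff_add_cancel dvd_add dvd_triv_right)
  then show "(lmonom (to_fract p * \<gamma> d) (d * t) \<otimes>\<^bsub>BB\<^esub> Psi h) i = 0"
    by (simp add: lmonom_mult_left Psi_def)
qed

lemma Psi_mult_single:
  assumes "g \<in> PF"
  shows "Psi g \<otimes>\<^bsub>BB\<^esub> lmonom (to_fract p * \<gamma> d) (d * t) =
    Psi (\<lambda>k. g (k - d) * pshift ((k - d) * t) p)"
proof (rule Psi_eqI)
  fix m
  have *: "m * t - d * t = (m - d) * t" by (simp only: left_diff_distrib)
  show "(Psi g \<otimes>\<^bsub>BB\<^esub> lmonom (to_fract p * \<gamma> d) (d * t)) (m * t) =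
      to_fract (g (m - d) * pshift ((m - d) * t) p) * \<gamma> m"
    using \<gamma>_add[of "m - d" d] assms by (simp add: mult_lmonom_right *)
next
  fix i assume "\<not> t dvd i"
  then have "\<not> t dvd i - d * t" by (metis diff_add_cancel dvd_add dvd_triv_right)
  then show "(Psi g \<otimes>\<^bsub>BB\<^esub> lmonom (to_fract p * \<gamma> d) (d * t)) i = 0"
    using assms by (simp add: mult_lmonom_right) (simp add: Psi_def)
qed

lemma single_mem_Nalg: "lmonom (to_fract p * \<gamma> d) (d * t) \<in> Nalg BB u"
  unfolding Nalg_eq Psi_single[symmetric] by simp

text \<open>Shared by left and right ideals: \<open>Q\<close> is the kind of ideal, and
  \<open>F\<close> a way of writing elements of N(u, B) as families under which ideals become
  twisted modules. One inclusion is immediate because \<open>I\<close> is itself a member of the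
  intersected collection.\<close>

lemma ideals_fg:
  assumes sub: "\<And>J. Q J \<Longrightarrow> J \<subseteq> Nalg BB u"
    and surj: "Nalg BB u = F ` PF"
    and module: "\<And>J. Q J \<Longrightarrow> twisted_module s {g \<in> PF. F g \<in> J}"
    and I: "Q I"
  shows "\<exists>A. finite A \<and> A \<subseteq> Nalg BB u \<and> I = \<Inter> {J. Q J \<and> A \<subseteq> J}"
proof -
  obtain A where A: "finite A" "A \<subseteq> {g \<in> PF. F g \<in> I}"
    "\<And>J. twisted_module s J \<Longrightarrow> A \<subseteq> J \<Longrightarrow> {g \<in> PF. F g \<in> I} \<subseteq> J"
    using twisted_module_fg[OF module[OF I]] by (auto simp: PF_def)
  have "I \<subseteq> J" if J: "Q J" "F ` A \<subseteq> J" for J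
  proof
    fix x assume x: "x \<in> I"
    then obtain g where g: "x = F g" "g \<in> PF" using sub[OF I] surj by auto
    have "{g \<in> PF. F g \<in> I} \<subseteq> {g \<in> PF. F g \<in> J}"
      using A(2) J by (intro A(3) module) auto
    then show "x \<in> J" using x g by auto
  qed
  then have "I = \<Inter> {J. Q J \<and> F ` A \<subseteq> J}" using I A(2) by auto
  then show ?thesis using A(1,2) surj by (intro exI[of _ "F ` A"]) auto
qed

lemma additive_subgroupD:
  assumes "additive_subgroup J (BB\<lparr>carrier := Nalg BB u\<rparr>)"
  shows "J \<subseteq> Nalg BB u" "\<zero>\<^bsub>BB\<^esub> \<in> J" "x \<in> J \<Longrightarrow> y \<in> J \<Longrightarrow> x \<oplus>\<^bsub>BB\<^esub> y \<in> J"
  using additive_subgroup.a_subset[OF assms] additive_subgroup.zero_closed[OF assms]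
    additive_subgroup.a_closed[OF assms] by auto

lemma noetherian_Nalg: "lr_noetherian (BB\<lparr>carrier := Nalg BB u\<rparr>)"
  unfolding lr_noetherian_def
proof (intro conjI allI impI)
  let ?N = "BB\<lparr>carrier := Nalg BB u\<rparr>"
  show "ring ?N" by (rule BB.subring_is_ring[OF subring_Nalg])
  {
    fix I assume I: "left_ideal I ?N"
    \<comment> \<open>Because \<open>pshift (m * t) p\<close> v^m = v^m p, left multiplication by
      v^d only moves the indices of \<open>g\<close>.\<close>
    define F where "F g = Psi (\<lambda>m. pshift (m * t) (g m))" for g
    have PF_pshift: "(\<lambda>m. pshift (i m) (g m)) \<in> PF \<longleftrightarrow> g \<in> PF" for i g by (simp add: PF_def)
    have Psi_F: "Psi g = F (\<lambda>m. pshift (- (m * t)) (g m))" for g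
      by (simp add: F_def pshift_pshift)
    have "Psi g \<in> F ` PF" if "g \<in> PF" for g
      unfolding Psi_F using that by (intro imageI) (simp add: PF_pshift)
    moreover have "F g \<in> Psi ` PF" if "g \<in> PF" for g
      using that unfolding F_def by (intro imageI) (simp add: PF_pshift)
    ultimately have surj: "Nalg BB u = F ` PF"
      unfolding Nalg_eq by blast
    have module: "twisted_module (- t) {g \<in> PF. F g \<in> J}" if "left_ideal J ?N" for J
    proof -
      have J: "additive_subgroup J ?N" "\<And>r x. r \<in> Nalg BB u \<Longrightarrow> x \<in> J \<Longrightarrow> r \<otimes>\<^bsub>BB\<^esub> x \<in> J"
        using that by (auto simp: left_ideal_def)
      have 1: "F (\<lambda>m. 0) \<in> J"
        using additive_subgroupD(2)[OF J(1)] by (simp add: F_def Psi_zero)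
      have 2: "F (\<lambda>m. g m + h m) \<in> J" if "F g \<in> J" "F h \<in> J" for g h
        using additive_subgroupD(3)[OF J(1) that] by (simp add: F_def Psi_add pshift_add)
      have 3: "F (\<lambda>m. g (m - d)) \<in> J" if "F g \<in> J" for g d
        using J(2)[OF single_mem_Nalg[of 1 d] that]
        by (simp only: F_def Psi_single_mult) (simp add: pshift_pshift left_diff_distrib)
      have 4: "F (\<lambda>m. pshift (m * - t) p * g m) \<in> J" if "F g \<in> J" for g p
        using J(2)[OF single_mem_Nalg[of p 0] that]
        by (simp only: F_def Psi_single_mult) (simp add: pshift_mult pshift_pshift)
      have 5: "(\<lambda>m. g (m - d)) \<in> PF" "(\<lambda>m. pshift (m * - t) p * g m) \<in> PF" if "g \<in> PF" for g d p
      proof -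
        have "{m. g (m - d) \<noteq> 0} = (\<lambda>m. m + d) ` {m. g m \<noteq> 0}"
          by (auto intro: image_eqI[of _ _ "m - d" for m])
        then show "(\<lambda>m. g (m - d)) \<in> PF" using that by (simp add: PF_def)
        show "(\<lambda>m. pshift (m * - t) p * g m) \<in> PF"
          using that unfolding PF_def by (auto elim: finite_subset[rotated])
      qed
      show ?thesis
        unfolding twisted_module_def using 1 2 3 4 5 PF_add by auto
    qed
    show "\<exists>A. finite A \<and> A \<subseteq> carrier ?N \<and> I = \<Inter> {J. left_ideal J ?N \<and> A \<subseteq> J}"
      using ideals_fg[where Q = "\<lambda>J. left_ideal J ?N", OF _ surj module I] additive_subgroupD(1)
      by (simp add: left_ideal_def)
  }
  {
    fix I assume I: "right_ideal I ?N"
    \<comment> \<open>With coefficients on the left, right multiplication by p multiplies g m by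
      \<open>pshift (m * t) p\<close>, so the twist is \<open>t\<close> itself.\<close>
    have module: "twisted_module t {g \<in> PF. Psi g \<in> J}" if "right_ideal J ?N" for J
    proof -
      have J: "additive_subgroup J ?N" "\<And>r x. r \<in> Nalg BB u \<Longrightarrow> x \<in> J \<Longrightarrow> x \<otimes>\<^bsub>BB\<^esub> r \<in> J"
        using that by (auto simp: right_ideal_def)
      have 1: "Psi (\<lambda>m. 0) \<in> J"
        using additive_subgroupD(2)[OF J(1)] by (simp add: Psi_zero)
      have 2: "Psi (\<lambda>m. g m + h m) \<in> J" if "Psi g \<in> J" "Psi h \<in> J" for g h
        using additive_subgroupD(3)[OF J(1) that] by (simp add: Psi_add)
      have sub: "J \<subseteq> carrier BB"
        using additive_subgroupD(1)[OF J(1)] subringE(1)[OF subring_Nalg] by blast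
      have 3: "(\<lambda>m. g (m - d)) \<in> PF \<and> Psi (\<lambda>m. g (m - d)) \<in> J" if "g \<in> PF" "Psi g \<in> J" for g d
        using J(2)[OF single_mem_Nalg[of 1 d] that(2)] sub
        by (simp add: Psi_mult_single[OF that(1)] del: to_fract_1) (auto simp flip: Psi_closed_iff)
      have 4: "(\<lambda>m. pshift (m * t) p * g m) \<in> PF \<and> Psi (\<lambda>m. pshift (m * t) p * g m) \<in> J"
        if "g \<in> PF" "Psi g \<in> J" for g p
        using J(2)[OF single_mem_Nalg[of p 0] that(2)] sub unfolding Psi_mult_single[OF that(1)]
        by (auto simp: mult.commute simp flip: Psi_closed_iff)
      show ?thesis
        unfolding twisted_module_def using 1 2 3 4 PF_add by auto
    qed
    show "\<exists>A. finite A \<and> A \<subseteq> carrier ?N \<and> I = \<Inter> {J. right_ideal J ?N \<and> A \<subseteq> J}"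
      using ideals_fg[where Q = "\<lambda>J. right_ideal J ?N", OF _ Nalg_eq module I] additive_subgroupD(1)
      by (simp add: right_ideal_def)
  }
qed

end

subsection \<open>Finite generation of polynomial rings and of images\<close>

lemma generate_ring_image:
  assumes "ring_hom_ring R S h" and M: "M \<subseteq> carrier R" and a: "a \<in> generate_ring R M"
  shows "h a \<in> generate_ring S (h ` M)"
proof -
  interpret h: ring_hom_ring R S h by (rule assms(1))
  note closed = h.R.generate_ring_in_carrier[OF M]
  show ?thesis using a
  proof induction
    case one
    show ?case by (simp add: generate_ring.one)
  next
    case (incl x)
    then show ?case by (intro generate_ring.incl) simp
  next
    case (a_inv x)
    then show ?case using closed by (simp add: generate_ring.a_inv)
  next
    case (eng_add x y)
    then show ?case using closed by (simp add: generate_ring.eng_add)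
  next
    case (eng_mult x y)
    then show ?case using closed by (simp add: generate_ring.eng_mult)
  qed
qed

lemma affine_algebra_iso:
  assumes aff: "affine_algebra \<iota> R" and S: "ring S" and h: "h \<in> ring_iso R S"
  shows "affine_algebra (\<lambda>c. h (\<iota> c)) S"
proof -
  obtain M where M: "finite M" "M \<subseteq> carrier R" "generate_ring R (range \<iota> \<union> M) = carrier R"
    and alg: "is_algebra \<iota> R"
    using aff unfolding affine_algebra_def algebra_generated_def by blast
  have R: "ring R" and \<iota>: "\<iota> \<in> ring_hom ring_of_type_algebra R"
    and comm: "\<And>c x. x \<in> carrier R \<Longrightarrow> \<iota> c \<otimes>\<^bsub>R\<^esub> x = x \<otimes>\<^bsub>R\<^esub> \<iota> c"
    using alg unfolding is_algebra_def by auto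
  interpret R: ring R by (rule R)
  interpret S: ring S by (rule S)
  have hom: "h \<in> ring_hom R S" and img: "h ` carrier R = carrier S"
    using h by (auto simp: ring_iso_def bij_betw_def)
  have hom_ring: "ring_hom_ring R S h" by (rule ring_hom_ringI2[OF R S hom])
  have \<iota>_closed: "\<iota> c \<in> carrier R" for c
    using ring_hom_closed[OF \<iota>, of c] by (simp add: ring_of_type_algebra_def)
  have "(\<lambda>c. h (\<iota> c)) \<in> ring_hom ring_of_type_algebra S"
    using ring_hom_trans[OF \<iota> hom] by (simp add: comp_def)
  moreover have "h (\<iota> c) \<otimes>\<^bsub>S\<^esub> y = y \<otimes>\<^bsub>S\<^esub> h (\<iota> c)" if "y \<in> carrier S" for c y
  proof -
    have "y \<in> h ` carrier R" using that img by simp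
    then obtain x where x: "x \<in> carrier R" "y = h x" by blast
    have "h (\<iota> c \<otimes>\<^bsub>R\<^esub> x) = h (x \<otimes>\<^bsub>R\<^esub> \<iota> c)" using comm[OF x(1), of c] by simp
    then show ?thesis
      unfolding x(2) ring_hom_mult[OF hom \<iota>_closed x(1)] ring_hom_mult[OF hom x(1) \<iota>_closed] .
  qed
  ultimately have alg': "is_algebra (\<lambda>c. h (\<iota> c)) S" unfolding is_algebra_def using S by blast
  have sub: "range \<iota> \<union> M \<subseteq> carrier R" using M(2) \<iota>_closed by auto
  have "carrier S \<subseteq> generate_ring S (range (\<lambda>c. h (\<iota> c)) \<union> h ` M)"
  proof
    fix y assume "y \<in> carrier S"
    then have "y \<in> h ` generate_ring R (range \<iota> \<union> M)" using img M(3) by simp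
    then obtain x where "x \<in> generate_ring R (range \<iota> \<union> M)" "y = h x" by blast
    then show "y \<in> generate_ring S (range (\<lambda>c. h (\<iota> c)) \<union> h ` M)"
      using generate_ring_image[OF hom_ring sub] by (simp add: image_Un image_image)
  qed
  moreover have "range (\<lambda>c. h (\<iota> c)) \<union> h ` M \<subseteq> carrier S"
    using \<iota>_closed M(2) ring_hom_closed[OF hom] by blast
  then have "generate_ring S (range (\<lambda>c. h (\<iota> c)) \<union> h ` M) \<subseteq> carrier S"
    by (rule S.generate_ring_incl)
  ultimately show ?thesis
    unfolding affine_algebra_def algebra_generated_def
    using alg' M(1,2) ring_hom_closed[OF hom] by (intro conjI exI[of _ "h ` M"]) auto
qed

text \<open>The generators are those of R, taken as constants, and the indeterminate.\<close>

lemma affine_algebra_UP: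
  assumes aff: "affine_algebra \<iota> R" and R: "cring R"
  shows "affine_algebra (\<lambda>c. up_ring.monom (UP R) (\<iota> c) 0) (UP R)"
proof -
  obtain M where M: "finite M" "M \<subseteq> carrier R" "generate_ring R (range \<iota> \<union> M) = carrier R"
    and alg: "is_algebra \<iota> R"
    using aff unfolding affine_algebra_def algebra_generated_def by blast
  have \<iota>: "\<iota> \<in> ring_hom ring_of_type_algebra R" using alg unfolding is_algebra_def by auto
  interpret UP_cring R "UP R" by (intro UP_cring.intro R) 
  have \<iota>_closed: "\<iota> c \<in> carrier R" for c
    using ring_hom_closed[OF \<iota>, of c] by (simp add: ring_of_type_algebra_def)
  let ?m = "\<lambda>a. up_ring.monom (UP R) a 0"
  let ?T = "insert (up_ring.monom (UP R) \<one>\<^bsub>R\<^esub> 1) (?m ` M)"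
  have hom: "ring_hom_ring R (UP R) ?m"
    by (intro ring_hom_ringI2 R.ring_axioms UP_ring const_ring_hom)
  have alg': "is_algebra (\<lambda>c. ?m (\<iota> c)) (UP R)"
    unfolding is_algebra_def
    using ring_hom_trans[OF \<iota> const_ring_hom] UP_ring UP_m_comm \<iota>_closed
    by (simp add: comp_def)
  have sub: "range (\<lambda>c. ?m (\<iota> c)) \<union> ?T \<subseteq> carrier (UP R)" using \<iota>_closed M(2) by auto
  let ?G = "generate_ring (UP R) (range (\<lambda>c. ?m (\<iota> c)) \<union> ?T)"
  have G: "subring ?G (UP R)" by (rule P.generate_ring_is_subring[OF sub])
  have "range \<iota> \<union> M \<subseteq> carrier R" using M(2) \<iota>_closed by auto
  from generate_ring_image[OF hom this]
  have "?m a \<in> generate_ring (UP R) (?m ` (range \<iota> \<union> M))" if "a \<in> carrier R" for a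
    using that M(3) by blast
  moreover have "generate_ring (UP R) (?m ` (range \<iota> \<union> M)) \<subseteq> ?G"
    by (rule P.mono_generate_ring) (use sub in \<open>auto\<close>)
  ultimately have const: "?m a \<in> ?G" if "a \<in> carrier R" for a using that by blast
  have indet_pow: "up_ring.monom (UP R) \<one>\<^bsub>R\<^esub> i \<in> ?G" for i
  proof (induction i)
    case 0
    show ?case using subringE(3)[OF G] by (simp add: monom_one)
  next
    case (Suc i)
    have "up_ring.monom (UP R) \<one>\<^bsub>R\<^esub> 1 \<in> ?G" by (rule generate_ring.incl) simp
    then have "up_ring.monom (UP R) \<one>\<^bsub>R\<^esub> i \<otimes>\<^bsub>UP R\<^esub> up_ring.monom (UP R) \<one>\<^bsub>R\<^esub> 1 \<in> ?G"
      using Suc subringE(6)[OF G] by blast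
    then show ?case by (simp only: monom_one_Suc)
  qed
  have monom: "up_ring.monom (UP R) a i \<in> ?G" if "a \<in> carrier R" for a i
    using subringE(6)[OF G const[OF that] indet_pow[of i]] monom_mult[OF that R.one_closed, of 0 i] that
    by (simp del: monom_mult)
  have "carrier (UP R) \<subseteq> ?G"
  proof
    fix p assume p: "p \<in> carrier (UP R)"
    have "finsum (UP R) (\<lambda>i. up_ring.monom (UP R) (up_ring.coeff (UP R) p i) i) A \<in> ?G"
      if "finite A" for A
      using that
    proof (induction A rule: finite_induct)
      case empty
      then show ?case using subringE(2)[OF G] by simp
    next
      case (insert i A)
      then show ?case using p monom[of "up_ring.coeff (UP R) p i" i] subringE(7)[OF G]
        by (subst P.finsum_insert) auto
    qed
    from this[of "{..deg R p}"] show "p \<in> ?G" using up_repr[OF p] by simp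
  qed
  moreover have "?G \<subseteq> carrier (UP R)" by (rule P.generate_ring_incl[OF sub])
  ultimately show ?thesis
    unfolding affine_algebra_def algebra_generated_def
    using alg' M(1) sub by (intro conjI exI[of _ ?T]) auto
qed

subsection \<open>The associated graded algebra\<close>

context canonical
begin

section \<open>Multiplicativity of the filtration\<close>

lemma Nfilt_neg: "i < 0 \<Longrightarrow> Nfilt BB u i = {\<zero>\<^bsub>BB\<^esub>}"
  by (simp add: Nfilt_def)

lemma Nfilt_zero_mem: "\<zero>\<^bsub>BB\<^esub> \<in> Nfilt BB u i"
  and Nfilt_closed: "f \<in> Nfilt BB u i \<Longrightarrow> f \<in> carrier BB"
  and Nfilt_add: "f \<in> Nfilt BB u i \<Longrightarrow> g \<in> Nfilt BB u i \<Longrightarrow> f \<oplus>\<^bsub>BB\<^esub> g \<in> Nfilt BB u i"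
  and Nfilt_uminus: "f \<in> Nfilt BB u i \<Longrightarrow> \<ominus>\<^bsub>BB\<^esub> f \<in> Nfilt BB u i"
proof -
  consider "i < 0" | j where "i = int j" by (metis not_le nonneg_int_cases)
  then have "\<zero>\<^bsub>BB\<^esub> \<in> Nfilt BB u i \<and> (f \<in> Nfilt BB u i \<longrightarrow> f \<in> carrier BB) \<and>
    (f \<in> Nfilt BB u i \<longrightarrow> g \<in> Nfilt BB u i \<longrightarrow> f \<oplus>\<^bsub>BB\<^esub> g \<in> Nfilt BB u i) \<and>
    (f \<in> Nfilt BB u i \<longrightarrow> \<ominus>\<^bsub>BB\<^esub> f \<in> Nfilt BB u i)"
  proof cases
    case 1
    then show ?thesis by (auto simp: Nfilt_neg)
  next
    case 2
    have "\<zero>\<^bsub>BB\<^esub> \<in> Psi ` PFdeg j" using PFdeg_zero unfolding Psi_zero by (rule imageI)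
    moreover have "\<ominus>\<^bsub>BB\<^esub> Psi a \<in> Psi ` PFdeg j" if "a \<in> PFdeg j" for a
      using that by (simp add: Psi_uminus[OF PFdeg_PF[OF that]] PFdeg_uminus)
    moreover have "Psi a \<oplus>\<^bsub>BB\<^esub> Psi b \<in> Psi ` PFdeg j" if "a \<in> PFdeg j" "b \<in> PFdeg j" for a b
      using that by (simp add: Psi_add PFdeg_add)
    ultimately show ?thesis unfolding 2 Nfilt_eq by (blast dest: PFdeg_PF Psi_closed)
  qed
  then show "\<zero>\<^bsub>BB\<^esub> \<in> Nfilt BB u i" "f \<in> Nfilt BB u i \<Longrightarrow> f \<in> carrier BB"
    "f \<in> Nfilt BB u i \<Longrightarrow> g \<in> Nfilt BB u i \<Longrightarrow> f \<oplus>\<^bsub>BB\<^esub> g \<in> Nfilt BB u i"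
    "f \<in> Nfilt BB u i \<Longrightarrow> \<ominus>\<^bsub>BB\<^esub> f \<in> Nfilt BB u i" by blast+
qed

lemma Nfilt_minus: "f \<in> Nfilt BB u i \<Longrightarrow> g \<in> Nfilt BB u i \<Longrightarrow> f \<ominus>\<^bsub>BB\<^esub> g \<in> Nfilt BB u i"
  by (simp add: a_minus_def Nfilt_add Nfilt_uminus)

lemma Nfilt_mono:
  assumes "i \<le> j" shows "Nfilt BB u i \<subseteq> Nfilt BB u j"
proof (cases "i < 0")
  case True
  then show ?thesis using Nfilt_zero_mem by (simp add: Nfilt_neg)
next
  case False
  then obtain i' j' where "i = int i'" "j = int j'" using assms
    by (metis not_le nonneg_int_cases order_trans)
  then show ?thesis using assms by (simp add: Nfilt_eq image_mono PFdeg_mono)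
qed

text \<open>Negative indices are included because the error terms in \<open>rcoset_mult_cls\<close>
  have index \<open>int i - 1\<close>, which is -1 for i = 0; the product is then 0.\<close>

lemma Nfilt_mult:
  assumes f: "f \<in> Nfilt BB u i" and g: "g \<in> Nfilt BB u j"
  shows "f \<otimes>\<^bsub>BB\<^esub> g \<in> Nfilt BB u (i + j)"
proof (cases "i < 0 \<or> j < 0")
  case True
  then have "f \<otimes>\<^bsub>BB\<^esub> g = \<zero>\<^bsub>BB\<^esub>" using f g Nfilt_closed[OF f] Nfilt_closed[OF g]
    by (auto simp: Nfilt_neg)
  then show ?thesis using Nfilt_zero_mem by simp
next
  case False
  then obtain i' j' where ij: "i = int i'" "j = int j'" by (metis not_le nonneg_int_cases)
  obtain a b where "f = Psi a" "a \<in> PFdeg i'" "g = Psi b" "b \<in> PFdeg j'"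
    using f g unfolding ij Nfilt_eq by blast
  then have "f \<otimes>\<^bsub>BB\<^esub> g \<in> Psi ` PFdeg (i' + j')"
    using PFdeg_pmul by (simp add: Psi_mult PFdeg_PF)
  then show ?thesis by (simp add: ij flip: Nfilt_eq of_nat_add)
qed

lemma additive_subgroup_Nfilt: "additive_subgroup (Nfilt BB u i) BB"
  by (rule additive_subgroup.intro, rule BB.add.subgroupI)
     (auto simp: Nfilt_closed Nfilt_add Nfilt_uminus intro: Nfilt_zero_mem
       simp flip: a_inv_def)

lemma abelian_subgroup_Nfilt: "abelian_subgroup (Nfilt BB u i) BB"
  by (rule abelian_subgroupI3[OF additive_subgroup_Nfilt BB.abelian_group_axioms])

section \<open>Arithmetic of cosets in the graded pieces\<close>

definition cls :: "nat \<Rightarrow> (int \<Rightarrow> 'k poly fract) \<Rightarrow> (int \<Rightarrow> 'k poly fract) set" where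
  "cls k a = Nfilt BB u (int k - 1) +>\<^bsub>BB\<^esub> a"

lemma cls_eq_iff:
  assumes "a \<in> carrier BB" "b \<in> carrier BB"
  shows "cls k a = cls k b \<longleftrightarrow> a \<ominus>\<^bsub>BB\<^esub> b \<in> Nfilt BB u (int k - 1)"
proof -
  interpret abelian_subgroup "Nfilt BB u (int k - 1)" BB by (rule abelian_subgroup_Nfilt)
  show ?thesis
    unfolding cls_def
    using assms a_rcos_self[of a] a_rcos_module_minus[OF BB.ring_axioms, of b a]
      a_repr_independence'[of a b] by auto
qed

lemma cls_mem:
  assumes "a \<in> carrier BB" shows "x \<in> cls k a \<longleftrightarrow> x \<in> carrier BB \<and> x \<ominus>\<^bsub>BB\<^esub> a \<in> Nfilt BB u (int k - 1)"
proof -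
  interpret abelian_subgroup "Nfilt BB u (int k - 1)" BB by (rule abelian_subgroup_Nfilt)
  show ?thesis
    unfolding cls_def
    using assms a_rcos_module_minus[OF BB.ring_axioms, of a x] a_elemrcos_carrier by blast
qed

lemma cls_zero: "cls k \<zero>\<^bsub>BB\<^esub> = Nfilt BB u (int k - 1)"
  by (auto simp: cls_mem Nfilt_closed a_minus_def)

lemma cls_add:
  "a \<in> carrier BB \<Longrightarrow> b \<in> carrier BB \<Longrightarrow> cls k a <+>\<^bsub>BB\<^esub> cls k b = cls k (a \<oplus>\<^bsub>BB\<^esub> b)"
  unfolding cls_def by (rule abelian_subgroup.a_rcos_sum[OF abelian_subgroup_Nfilt])

lemma abelian_group_Nfilt: "abelian_group (BB\<lparr>carrier := Nfilt BB u i\<rparr>)"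
proof (rule abelian_groupI)
  fix x assume "x \<in> carrier (BB\<lparr>carrier := Nfilt BB u i\<rparr>)"
  then have x: "x \<in> Nfilt BB u i" by simp
  show "\<exists>y\<in>carrier (BB\<lparr>carrier := Nfilt BB u i\<rparr>).
      y \<oplus>\<^bsub>BB\<lparr>carrier := Nfilt BB u i\<rparr>\<^esub> x = \<zero>\<^bsub>BB\<lparr>carrier := Nfilt BB u i\<rparr>\<^esub>"
    using Nfilt_uminus[OF x] BB.l_neg[OF Nfilt_closed[OF x]] by auto
qed (simp_all add: Nfilt_closed Nfilt_add Nfilt_zero_mem BB.a_ac)

lemma comm_group_gr_piece: "comm_group (gr_piece BB (Nfilt BB u) k)"
proof -
  have "subgroup (Nfilt BB u (int k - 1)) (add_monoid (BB\<lparr>carrier := Nfilt BB u (int k)\<rparr>))"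
  proof (rule group.group_incl_imp_subgroup)
    show "Group.group (add_monoid (BB\<lparr>carrier := Nfilt BB u (int k)\<rparr>))"
      by (rule abelian_group.a_group[OF abelian_group_Nfilt])
    show "Nfilt BB u (int k - 1) \<subseteq> carrier (add_monoid (BB\<lparr>carrier := Nfilt BB u (int k)\<rparr>))"
      using Nfilt_mono[of "int k - 1" "int k"] by simp
    show "Group.group (add_monoid (BB\<lparr>carrier := Nfilt BB u (int k)\<rparr>)\<lparr>carrier := Nfilt BB u (int k - 1)\<rparr>)"
      using abelian_group.a_group[OF abelian_group_Nfilt, of "int k - 1"] by simp
  qed
  then have "abelian_subgroup (Nfilt BB u (int k - 1)) (BB\<lparr>carrier := Nfilt BB u (int k)\<rparr>)"
    by (intro abelian_subgroupI3 additive_subgroup.intro abelian_group_Nfilt)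
  then show ?thesis
    unfolding gr_piece_def by (rule abelian_subgroup.a_factorgroup_is_comm_group)
qed

lemma carrier_gr_piece: "carrier (gr_piece BB (Nfilt BB u) k) = cls k ` Nfilt BB u (int k)"
  by (auto simp: gr_piece_def A_FactGroup_def FactGroup_def RCOSETS_def cls_def a_r_coset_def r_coset_def)

lemma mult_gr_piece: "monoid.mult (gr_piece BB (Nfilt BB u) k) = (<+>\<^bsub>BB\<^esub>)"
  by (simp add: gr_piece_def A_FactGroup_def FactGroup_def set_add_def set_mult_def fun_eq_iff)

lemma one_gr_piece: "\<one>\<^bsub>gr_piece BB (Nfilt BB u) k\<^esub> = Nfilt BB u (int k - 1)"
  by (simp add: gr_piece_def A_FactGroup_def FactGroup_def)

lemma finprod_gr_piece:
  assumes "finite A" "\<And>i. i \<in> A \<Longrightarrow> x i \<in> Nfilt BB u (int k)"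
  shows "finprod (gr_piece BB (Nfilt BB u) k) (\<lambda>i. cls k (x i)) A = cls k (finsum BB x A)"
proof -
  interpret comm_group "gr_piece BB (Nfilt BB u) k" by (rule comm_group_gr_piece)
  show ?thesis using assms
  proof (induction A rule: finite_induct)
    case empty
    then show ?case by (simp add: one_gr_piece cls_zero)
  next
    case (insert i A)
    have "(\<lambda>i. cls k (x i)) \<in> A \<rightarrow> carrier (gr_piece BB (Nfilt BB u) k)"
      "cls k (x i) \<in> carrier (gr_piece BB (Nfilt BB u) k)"
      using insert.prems by (auto simp: carrier_gr_piece)
    moreover have "x \<in> A \<rightarrow> carrier BB" "x i \<in> carrier BB"
      using insert.prems Nfilt_closed by auto
    ultimately show ?case
      using insert by (simp add: mult_gr_piece cls_add)
  qed
qed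

text \<open>\<open>rcoset_mult\<close> is a union over all representatives, so their products must
  all lie in one coset: a' b' - a b = (a' - a) b' + a (b' - b), and both summands lie one step
  lower.\<close>

lemma rcoset_mult_cls:
  assumes a: "a \<in> Nfilt BB u (int i)" and b: "b \<in> Nfilt BB u (int j)"
  shows "rcoset_mult BB (Nfilt BB u (int (i + j) - 1)) (cls i a) (cls j b) = cls (i + j) (a \<otimes>\<^bsub>BB\<^esub> b)"
proof -
  note ab = Nfilt_closed[OF a] Nfilt_closed[OF b]
  have eq: "cls (i + j) (a' \<otimes>\<^bsub>BB\<^esub> b') = cls (i + j) (a \<otimes>\<^bsub>BB\<^esub> b)"
    if a': "a' \<in> cls i a" and b': "b' \<in> cls j b" for a' b'
  proof -
    have a'': "a' \<in> carrier BB" "a' \<ominus>\<^bsub>BB\<^esub> a \<in> Nfilt BB u (int i - 1)" using a' ab by (auto simp: cls_mem)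
    have b'': "b' \<in> carrier BB" "b' \<ominus>\<^bsub>BB\<^esub> b \<in> Nfilt BB u (int j - 1)" using b' ab by (auto simp: cls_mem)
    \<comment> \<open>The first error term contains b' instead of b, so b' has to be placed in the
      filtration as well.\<close>
    have "b' = (b' \<ominus>\<^bsub>BB\<^esub> b) \<oplus>\<^bsub>BB\<^esub> b" using ab b'' by (simp add: a_minus_def BB.a_assoc BB.l_neg)
    then have "b' \<in> Nfilt BB u (int j)"
      using b b''(2) Nfilt_mono[of "int j - 1" "int j"] Nfilt_add[of "b' \<ominus>\<^bsub>BB\<^esub> b" "int j" b] by auto
    then have 1: "(a' \<ominus>\<^bsub>BB\<^esub> a) \<otimes>\<^bsub>BB\<^esub> b' \<in> Nfilt BB u (int (i + j) - 1)"
      using Nfilt_mult[OF a''(2), of b' "int j"] by (simp add: algebra_simps)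
    have 2: "a \<otimes>\<^bsub>BB\<^esub> (b' \<ominus>\<^bsub>BB\<^esub> b) \<in> Nfilt BB u (int (i + j) - 1)"
      using Nfilt_mult[OF a b''(2)] by (simp add: algebra_simps)
    have "a' \<otimes>\<^bsub>BB\<^esub> b' \<ominus>\<^bsub>BB\<^esub> a \<otimes>\<^bsub>BB\<^esub> b = (a' \<ominus>\<^bsub>BB\<^esub> a) \<otimes>\<^bsub>BB\<^esub> b' \<oplus>\<^bsub>BB\<^esub> a \<otimes>\<^bsub>BB\<^esub> (b' \<ominus>\<^bsub>BB\<^esub> b)"
    proof -
      have "(a' \<ominus>\<^bsub>BB\<^esub> a) \<otimes>\<^bsub>BB\<^esub> b' = a' \<otimes>\<^bsub>BB\<^esub> b' \<ominus>\<^bsub>BB\<^esub> a \<otimes>\<^bsub>BB\<^esub> b'"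
        using ab a'' b'' by (simp add: a_minus_def BB.l_distr BB.l_minus)
      moreover have "a \<otimes>\<^bsub>BB\<^esub> (b' \<ominus>\<^bsub>BB\<^esub> b) = a \<otimes>\<^bsub>BB\<^esub> b' \<ominus>\<^bsub>BB\<^esub> a \<otimes>\<^bsub>BB\<^esub> b"
        using ab a'' b'' by (simp add: a_minus_def BB.r_distr BB.r_minus)
      ultimately show ?thesis using ab a'' b''
        by (simp add: minus_BB) (simp add: add_BB)
    qed
    then show ?thesis using 1 2 ab a'' b'' by (simp add: cls_eq_iff Nfilt_add)
  qed
  have ne: "a \<in> cls i a" "b \<in> cls j b"
    using ab Nfilt_zero_mem by (auto simp: cls_mem a_minus_def BB.r_neg)
  have "rcoset_mult BB (Nfilt BB u (int (i + j) - 1)) (cls i a) (cls j b) =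
      (\<Union>a'\<in>cls i a. \<Union>b'\<in>cls j b. cls (i + j) (a' \<otimes>\<^bsub>BB\<^esub> b'))"
    by (simp add: rcoset_mult_def cls_def)
  also have "\<dots> = (\<Union>a'\<in>cls i a. \<Union>b'\<in>cls j b. cls (i + j) (a \<otimes>\<^bsub>BB\<^esub> b))"
    using eq by simp
  also have "\<dots> = cls (i + j) (a \<otimes>\<^bsub>BB\<^esub> b)" using ne by blast
  finally show ?thesis .
qed

section \<open>Leading coefficients with respect to H\<close>

lemma HB_pow_mem: "HB [^]\<^bsub>BB\<^esub> i \<in> Nfilt BB u (int i)"
  using HB_pow_Nfilt by blast

lemma Cent_Nfilt: "c \<in> Cent BB u \<Longrightarrow> c \<in> Nfilt BB u (int 0)"
  by (simp add: Cent_def)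

lemma Cent_closed: "c \<in> Cent BB u \<Longrightarrow> c \<in> carrier BB"
  using subringE(1)[OF subring_Cent] by blast

lemma Cent_HB_pow_mem: "c \<in> Cent BB u \<Longrightarrow> c \<otimes>\<^bsub>BB\<^esub> HB [^]\<^bsub>BB\<^esub> i \<in> Nfilt BB u (int i)"
  using Nfilt_mult[OF Cent_Nfilt HB_pow_mem] by simp

lemma Cent_HB_pow_eq:
  "g \<in> PF \<Longrightarrow> Psi g \<otimes>\<^bsub>BB\<^esub> HB [^]\<^bsub>BB\<^esub> i = Psi (\<lambda>m. g m * pshift (m * t) ([:0, 1:] ^ i))"
  using Psi_mult_single[of g "[:0, 1:] ^ i" 0] by (simp add: HB_pow)

text \<open>Moving H^i past v^m shifts it by m t, so the coefficients of the commutator are constant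
  multiples of \<open>pdelta (m * t)\<close> of H^i, which has degree below i and vanishes for i =
  0. This makes the graded algebra commutative.\<close>

lemma HB_pow_Cent_commute:
  assumes "c \<in> Cent BB u"
  shows "HB [^]\<^bsub>BB\<^esub> i \<otimes>\<^bsub>BB\<^esub> c \<ominus>\<^bsub>BB\<^esub> c \<otimes>\<^bsub>BB\<^esub> HB [^]\<^bsub>BB\<^esub> i \<in> Nfilt BB u (int i - 1)"
proof -
  obtain g where g: "c = Psi g" "g \<in> PFdeg 0" using assms unfolding Cent_eq by blast
  have "HB [^]\<^bsub>BB\<^esub> i \<otimes>\<^bsub>BB\<^esub> c = Psi (\<lambda>m. [:0, 1:] ^ i * g m)"
    using Psi_single_mult[of "[:0, 1:] ^ i" 0 g] by (simp add: HB_pow g)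
  moreover have "c \<otimes>\<^bsub>BB\<^esub> HB [^]\<^bsub>BB\<^esub> i = Psi (\<lambda>m. g m * pshift (m * t) ([:0, 1:] ^ i))"
    using Cent_HB_pow_eq g PFdeg_PF by simp
  moreover define h where "h = (\<lambda>m. - (g m * pdelta (m * t) ([:0, 1:] ^ i)))"
  moreover have hPF: "h \<in> PF"
    using PFdeg_PF[OF g(2)] unfolding PF_def h_def by (auto elim: finite_subset[rotated])
  moreover have "c \<otimes>\<^bsub>BB\<^esub> HB [^]\<^bsub>BB\<^esub> i \<in> carrier BB" using Cent_closed[OF assms] by simp
  ultimately have eq: "HB [^]\<^bsub>BB\<^esub> i \<otimes>\<^bsub>BB\<^esub> c \<ominus>\<^bsub>BB\<^esub> c \<otimes>\<^bsub>BB\<^esub> HB [^]\<^bsub>BB\<^esub> i = Psi h"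
    by (simp add: minus_BB) (auto simp: Psi_def pdelta_def algebra_simps)
  show ?thesis
  proof (cases i)
    case 0
    then have "h = (\<lambda>m. 0)" by (simp add: h_def pdelta_def)
    then show ?thesis unfolding eq using Nfilt_zero_mem by (simp flip: Psi_zero)
  next
    case (Suc j)
    have "degree (h m) \<le> j" for m
    proof -
      obtain e where e: "g m = [:e:]" using g(2) by (auto simp: PFdeg_def elim: degree_eq_zeroE)
      have "degree ([:0, 1 :: 'k:] ^ i) \<le> Suc j" using Suc by (simp add: degree_linear_power)
      then have "degree (pdelta (m * t) ([:0, 1 :: 'k:] ^ i)) \<le> j" by (rule degree_pdelta_le)
      then show ?thesis by (simp add: h_def e degree_smult_leI)
    qed
    then have "Psi h \<in> Nfilt BB u (int j)" using hPF by (auto simp: Nfilt_eq PFdeg_def)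
    then show ?thesis unfolding eq using Suc by simp
  qed
qed

text \<open>A nonzero constant g m leaves a polynomial of degree exactly k at v^m, too large for the
  lower piece. Injectivity of \<open>Phi\<close> rests on this.\<close>

lemma Cent_HB_pow_cancel:
  assumes c: "c \<in> Cent BB u" and mem: "c \<otimes>\<^bsub>BB\<^esub> HB [^]\<^bsub>BB\<^esub> k \<in> Nfilt BB u (int k - 1)"
  shows "c = \<zero>\<^bsub>BB\<^esub>"
proof (cases k)
  case 0
  then show ?thesis using mem Cent_closed[OF c] by (simp add: Nfilt_neg)
next
  case (Suc j)
  obtain g where g: "c = Psi g" "g \<in> PFdeg 0" using c unfolding Cent_eq by blast
  have "int k - 1 = int j" using Suc by simp
  then have "(\<lambda>m. g m * pshift (m * t) ([:0, 1:] ^ k)) \<in> PFdeg j"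
    using mem g by (auto simp: Nfilt_eq Cent_HB_pow_eq[OF PFdeg_PF[OF g(2)]])
  then have deg: "degree (g m * pshift (m * t) ([:0, 1:] ^ k)) \<le> j" for m
    by (simp add: PFdeg_def)
  have "g m = 0" for m
  proof (rule ccontr)
    assume "g m \<noteq> 0"
    then have "degree (g m * pshift (m * t) ([:0, 1:] ^ k)) = k"
      using g(2) by (subst degree_mult_eq) (auto simp: PFdeg_def degree_linear_power)
    then show False using deg[of m] Suc by simp
  qed
  then have "g = (\<lambda>m. 0)" by (rule ext)
  then show ?thesis by (simp add: g Psi_zero)
qed

text \<open>Take the top summand of the expansion in \<open>Nfilt_sum_HB\<close>; the others lie in
  the lower piece. Surjectivity of \<open>Phi\<close> rests on this.\<close>

lemma Nfilt_top_coeff: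
  assumes a: "a \<in> Nfilt BB u (int k)"
  obtains c where "c \<in> Cent BB u" "cls k a = cls k (c \<otimes>\<^bsub>BB\<^esub> HB [^]\<^bsub>BB\<^esub> k)"
proof (cases k)
  case 0
  then show ?thesis using that[of a] a Nfilt_closed[OF a] by (simp add: Cent_def)
next
  case (Suc j)
  obtain c where c: "a = (\<Oplus>\<^bsub>BB\<^esub>i\<in>{..k}. c i \<otimes>\<^bsub>BB\<^esub> HB [^]\<^bsub>BB\<^esub> i)" "c \<in> {..k} \<rightarrow> Cent BB u"
    using a unfolding Nfilt_sum_HB by blast
  let ?b = "\<Oplus>\<^bsub>BB\<^esub>i\<in>{..j}. c i \<otimes>\<^bsub>BB\<^esub> HB [^]\<^bsub>BB\<^esub> i"
  have closed: "(\<lambda>i. c i \<otimes>\<^bsub>BB\<^esub> HB [^]\<^bsub>BB\<^esub> i) \<in> {..Suc j} \<rightarrow> carrier BB"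
    using c(2) Suc Cent_closed by (auto simp: Pi_iff)
  have ck: "c k \<in> Cent BB u" using c(2) by auto
  have a_eq: "a = c k \<otimes>\<^bsub>BB\<^esub> HB [^]\<^bsub>BB\<^esub> k \<oplus>\<^bsub>BB\<^esub> ?b"
    using BB.finsum_Suc[OF closed] c(1) Suc by simp
  have b: "?b \<in> Nfilt BB u (int j)"
    unfolding Nfilt_sum_HB using c(2) Suc by (intro CollectI exI[of _ c]) auto
  have "a \<ominus>\<^bsub>BB\<^esub> c k \<otimes>\<^bsub>BB\<^esub> HB [^]\<^bsub>BB\<^esub> k = ?b"
    unfolding a_eq using Cent_closed[OF ck] Nfilt_closed[OF b]
    by (simp add: minus_BB) (simp add: add_BB)
  then have "cls k a = cls k (c k \<otimes>\<^bsub>BB\<^esub> HB [^]\<^bsub>BB\<^esub> k)"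
    using b Suc Cent_closed[OF ck] Nfilt_closed[OF a] by (simp add: cls_eq_iff)
  then show ?thesis using ck that by blast
qed

text \<open>Evaluation at h in explicit form, using that elements of \<open>UP\<close> are
  coefficient functions. Its agreement with the library evaluation is shown in
  \<open>eval_iso\<close>.\<close>

definition Phi :: "(nat \<Rightarrow> int \<Rightarrow> 'k poly fract) \<Rightarrow> nat \<Rightarrow> (int \<Rightarrow> 'k poly fract) set" where
  "Phi p k = cls k (p k \<otimes>\<^bsub>BB\<^esub> HB [^]\<^bsub>BB\<^esub> k)"

abbreviation CC where "CC \<equiv> BB\<lparr>carrier := Cent BB u\<rparr>"

lemma finsum_CC:
  "finite A \<Longrightarrow> f \<in> A \<rightarrow> Cent BB u \<Longrightarrow> finsum CC f A = finsum BB f A"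
proof (induction A rule: finite_induct)
  case empty
  interpret cring CC by (rule cring_Cent)
  show ?case by simp
next
  case (insert i A)
  interpret cring CC by (rule cring_Cent)
  show ?case using insert Cent_closed by (auto simp: Pi_iff)
qed

lemma carrier_GG:
  "x \<in> carrier (GG u) \<longleftrightarrow>
    (\<forall>k. x k \<in> cls k ` Nfilt BB u (int k)) \<and> finite {k. x k \<noteq> Nfilt BB u (int k - 1)}"
proof -
  have "Group.group (gr_piece BB (Nfilt BB u) k)" for k
    using comm_group_gr_piece by (rule comm_group.axioms)
  then show ?thesis
    by (simp add: assoc_graded_def carrier_sum_group PiE_iff carrier_gr_piece one_gr_piece)
qed

lemma up_CC: "p \<in> up CC \<longleftrightarrow> (\<forall>i. p i \<in> Cent BB u) \<and> finite {i. p i \<noteq> \<zero>\<^bsub>BB\<^esub>}"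
proof -
  have "(\<exists>n. bound \<zero>\<^bsub>BB\<^esub> n p) \<longleftrightarrow> finite {i. p i \<noteq> \<zero>\<^bsub>BB\<^esub>}"
    unfolding bound_def finite_nat_set_iff_bounded_le by (auto simp: not_less[symmetric])
  then show ?thesis by (auto simp: up_def)
qed

text \<open>For products, moving H^i past the coefficient q (k - i) changes the result only by lower
  terms, so the graded convolution becomes the convolution of the coefficients times H^k.\<close>

lemma Phi_iso: "Phi \<in> ring_iso (UP CC) (GG u)"
proof (rule ring_iso_memI)
  interpret cring CC by (rule cring_Cent)
  fix p assume "p \<in> carrier (UP CC)"
  then have up: "p \<in> up CC" and p: "\<And>i. p i \<in> Cent BB u" "finite {i. p i \<noteq> \<zero>\<^bsub>BB\<^esub>}"
    using up_CC by (auto simp: UP_def)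
  have "{k. Phi p k \<noteq> Nfilt BB u (int k - 1)} \<subseteq> {i. p i \<noteq> \<zero>\<^bsub>BB\<^esub>}"
    by (auto simp: Phi_def cls_zero)
  then show "Phi p \<in> carrier (GG u)"
    using p Cent_HB_pow_mem finite_subset by (auto simp: carrier_GG Phi_def)
  fix q assume "q \<in> carrier (UP CC)"
  then have uq: "q \<in> up CC" and q: "\<And>i. q i \<in> Cent BB u" using up_CC by (auto simp: UP_def)
  show "Phi (p \<oplus>\<^bsub>UP CC\<^esub> q) = Phi p \<oplus>\<^bsub>GG u\<^esub> Phi q"
  proof
    fix k
    show "Phi (p \<oplus>\<^bsub>UP CC\<^esub> q) k = (Phi p \<oplus>\<^bsub>GG u\<^esub> Phi q) k"
      using p(1) q Cent_closed
      by (simp add: Phi_def UP_def up uq assoc_graded_def mult_gr_piece cls_add BB.l_distr)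
  qed
  show "Phi (p \<otimes>\<^bsub>UP CC\<^esub> q) = Phi p \<otimes>\<^bsub>GG u\<^esub> Phi q"
  proof
    fix k
    let ?x = "\<lambda>i. (p i \<otimes>\<^bsub>BB\<^esub> HB [^]\<^bsub>BB\<^esub> i) \<otimes>\<^bsub>BB\<^esub> (q (k - i) \<otimes>\<^bsub>BB\<^esub> HB [^]\<^bsub>BB\<^esub> (k - i))"
    let ?y = "\<lambda>i. (p i \<otimes>\<^bsub>BB\<^esub> q (k - i)) \<otimes>\<^bsub>BB\<^esub> HB [^]\<^bsub>BB\<^esub> k"
    have pq: "p i \<otimes>\<^bsub>BB\<^esub> q (k - i) \<in> Cent BB u" for i
      using subringE(6)[OF subring_Cent p(1) q] .
    have xy: "cls k (?x i) = cls k (?y i)" if "i \<le> k" for i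
    proof -
      note cl = Cent_closed[OF p(1)[of i]] Cent_closed[OF q[of "k - i"]]
      let ?d = "HB [^]\<^bsub>BB\<^esub> i \<otimes>\<^bsub>BB\<^esub> q (k - i) \<ominus>\<^bsub>BB\<^esub> q (k - i) \<otimes>\<^bsub>BB\<^esub> HB [^]\<^bsub>BB\<^esub> i"
      have d: "?d \<in> Nfilt BB u (int i - 1)" by (rule HB_pow_Cent_commute[OF q])
      have "(p i \<otimes>\<^bsub>BB\<^esub> ?d) \<otimes>\<^bsub>BB\<^esub> HB [^]\<^bsub>BB\<^esub> (k - i) \<in> Nfilt BB u (int 0 + (int i - 1) + int (k - i))"
        by (intro Nfilt_mult Cent_Nfilt p(1) d HB_pow_mem)
      then have "(p i \<otimes>\<^bsub>BB\<^esub> ?d) \<otimes>\<^bsub>BB\<^esub> HB [^]\<^bsub>BB\<^esub> (k - i) \<in> Nfilt BB u (int k - 1)"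
        using that by (simp add: of_nat_diff)
      moreover have "?x i \<ominus>\<^bsub>BB\<^esub> ?y i = (p i \<otimes>\<^bsub>BB\<^esub> ?d) \<otimes>\<^bsub>BB\<^esub> HB [^]\<^bsub>BB\<^esub> (k - i)"
      proof -
        have pow: "HB [^]\<^bsub>BB\<^esub> k = HB [^]\<^bsub>BB\<^esub> i \<otimes>\<^bsub>BB\<^esub> HB [^]\<^bsub>BB\<^esub> (k - i)"
          using that by (simp add: BB.nat_pow_mult)
        show ?thesis unfolding pow using cl
          by (simp add: a_minus_def BB.l_distr BB.r_distr BB.l_minus BB.r_minus BB.m_assoc)
      qed
      ultimately show ?thesis using cl by (simp add: cls_eq_iff)
    qed
    have ymem: "?y i \<in> Nfilt BB u (int k)" for i by (rule Cent_HB_pow_mem[OF pq])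
    have "(Phi p \<otimes>\<^bsub>GG u\<^esub> Phi q) k = finprod (gr_piece BB (Nfilt BB u) k)
        (\<lambda>i. rcoset_mult BB (Nfilt BB u (int k - 1)) (Phi p i) (Phi q (k - i))) {..k}"
      by (simp add: assoc_graded_def)
    also have "\<dots> = finprod (gr_piece BB (Nfilt BB u) k) (\<lambda>i. cls k (?y i)) {..k}"
    proof (rule comm_monoid.finprod_cong'[OF _ refl])
      show "comm_monoid (gr_piece BB (Nfilt BB u) k)"
        using comm_group_gr_piece by (rule comm_group.axioms)
      show "(\<lambda>i. cls k (?y i)) \<in> {..k} \<rightarrow> carrier (gr_piece BB (Nfilt BB u) k)"
        using ymem by (simp add: carrier_gr_piece)
      fix i assume "i \<in> {..k}"
      then show "rcoset_mult BB (Nfilt BB u (int k - 1)) (Phi p i) (Phi q (k - i)) = cls k (?y i)"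
        using rcoset_mult_cls[OF Cent_HB_pow_mem[OF p(1)] Cent_HB_pow_mem[OF q], of i "k - i" i "k - i"] xy[of i]
        by (simp add: Phi_def)
    qed
    also have "\<dots> = cls k (\<Oplus>\<^bsub>BB\<^esub>i\<in>{..k}. ?y i)" by (rule finprod_gr_piece) (auto intro: ymem)
    also have "(\<Oplus>\<^bsub>BB\<^esub>i\<in>{..k}. ?y i) = (\<Oplus>\<^bsub>BB\<^esub>i\<in>{..k}. p i \<otimes>\<^bsub>BB\<^esub> q (k - i)) \<otimes>\<^bsub>BB\<^esub> HB [^]\<^bsub>BB\<^esub> k"
      using pq Cent_closed by (intro BB.finsum_ldistr[symmetric]) auto
    also have "(\<Oplus>\<^bsub>BB\<^esub>i\<in>{..k}. p i \<otimes>\<^bsub>BB\<^esub> q (k - i)) = (p \<otimes>\<^bsub>UP CC\<^esub> q) k"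
      using pq by (simp add: UP_def up uq finsum_CC)
    finally show "Phi (p \<otimes>\<^bsub>UP CC\<^esub> q) k = (Phi p \<otimes>\<^bsub>GG u\<^esub> Phi q) k"
      unfolding Phi_def[of "p \<otimes>\<^bsub>UP CC\<^esub> q"] by (rule sym)
  qed
next
  show "Phi \<one>\<^bsub>UP CC\<^esub> = \<one>\<^bsub>GG u\<^esub>"
    by (rule ext) (simp add: Phi_def UP_def assoc_graded_def cls_zero, simp add: cls_def)
next
  show "bij_betw Phi (carrier (UP CC)) (carrier (GG u))"
    unfolding bij_betw_def
  proof
    show "inj_on Phi (carrier (UP CC))"
    proof (rule inj_onI)
      fix p q assume "p \<in> carrier (UP CC)" "q \<in> carrier (UP CC)" and eq: "Phi p = Phi q"
      then have p: "\<And>i. p i \<in> Cent BB u" and q: "\<And>i. q i \<in> Cent BB u"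
        using up_CC by (auto simp: UP_def)
      show "p = q"
      proof
        fix k
        note cl = Cent_closed[OF p[of k]] Cent_closed[OF q[of k]]
        have "p k \<otimes>\<^bsub>BB\<^esub> HB [^]\<^bsub>BB\<^esub> k \<ominus>\<^bsub>BB\<^esub> q k \<otimes>\<^bsub>BB\<^esub> HB [^]\<^bsub>BB\<^esub> k \<in> Nfilt BB u (int k - 1)"
          using fun_cong[OF eq, of k] cl by (simp add: Phi_def cls_eq_iff)
        then have "(p k \<ominus>\<^bsub>BB\<^esub> q k) \<otimes>\<^bsub>BB\<^esub> HB [^]\<^bsub>BB\<^esub> k \<in> Nfilt BB u (int k - 1)"
          using cl by (simp add: a_minus_def BB.l_distr BB.l_minus)
        moreover have "p k \<ominus>\<^bsub>BB\<^esub> q k \<in> Cent BB u"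
          using Nfilt_minus[OF Cent_Nfilt[OF p] Cent_Nfilt[OF q]] by (simp add: Cent_def)
        ultimately have "p k \<ominus>\<^bsub>BB\<^esub> q k = \<zero>\<^bsub>BB\<^esub>" using Cent_HB_pow_cancel by blast
        then show "p k = q k" using cl by simp
      qed
    qed
    show "Phi ` carrier (UP CC) = carrier (GG u)"
    proof (intro equalityI subsetI)
      fix x assume "x \<in> carrier (GG u)"
      then have x: "\<And>k. x k \<in> cls k ` Nfilt BB u (int k)" "finite {k. x k \<noteq> Nfilt BB u (int k - 1)}"
        by (auto simp: carrier_GG)
      \<comment> \<open>The last condition makes finiteness of the support of the chosen
        coefficients immediate.\<close>
      have "\<exists>c. c \<in> Cent BB u \<and> x k = cls k (c \<otimes>\<^bsub>BB\<^esub> HB [^]\<^bsub>BB\<^esub> k) \<and>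
          (x k = Nfilt BB u (int k - 1) \<longrightarrow> c = \<zero>\<^bsub>BB\<^esub>)" for k
      proof (cases "x k = Nfilt BB u (int k - 1)")
        case True
        then show ?thesis using subringE(2)[OF subring_Cent]
          by (intro exI[of _ "\<zero>\<^bsub>BB\<^esub>"]) (simp add: cls_zero)
      next
        case False
        obtain a where a: "a \<in> Nfilt BB u (int k)" "x k = cls k a" using x(1) by blast
        then show ?thesis using Nfilt_top_coeff[OF a(1)] False by metis
      qed
      then obtain p where p: "\<And>k. p k \<in> Cent BB u" "\<And>k. x k = cls k (p k \<otimes>\<^bsub>BB\<^esub> HB [^]\<^bsub>BB\<^esub> k)"
        "\<And>k. x k = Nfilt BB u (int k - 1) \<Longrightarrow> p k = \<zero>\<^bsub>BB\<^esub>" by metis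
      have "{k. p k \<noteq> \<zero>\<^bsub>BB\<^esub>} \<subseteq> {k. x k \<noteq> Nfilt BB u (int k - 1)}" using p(3) by auto
      then have "finite {k. p k \<noteq> \<zero>\<^bsub>BB\<^esub>}" using x(2) by (rule finite_subset)
      then have "p \<in> carrier (UP CC)" using p(1) by (simp add: UP_def up_CC)
      moreover have "x = Phi p" using p(2) by (auto simp: Phi_def)
      ultimately show "x \<in> Phi ` carrier (UP CC)" by blast
    next
      fix x assume "x \<in> Phi ` carrier (UP CC)"
      then obtain p where x: "x = Phi p" "p \<in> up CC" by (auto simp: UP_def)
      then have p: "\<And>i. p i \<in> Cent BB u" "finite {i. p i \<noteq> \<zero>\<^bsub>BB\<^esub>}" using up_CC by auto
      have "{k. Phi p k \<noteq> Nfilt BB u (int k - 1)} \<subseteq> {i. p i \<noteq> \<zero>\<^bsub>BB\<^esub>}"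
        by (auto simp: Phi_def cls_zero)
      then show "x \<in> carrier (GG u)"
        using p Cent_HB_pow_mem finite_subset by (auto simp: carrier_GG Phi_def x(1))
    qed
  qed
qed

lemma cring_GG: "cring (GG u)"
proof -
  interpret UP_cring CC "UP CC" by (intro UP_cring.intro cring_Cent)
  \<comment> \<open>\<open>ring_iso\<close> does not speak of zeros, so the zero of
    \<open>GG u\<close> is identified with the image of zero separately.\<close>
  have "Phi \<zero>\<^bsub>UP CC\<^esub> = \<zero>\<^bsub>GG u\<^esub>"
    by (rule ext) (simp add: Phi_def UP_def assoc_graded_def one_gr_piece cls_zero)
  then show ?thesis using P.ring_iso_imp_img_cring[OF Phi_iso] by simp
qed

lemma gr_class_0_eq:
  assumes "c \<in> Cent BB u"
  shows "gr_class BB (Nfilt BB u) 0 c = Phi (up_ring.monom (UP CC) c 0)"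
  using assms Cent_closed[OF assms]
  by (intro ext) (simp add: gr_class_def Phi_def UP_def cls_zero, simp add: cls_def)

lemma gr_class_1_eq: "gr_class BB (Nfilt BB u) 1 HB = Phi (up_ring.monom (UP CC) \<one>\<^bsub>BB\<^esub> 1)"
  using subringE(3)[OF subring_Cent]
  by (intro ext) (simp add: gr_class_def Phi_def UP_def cls_zero, simp add: cls_def)

text \<open>\<open>Phi\<close> is a homomorphism and sends the monomial with coefficient c and
  exponent i to the class of c times h^i, so it agrees with the evaluation on every
  polynomial.\<close>

lemma eval_iso:
  "UnivPoly.eval CC (GG u) (gr_class BB (Nfilt BB u) 0) (gr_class BB (Nfilt BB u) 1 HB)
     \<in> ring_iso (UP CC) (GG u)"
proof -
  interpret UP_cring CC "UP CC" by (intro UP_cring.intro cring_Cent)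
  interpret G: cring "GG u" by (rule cring_GG)
  have hom: "Phi \<in> ring_hom (UP CC) (GG u)" using Phi_iso by (simp add: ring_iso_def)
  interpret Phi: ring_hom_cring "UP CC" "GG u" Phi
    by (intro ring_hom_cringI UP_cring cring_GG hom)
  have one: "\<one>\<^bsub>BB\<^esub> \<in> carrier CC" using subringE(3)[OF subring_Cent] by simp
  show ?thesis
  proof (rule P.ring_iso_restrict[OF Phi_iso])
    fix p assume p: "p \<in> carrier (UP CC)"
    have summand: "Phi (up_ring.monom (UP CC) c i) =
        gr_class BB (Nfilt BB u) 0 c \<otimes>\<^bsub>GG u\<^esub> gr_class BB (Nfilt BB u) 1 HB [^]\<^bsub>GG u\<^esub> i"
      if "c \<in> Cent BB u" for c i
    proof -
      have "up_ring.monom (UP CC) c i =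
          up_ring.monom (UP CC) c 0 \<otimes>\<^bsub>UP CC\<^esub> up_ring.monom (UP CC) \<one>\<^bsub>BB\<^esub> 1 [^]\<^bsub>UP CC\<^esub> i"
        using that one monom_pow[OF one, of 1 i] monom_mult[of c "\<one>\<^bsub>BB\<^esub>" 0 i] Cent_closed[OF that]
          R.nat_pow_one[of i] by simp
      then show ?thesis
        using that one by (simp add: gr_class_0_eq gr_class_1_eq[simplified])
    qed
    have "Phi p = Phi (\<Oplus>\<^bsub>UP CC\<^esub>i\<in>{..deg CC p}. up_ring.monom (UP CC) (up_ring.coeff (UP CC) p i) i)"
      using up_repr[OF p] by simp
    also have "\<dots> = (\<Oplus>\<^bsub>GG u\<^esub>i\<in>{..deg CC p}. Phi (up_ring.monom (UP CC) (up_ring.coeff (UP CC) p i) i))"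
      using monom_closed[OF coeff_closed[OF p]] by (subst Phi.hom_finsum) (simp_all add: comp_def)
    also have "\<dots> = UnivPoly.eval CC (GG u) (gr_class BB (Nfilt BB u) 0)
        (gr_class BB (Nfilt BB u) 1 HB) p"
      using p coeff_closed[OF p] by (simp add: UnivPoly.eval_def summand)
    finally show "Phi p = UnivPoly.eval CC (GG u) (gr_class BB (Nfilt BB u) 0)
        (gr_class BB (Nfilt BB u) 1 HB) p" .
  qed
qed

lemma affine_GG: "affine_algebra (\<lambda>c. gr_class BB (Nfilt BB u) 0 (scalarB c)) (GG u)"
  using affine_algebra_iso[OF affine_algebra_UP[OF affine_Cent cring_Cent] _ Phi_iso]
    cring.axioms(1)[OF cring_GG] by (simp add: gr_class_0_eq scalarB_Cent)

end

theorem theorem2p3: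
  shows
    "(\<forall>(\<alpha> :: 'k::field_char_0 poly fract) n u.
        n \<noteq> 0 \<longrightarrow> \<alpha> \<noteq> 0 \<longrightarrow> monic_fract \<alpha> \<longrightarrow> u = lmonom \<alpha> n \<longrightarrow>
        Nalg BB u = algebra_generated scalarB BB (Cent BB u \<union> {HB}) \<and>
        (\<forall>t \<beta> v. canonical_generator \<alpha> n t \<beta> \<longrightarrow> v = lmonom \<beta> t \<longrightarrow>
           laurent_subst KpolyH BB (\<lambda>a. lmonom a 0) v
             \<in> ring_iso (skew_laurent KpolyH (sigma_pow t)) (BB\<lparr>carrier := Nalg BB u\<rparr>)) \<and>
        affine_algebra scalarB (BB\<lparr>carrier := Nalg BB u\<rparr>) \<and>
        lr_noetherian (BB\<lparr>carrier := Nalg BB u\<rparr>) \<and>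
        (\<forall>j::nat.
           Nfilt BB u (int j) =
             {\<Oplus>\<^bsub>BB\<^esub>i\<in>{..j}. c i \<otimes>\<^bsub>BB\<^esub> HB [^]\<^bsub>BB\<^esub> i | c. c \<in> {..j} \<rightarrow> Cent BB u} \<and>
           HB [^]\<^bsub>BB\<^esub> j \<in> Nfilt BB u (int j) - Nfilt BB u (int j - 1)) \<and>
        UnivPoly.eval (BB\<lparr>carrier := Cent BB u\<rparr>) (GG u)
            (gr_class BB (Nfilt BB u) 0) (gr_class BB (Nfilt BB u) 1 HB)
          \<in> ring_iso (UP (BB\<lparr>carrier := Cent BB u\<rparr>)) (GG u) \<and>
        affine_algebra (\<lambda>c. gr_class BB (Nfilt BB u) 0 (scalarB c)) (GG u) \<and>
        cring (GG u)) \<and>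
     (\<forall>u :: int \<Rightarrow> 'k poly fract.
        u \<in> range (\<lambda>a. lmonom a 0) - range scalarB \<longrightarrow>
        Nalg BB u = Cent BB u \<and> Cent BB u = range (\<lambda>a. lmonom a 0))"
proof (intro conjI allI impI)
  fix \<alpha> :: "'k poly fract" and n u
  assume *: "n \<noteq> 0" "\<alpha> \<noteq> 0" "monic_fract \<alpha>" "u = lmonom \<alpha> n"
  \<comment> \<open>These conclusions do not mention a canonical generator, so any one may supply
    the normal form.\<close>
  obtain t \<beta> where "canonical_generator \<alpha> n t \<beta>"
    using canonical_generator_exists[OF *(1,3)] by blast
  then interpret canonical \<alpha> \<beta> n t by unfold_locales (rule *)
  show "Nalg BB u = algebra_generated scalarB BB (Cent BB u \<union> {HB})"
    unfolding *(4) by (rule Nalg_algebra_generated)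
  show "affine_algebra scalarB (BB\<lparr>carrier := Nalg BB u\<rparr>)" unfolding *(4) by (rule affine_Nalg)
  show "lr_noetherian (BB\<lparr>carrier := Nalg BB u\<rparr>)" unfolding *(4) by (rule noetherian_Nalg)
  show "UnivPoly.eval (BB\<lparr>carrier := Cent BB u\<rparr>) (GG u)
      (gr_class BB (Nfilt BB u) 0) (gr_class BB (Nfilt BB u) 1 HB)
    \<in> ring_iso (UP (BB\<lparr>carrier := Cent BB u\<rparr>)) (GG u)" unfolding *(4) by (rule eval_iso)
  show "affine_algebra (\<lambda>c. gr_class BB (Nfilt BB u) 0 (scalarB c)) (GG u)"
    unfolding *(4) by (rule affine_GG)
  show "cring (GG u)" unfolding *(4) by (rule cring_GG)
  fix j :: nat
  show "Nfilt BB u (int j) =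
      {\<Oplus>\<^bsub>BB\<^esub>i\<in>{..j}. c i \<otimes>\<^bsub>BB\<^esub> HB [^]\<^bsub>BB\<^esub> i | c. c \<in> {..j} \<rightarrow> Cent BB u}"
    unfolding *(4) by (rule Nfilt_sum_HB)
  show "HB [^]\<^bsub>BB\<^esub> j \<in> Nfilt BB u (int j) - Nfilt BB u (int j - 1)"
    unfolding *(4) by (rule HB_pow_Nfilt)
next
  fix \<alpha> \<beta> :: "'k poly fract" and n t u v
  assume *: "n \<noteq> 0" "u = lmonom \<alpha> n" "canonical_generator \<alpha> n t \<beta>" "v = lmonom \<beta> t"
  \<comment> \<open>Here the canonical generator is prescribed by the statement, so the locale is
    instantiated afresh.\<close>
  interpret canonical \<alpha> \<beta> n t by unfold_locales (rule *)+
  show "laurent_subst KpolyH BB (\<lambda>a. lmonom a 0) v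
      \<in> ring_iso (skew_laurent KpolyH (sigma_pow t)) (BB\<lparr>carrier := Nalg BB u\<rparr>)"
    unfolding *(2,4) by (rule laurent_subst_iso)
next
  fix u :: "int \<Rightarrow> 'k poly fract"
  assume "u \<in> range (\<lambda>a. lmonom a 0) - range scalarB"
  then obtain a where a: "u = lmonom a 0" "u \<notin> range scalarB" by blast
  have N: "Nfilt BB u (int j) = range (\<lambda>a. lmonom a 0)" for j
    by (rule Nfilt_degree_zero[OF a])
  show C: "Cent BB u = range (\<lambda>a. lmonom a 0)" using N[of 0] by (simp add: Cent_def)
  show "Nalg BB u = Cent BB u" unfolding C by (simp add: Nalg_def N)
qed

end
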